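(* Let $k\in\{9,10,11\}$. Then the set of odd positive integers $n$ with $s(n)=s(n^2)=k$ is finite.
   Context: For a nonnegative integer $n$, $s(n)$ denotes the sum of the digits of $n$ in base $2$ (the number of $1$'s in the binary expansion of $n$). *)

theory Defs
  imports Main
begin

fun binary_digit_sum :: "nat \<Rightarrow> nat" where
  "binary_digit_sum n = (if n = 0 then 0 else n mod 2 + binary_digit_sum (n div 2))"

(* The unconditional equation makes the simplifier loop. *)
declare binary_digit_sum.simps [simp del]

lemma binary_digit_sum_eq_card_bits: "binary_digit_sum n = card {i. bit n i}"
proof (induction n rule: binary_digit_sum.induct)
  case (1 n)
  show ?case
  proof (cases "n = 0")
    case True
    then show ?thesis by (simp add: binary_digit_sum.simps)
  next
    case False
    have "i < m" if "bit m i" for m i :: nat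
    proof (rule ccontr)
      assume "\<not> i < m"
      then have "m < 2 ^ i"
        using less_exp [of i] by linarith
      with that show False by (simp add: bit_iff_odd)
    qed
    then have fin: "finite {i. bit (n div 2) i}"
      by (auto intro: finite_subset [of _ "{..<n div 2}"])
    have "{i. bit n i} = (if odd n then {0} else {}) \<union> Suc ` {i. bit (n div 2) i}"
    proof (rule set_eqI)
      fix i
      show "i \<in> {i. bit n i} \<longleftrightarrow>
        i \<in> (if odd n then {0} else {}) \<union> Suc ` {i. bit (n div 2) i}"
        by (cases i) (auto simp: bit_0 bit_Suc)
    qed
    then have "card {i. bit n i} = n mod 2 + card {i. bit (n div 2) i}"
      using fin by (cases "odd n") (auto simp: card_image odd_iff_mod_2_eq_one)
    with False 1 show ?thesis by (simp add: binary_digit_sum.simps [of n])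
  qed
qed

end

theory Submission
  imports Defs
begin

text \<open>
  If \<open>n\<close> is large but has at most 11 ones, its ones fall into \<open>r \<ge> 2\<close> clusters: \<open>n = \<Sum>i. B i * 2 ^ e i\<close>
  with \<open>B i\<close> odd and gaps that are huge compared with the lengths of the \<open>B i\<close>. The square is the sum of the terms
  \<open>B i * B j\<close> at the positions \<open>e i + e j\<close>, and terms at distant positions contribute independently to the digit sum.
  There are at least \<open>2 r - 1\<close> distant positions, and no more only if the \<open>e i\<close> are almost in arithmetic
  progression. In each case the digit sum of the square is strictly larger than that of \<open>n\<close>.

  For \<open>r = 2\<close> this says \<open>s a + s b < s (a\<^sup>2) + s (a * b) + s (b\<^sup>2)\<close> whenever \<open>s a + s b \<le> 11\<close>. A counterexample would have
  a factor whose square has at most 4 ones; these factors are \<open>2 ^ m + 1\<close> and finitely many others. For each of them the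
  \<open>b\<close> with \<open>s (a * b) \<le> 3\<close> are found by a search from the lowest digit upwards.
\<close>

section \<open>Binary digit sums\<close>

text \<open>The proof is shaped by a tight count. The positions \<open>e 0 + e 0\<close>,
  \<open>e 0 + e 1\<close>, up to \<open>e 0 + e (r - 1)\<close>, then
  \<open>e 1 + e (r - 1)\<close> up to \<open>e (r - 1) + e (r - 1)\<close>, are
  \<open>2 * r - 1\<close> distant ones, so \<open>r >= 7\<close> is settled by 13 > 11. For smaller
  \<open>r\<close> the four extreme index pairs never collide with another term and count with their
  full digit sums, while a middle position guarantees only a single one. The loss occurs exactly
  where middle terms collide; such a sum contributes a single one only if it is a power of two,
  which congruences modulo 4 and 8 mostly exclude. For two clusters a sparse square exists because
  \<open>s (a * b) >= 2\<close> leaves at most 9 ones for two squares. What counts as a cluster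
  depends on a scale, since gaps must be huge compared with the current lengths. Two clusters that
  are too close are merged, which enlarges the scale by an amount independent of \<open>n\<close>.
  With at most 11 ones there are at most 10 mergers, so either a separated decomposition appears or
  \<open>n\<close> lies below a bound fixed in advance.\<close>

abbreviation s :: "nat \<Rightarrow> nat" where "s \<equiv> binary_digit_sum"

lemma s_0 [simp]: "s 0 = 0"
  by (simp add: binary_digit_sum.simps)

lemma s_double [simp]: "s (2 * n) = s n"
  by (cases "n = 0") (simp_all add: binary_digit_sum.simps [of "2 * n"])

lemma s_double_Suc [simp]: "s (Suc (2 * n)) = Suc (s n)"
  by (subst binary_digit_sum.simps) simp

lemma s_rec: "s n = n mod 2 + s (n div 2)"
  by (cases "n = 0") (simp_all add: binary_digit_sum.simps [of n])

lemma s_1 [simp]: "s 1 = 1" "s (Suc 0) = 1"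
  using s_double_Suc [of 0] by simp_all

lemma s_numeral [simp]:
  "s (numeral (num.Bit0 w)) = s (numeral w)"
  "s (numeral (num.Bit1 w)) = Suc (s (numeral w))"
proof -
  have "numeral (num.Bit0 w) = 2 * (numeral w :: nat)"
    by simp
  then show "s (numeral (num.Bit0 w)) = s (numeral w)" by (simp only: s_double)
  have "numeral (num.Bit1 w) = Suc (2 * (numeral w :: nat))"
    by simp
  then show "s (numeral (num.Bit1 w)) = Suc (s (numeral w))" by (simp only: s_double_Suc)
qed

lemma s_pow_mult [simp]: "s (2 ^ p * n) = s n"
  by (induction p) (simp_all add: mult.assoc)

lemma s_mult_pow [simp]: "s (n * 2 ^ p) = s n"
  by (subst mult.commute) (rule s_pow_mult)

lemma s_pow [simp]: "s (2 ^ p) = 1"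
  using s_pow_mult [of p 1] by simp

lemma s_eq_0_iff [simp]: "s n = 0 \<longleftrightarrow> n = 0"
proof (induction n rule: less_induct)
  case (less n)
  show ?case
  proof (cases "n = 0")
    case False
    then have "s n = n mod 2 + s (n div 2)" "s (n div 2) = 0 \<longleftrightarrow> n div 2 = 0"
      using less [of "n div 2"] s_rec [of n] by auto
    with False show ?thesis by auto
  qed simp
qed

lemma s_pos: "n > 0 \<Longrightarrow> s n \<ge> 1"
  using s_eq_0_iff [of n] by linarith

lemma s_split: "a < 2 ^ p \<Longrightarrow> s (a + 2 ^ p * b) = s a + s b"
proof (induction p arbitrary: a)
  case (Suc p)
  have "(a + 2 ^ Suc p * b) div 2 = a div 2 + 2 ^ p * b" "(a + 2 ^ Suc p * b) mod 2 = a mod 2"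
    by (simp_all add: mult.assoc)
  moreover have "a div 2 < 2 ^ p" using Suc.prems by simp
  ultimately show ?case
    using Suc.IH [of "a div 2"] s_rec [of "a + 2 ^ Suc p * b"] s_rec [of a] by simp
qed simp

lemma s_mod_div: "s n = s (n mod 2 ^ p) + s (n div 2 ^ p)"
  using s_split [of "n mod 2 ^ p" p "n div 2 ^ p"] by simp

lemma s_mod_le: "s (n mod 2 ^ p) \<le> s n"
  using s_mod_div [of n p] by simp

lemma s_eq_1_iff: "s n = Suc 0 \<longleftrightarrow> (\<exists>c. n = 2 ^ c)"
proof
  show "s n = Suc 0 \<Longrightarrow> \<exists>c. n = 2 ^ c"
  proof (induction n rule: less_induct)
    case (less n)
    have n: "n \<noteq> 0" using less.prems by (intro notI) simp
    show ?case
    proof (cases "even n")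
      case True
      then obtain m where m: "n = 2 * m" by blast
      then have "\<exists>c. m = 2 ^ c" using less n by auto
      then obtain c where "m = 2 ^ c" ..
      then show ?thesis using m by (intro exI [of _ "Suc c"]) simp
    next
      case False
      then obtain m where m: "n = 2 * m + 1" by (auto elim: oddE)
      then have "n = 1" using less.prems by simp
      then show ?thesis by (intro exI [of _ 0]) simp
    qed
  qed
qed auto

lemma odd_s_eq_1: "odd n \<Longrightarrow> s n = 1 \<Longrightarrow> n = 1"
  by (auto simp: s_eq_1_iff)

lemma odd_s_ge_2: "odd n \<Longrightarrow> n \<noteq> 1 \<Longrightarrow> s n \<ge> 2"
  using odd_s_eq_1 [of n] s_pos [of n] by (cases "n = 0"; cases "s n = 1") auto

lemma s_shift_odd:
  assumes "n > 0" obtains p m where "n = 2 ^ p * m" "odd m" "s m = s n"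
proof -
  have "\<exists>p m. n = 2 ^ p * m \<and> odd m" using assms
  proof (induction n rule: less_induct)
    case (less n)
    show ?case
    proof (cases "even n")
      case True
      then obtain k where k: "n = 2 * k" by blast
      then obtain p m where "k = 2 ^ p * m" "odd m" using less.IH [of k] less.prems by auto
      then show ?thesis using k by (intro exI [of _ "Suc p"] exI [of _ m]) simp
    next
      case False
      then show ?thesis by (intro exI [of _ 0] exI [of _ n]) simp
    qed
  qed
  then show ?thesis using that by auto
qed

lemma odd_dvd_pow2: "odd (d::nat) \<Longrightarrow> d dvd 2 ^ c \<Longrightarrow> d = 1"
  using coprime_absorb_left [of d "2 ^ c"] by simp

text \<open>A power of two has no odd divisor except 1. This is the basic lower bound for every
  cross term below.\<close>

lemma s_odd_mult_ge_2:
  assumes "odd d" "d \<noteq> 1" "n > 0" shows "s (d * n) \<ge> 2"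
proof -
  have "s (d * n) \<noteq> 1"
  proof
    assume "s (d * n) = 1"
    then obtain c where "d * n = 2 ^ c" by (auto simp: s_eq_1_iff)
    then have "d dvd 2 ^ c" by (metis dvd_triv_left)
    then show False using odd_dvd_pow2 assms by blast
  qed
  moreover have "s (d * n) \<ge> 1" using assms by (intro s_pos) (auto intro: Nat.gr0I)
  ultimately show ?thesis by simp
qed

lemma odd_s_2: assumes "odd n" "s n = 2" obtains c where "n = 1 + 2 ^ c" "c \<ge> 1"
proof -
  obtain m where m: "n = 2 * m + 1" using assms by (auto elim: oddE)
  then have "s m = 1" using assms by simp
  then obtain c where "m = 2 ^ c" by (auto simp: s_eq_1_iff)
  then show ?thesis using m that [of "Suc c"] by simp
qed

lemma s_compl_sum: "w + z + 1 = 2 ^ m \<Longrightarrow> s w + s z = m"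
proof (induction m arbitrary: w z)
  case (Suc m)
  define P :: nat where "P = 2 ^ m"
  have "w + z + 1 = 2 * P" using Suc.prems by (simp add: P_def)
  then have "w div 2 + z div 2 + 1 = P" "w mod 2 + z mod 2 = 1" by presburger+
  then show ?case
    using Suc.IH [of "w div 2" "z div 2"] s_rec [of w] s_rec [of z] by (simp add: P_def)
qed simp

lemma s_compl: "z < 2 ^ m \<Longrightarrow> s (2 ^ m - 1 - z) + s z = m"
  by (rule s_compl_sum) simp

text \<open>Modulo \<open>2 ^ m\<close>, \<open>a\<close> is \<open>- z\<close>, which is the
  bitwise complement of \<open>z - 1\<close>. Hence a number congruent to the negative of a small
  one must have many ones; this is the source of all contradictions with the bound on the number of
  ones.\<close>

lemma s_neg:
  assumes "(a + z) mod 2 ^ m = 0" "0 < z" 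
  shows "s (a mod 2 ^ m) + s ((z - 1) mod 2 ^ m) = m"
proof -
  define u where "u = (z - 1) mod 2 ^ m"
  have u: "u < 2 ^ m" by (simp add: u_def)
  have "(a + z) mod 2 ^ m = (a mod 2 ^ m + u + 1) mod 2 ^ m"
  proof -
    have "a + z = a + (z - 1) + 1" using assms(2) by simp
    then have "(a + z) mod 2 ^ m = (a + (z - 1) + 1) mod 2 ^ m" by simp
    also have "\<dots> = (a mod 2 ^ m + u + 1) mod 2 ^ m"
      unfolding u_def by (metis mod_add_eq mod_add_left_eq)
    finally show ?thesis .
  qed
  then have "2 ^ m dvd (a mod 2 ^ m + u + 1)" using assms(1) by (simp add: mod_eq_0_iff_dvd)
  then obtain q where q: "a mod 2 ^ m + u + 1 = 2 ^ m * q" by (rule dvdE)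
  moreover have "a mod 2 ^ m + u + 1 < 2 ^ m * 2" 
  proof -
    have "a mod 2 ^ m < 2 ^ m" by simp
    then show ?thesis using u by linarith
  qed
  ultimately have "2 ^ m * q < 2 ^ m * (2::nat)" by simp
  then have "q < 2" by simp
  moreover have "q \<noteq> 0" using q by (intro notI) simp
  ultimately have "q = 1" by simp
  then have "a mod 2 ^ m + u + 1 = 2 ^ m" using q by simp
  then have "a mod 2 ^ m = 2 ^ m - 1 - u" by simp
  then show ?thesis using s_compl [OF u] by (simp add: u_def)
qed

lemma s_pred_pow: "s (2 ^ m - 1) = m"
  using s_compl [of 0 m] by simp

section \<open>Sparse squares\<close>

lemma s_add_le: "s (a + b) \<le> s a + s b"
proof (induction a arbitrary: b rule: less_induct)
  case (less a)
  show ?case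
  proof (cases "a = 0")
    case False
    \<comment> \<open>\<open>c\<close> is a carry: it is put into the free summand, so that the
      induction hypothesis applies to \<open>a div 2\<close>.\<close>
    then have IH: "s (a div 2 + b div 2 + c) \<le> s (a div 2) + s (b div 2 + c)" for c
      using less [of "a div 2" "b div 2 + c"] by (simp add: add.assoc)
    have suc: "s (x + 1) \<le> s x + 1" for x
    proof (induction x rule: less_induct)
      case (less x)
      show ?case
      proof (cases "even x")
        case True
        then show ?thesis by (elim evenE) simp
      next
        case False
        then obtain k where k: "x = 2 * k + 1" by (auto elim: oddE)
        then have "s (x + 1) = s (2 * (k + 1))" by simp
        also have "\<dots> = s (k + 1)" by (rule s_double)
        finally have "s (x + 1) = s (k + 1)" .
        with less [of k] k show ?thesis by simp
      qed
    qed
    show ?thesis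
    proof (cases "odd a \<and> odd b")
      case True
      then obtain x y where xy: "a = 2 * x + 1" "b = 2 * y + 1" by (auto elim!: oddE)
      have "s (a + b) = s (2 * (x + y + 1))" using xy by simp
      also have "\<dots> = s (x + y + 1)" by (rule s_double)
      finally show ?thesis using IH [of 1] suc [of y] xy by simp
    next
      case False
      then have "a mod 2 + b mod 2 < 2" by (cases "odd a") (simp_all add: odd_iff_mod_2_eq_one)
      then have m: "(a + b) mod 2 = a mod 2 + b mod 2" by (metis mod_add_eq mod_less)
      moreover have "(a + b) div 2 = a div 2 + b div 2"
        using \<open>a mod 2 + b mod 2 < 2\<close> unfolding div_add1_eq [of a b 2] by simp
      ultimately have "s (a + b) = (a mod 2 + b mod 2) + s (a div 2 + b div 2)"
        by (subst s_rec) (simp only:)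
      also have "\<dots> \<le> (a mod 2 + b mod 2) + (s (a div 2) + s (b div 2))"
        using IH [of 0] by simp
      also have "\<dots> = (a mod 2 + s (a div 2)) + (b mod 2 + s (b div 2))"
        by (simp only: ac_simps)
      also have "\<dots> = s a + s b" by (simp only: s_rec [symmetric])
      finally show ?thesis .
    qed
  qed simp
qed

lemma s_eq_2_cases:
  assumes "s n = 2" obtains i c where "n = 2 ^ i + 2 ^ c" "i < c"
proof -
  have "n > 0" using assms by (intro Nat.gr0I) simp
  then obtain p m where p: "n = 2 ^ p * m" "odd m" "s m = s n" by (rule s_shift_odd)
  then obtain c where "m = 1 + 2 ^ c" "c \<ge> 1" using assms by (auto elim: odd_s_2)
  then show ?thesis using p that [of p "p + c"] by (simp add: algebra_simps power_add)
qed

text \<open>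
  Here \<open>1 + 2 ^ Suc h * y\<close> is the number squared. A sparse square forces digits of \<open>y\<close> above position \<open>h\<close> to agree with
  those of a small negative number, hence to be mostly ones, which \<open>s y \<le> 8\<close> excludes.
\<close>

lemma sparse_square_step_one:
  assumes y: "odd y" "s y \<le> 8" and h: "h \<ge> 10" and sq: "s (y + 2 ^ h * y\<^sup>2) \<le> 3"
  shows "y = 1"
proof -
  define Q :: nat where "Q = 2 ^ h"
  define m where "m = Suc h"
  define z w where "z = y mod Q" and "w = y div Q"
  have y_eq: "y = z + Q * w" by (simp add: z_def w_def)
  have Qd: "2 * Q = 2 ^ m" by (simp add: Q_def m_def)
  have "2 ^ m * 2 ^ (h - 1) = Q * Q" using h by (cases h) (simp_all add: Q_def m_def power_add)
  then have dvdQ: "(2::nat) ^ m dvd Q * Q" by (metis dvd_triv_left)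
  have zQ: "z < 2 ^ h" by (simp add: z_def Q_def)
  have sy: "s y = s z + s w" using s_split [OF zQ, of w] y_eq by (simp add: Q_def)
  have "y + 2 ^ h * y\<^sup>2 = z + 2 ^ h * (w + y\<^sup>2)" 
    using y_eq by (simp add: Q_def algebra_simps)
  then have s3: "s z + s (w + y\<^sup>2) \<le> 3" using sq s_split [OF zQ, of "w + y\<^sup>2"] by simp
  have oz: "odd z" using y y_eq h by (simp add: Q_def)
  have y2: "y\<^sup>2 = z\<^sup>2 + 2 ^ m * (z * w) + Q * Q * w\<^sup>2"
    unfolding y_eq Qd [symmetric] by (simp add: power2_eq_square algebra_simps)
  \<comment> \<open>\<open>w\<close> would end in \<open>m\<close> ones, and \<open>m >= 11\<close>
    exceeds the 8 available.\<close>
  have neg: False if "(w + 1) mod 2 ^ m = 0"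
  proof -
    have "s (w mod 2 ^ m) = m" using s_neg [OF that] by simp
    then show False using s_mod_le [of w m] sy y(2) h unfolding m_def by linarith
  qed
  \<comment> \<open>\<open>Q * Q\<close> is itself the power \<open>2 ^ (h + h)\<close>, so a power
    of two above half of it is a multiple of it.\<close>
  have big: "Q * Q \<le> 2 ^ c" if "Q * Q < 2 * 2 ^ c" for c
  proof -
    have "(2::nat) ^ (h + h) < 2 ^ Suc c" using that by (simp add: Q_def power_add)
    then have "h + h < Suc c" by (rule power_less_imp_less_exp [rotated]) simp
    then have "(2::nat) ^ (h + h) \<le> 2 ^ c" by (intro power_increasing) auto
    then show ?thesis by (simp add: Q_def power_add)
  qed
  have dvdc: "Q * Q dvd 2 ^ c" if "Q * Q < 2 * 2 ^ c" for c
    using big [OF that] unfolding Q_def power_add [symmetric]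
    by (intro le_imp_power_dvd) simp
  show ?thesis
  proof (cases "w = 0")
    case True
    then have yz: "y = z" using y_eq by simp
    show ?thesis
    proof (rule ccontr)
      assume "y \<noteq> 1"
      then have "s y \<ge> 2" "s (y * y) \<ge> 2"
        using odd_s_ge_2 s_odd_mult_ge_2 [of y y] y by (auto intro: Nat.gr0I)
      with s3 True yz show False by (simp add: power2_eq_square)
    qed
  next
    case False
    have pos: "s (w + y\<^sup>2) \<ge> 1" using False by (intro s_pos) simp
    have "s z \<ge> 1" using oz by (intro s_pos) (auto intro: Nat.gr0I)
    have lowb: "Q * Q < w + y\<^sup>2"
    proof -
      have "Q * Q * 1 \<le> Q * Q * w\<^sup>2" using False by (intro mult_left_mono) auto
      then show ?thesis using y2 False by linarith
    qed
    consider "s z = 1" "s (w + y\<^sup>2) = 1" | "s z = 1" "s (w + y\<^sup>2) = 2" 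
      | "s z = 2" "s (w + y\<^sup>2) = 1" using s3 pos \<open>s z \<ge> 1\<close> by linarith
    then have False
    proof cases
      case 1
      then have "z = 1" using oz odd_s_eq_1 by blast
      obtain c where c: "w + y\<^sup>2 = 2 ^ c" using 1 by (auto simp: s_eq_1_iff)
      have "2 ^ m dvd w + y\<^sup>2" using dvdc [of c] lowb dvdQ c by auto
      then have "2 ^ m dvd (w + 1) + 2 ^ m * w + Q * Q * w\<^sup>2" using y2 \<open>z = 1\<close> by (simp add: ac_simps)
      then have "2 ^ m dvd w + 1" using dvdQ
        by (metis dvd_add_left_iff dvd_mult2 dvd_triv_left)
      then show False using neg by (simp add: mod_eq_0_iff_dvd)
    next
      case 2
      then have "z = 1" using oz odd_s_eq_1 by blast
      obtain i c where ic: "w + y\<^sup>2 = 2 ^ i + 2 ^ c" "i < c" using 2 by (auto elim: s_eq_2_cases)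
      have "(2::nat) ^ i < 2 ^ c" using ic by simp
      then have dQ: "Q * Q dvd 2 ^ c" using lowb ic by (intro dvdc) linarith
      then have mc: "2 ^ m dvd (2::nat) ^ c" using dvdQ dvd_trans by blast
      have eq: "w + 1 + 2 ^ m * w + Q * Q * w\<^sup>2 = 2 ^ i + 2 ^ c"
        using ic y2 \<open>z = 1\<close> by simp
      have "(w + 1) mod 2 ^ m = 2 ^ i mod 2 ^ m"
      proof -
        obtain a where a: "Q * Q = 2 ^ m * a" using dvdQ by (rule dvdE)
        obtain b where b: "(2::nat) ^ c = 2 ^ m * b" using mc by (rule dvdE)
        have "(w + 1 + 2 ^ m * (w + a * w\<^sup>2)) mod 2 ^ m = (2 ^ i + 2 ^ m * b) mod 2 ^ m"
          using eq a b by (simp add: algebra_simps)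
        then show ?thesis by simp
      qed
      note w0 = this
      have im: "i < m"
      proof (rule ccontr)
        assume "\<not> i < m"
        then have "2 ^ m dvd (2::nat) ^ i" by (intro le_imp_power_dvd) simp
        then have "(w + 1) mod 2 ^ m = 0" unfolding w0 by (rule dvd_imp_mod_0)
        then show False by (rule neg)
      qed
      then have "(2::nat) ^ i < 2 ^ m" by (intro power_strict_increasing) auto
      then have w1: "(w + 1) mod 2 ^ m = 2 ^ i" unfolding w0 by (rule mod_less)
      show False
      proof (cases "i = 0")
        case True
        \<comment> \<open>The summand 1 cancels, and an odd cofactor above 1 is left in a power of
          two.\<close>
        then have "w * (1 + 2 ^ m + Q * Q * w) = 2 ^ c" 
          using eq by (simp add: algebra_simps power2_eq_square)
        then have "1 + 2 ^ m + Q * Q * w dvd 2 ^ c" by (metis dvd_triv_right)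
        moreover have "odd (1 + 2 ^ m + Q * Q * w)" using h by (simp add: m_def Q_def)
        ultimately have "1 + 2 ^ m + Q * Q * w = 1" by (intro odd_dvd_pow2)
        then show False by simp
      next
        case False
        have wm: "w mod 2 ^ m = 2 ^ i - 1"
        proof -
          have "(w mod 2 ^ m + 1) mod 2 ^ m = 2 ^ i" using w1 by (simp add: mod_Suc_eq)
          moreover have "w mod 2 ^ m + 1 \<noteq> 2 ^ m"
          proof
            assume "w mod 2 ^ m + 1 = 2 ^ m"
            with \<open>(w mod 2 ^ m + 1) mod 2 ^ m = 2 ^ i\<close> show False by simp
          qed
          moreover have "w mod 2 ^ m < 2 ^ m" by simp
          ultimately show ?thesis by (simp add: mod_Suc split: if_splits)
        qed
        \<comment> \<open>The low \<open>m\<close> digits of \<open>w\<close> contain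
          \<open>i\<close> ones. Dividing the equation by \<open>2 ^ m\<close> shows that the next
          block \<open>v\<close> is congruent to \<open>- (2 ^ i - 1)\<close> modulo
          \<open>2 ^ (m - 2)\<close>, so it has at least \<open>m - 1 - i\<close> ones. Together
          these are at least 10.\<close>
        define v where "v = w div 2 ^ m"
        have wv: "w = (2 ^ i - 1) + 2 ^ m * v" using wm by (metis mod_mult_div_eq v_def)
        have QQ: "Q * Q = 2 ^ m * 2 ^ (m - 2)"
          using h by (cases h) (simp_all add: Q_def m_def power_add)
        have i2: "(2::nat) ^ 1 \<le> 2 ^ i" using False by (intro power_increasing) auto
        then have "w + 1 = 2 ^ i + 2 ^ m * v" using wv by simp
        then have "2 ^ m * (v + w) + Q * Q * w\<^sup>2 = 2 ^ c"
          using eq unfolding distrib_left by linarith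
        then have "2 ^ m * 2 ^ (m - 2) dvd 2 ^ m * (v + w)" using dQ QQ 
          by (metis dvd_add_left_iff dvd_triv_left)
        then have "2 ^ (m - 2) dvd v + w" by simp
        moreover have "v + w = v + (2 ^ i - 1) + 2 ^ (m - 2) * (4 * v)"
        proof -
          have "(2::nat) ^ m = 2 ^ (m - 2) * 4" using h by (simp add: m_def power_eq_if)
          then have "2 ^ m * v = 2 ^ (m - 2) * (4 * v)" by simp
          then show ?thesis using wv by linarith
        qed
        ultimately have "2 ^ (m - 2) dvd v + (2 ^ i - 1)" by (metis dvd_add_left_iff dvd_triv_left)
        then have "(v + (2 ^ i - 1)) mod 2 ^ (m - 2) = 0" by simp
        from s_neg [OF this] have "s (v mod 2 ^ (m - 2)) + s ((2 ^ i - 1 - 1) mod 2 ^ (m - 2)) = m - 2"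
          using i2 by simp
        moreover have "(2::nat) ^ i - 1 - 1 = 2 * (2 ^ (i - 1) - 1)" 
          using False by (cases i) auto
        then have "s (2 ^ i - 1 - 1) = i - 1" using s_pred_pow [of "i - 1"] by simp
        ultimately have "s v + (i - 1) \<ge> m - 2"
          using s_mod_le [of v "m - 2"] s_mod_le [of "2 ^ i - 1 - 1" "m - 2"] by linarith
        moreover have "s w = i + s v"
          using s_split [of "2 ^ i - 1" m v] wv s_pred_pow [of i] im
          by (metis wm mod_less_divisor zero_less_numeral zero_less_power)
        ultimately show False using sy y h False \<open>s z \<ge> 1\<close> by (simp add: m_def)
      qed
    next
      case 3
      then obtain u where u: "z = 1 + 2 ^ u" "u \<ge> 1" using oz by (auto elim: odd_s_2)
      obtain c where c: "w + y\<^sup>2 = 2 ^ c" using 3 by (auto simp: s_eq_1_iff)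
      have "2 ^ m dvd w + y\<^sup>2" using dvdc [of c] lowb dvdQ c by auto
      then have "2 ^ m dvd (w + z\<^sup>2) + 2 ^ m * (z * w) + Q * Q * w\<^sup>2" using y2 by (simp add: ac_simps)
      then have "2 ^ m dvd w + z\<^sup>2" using dvdQ
        by (metis dvd_add_left_iff dvd_mult2 dvd_triv_left)
      then have "(w + z\<^sup>2) mod 2 ^ m = 0" by simp
      from s_neg [OF this] have "s (w mod 2 ^ m) + s ((z\<^sup>2 - 1) mod 2 ^ m) = m" using u by simp
      moreover have "z\<^sup>2 - 1 = 2 ^ (u + 1) + 2 ^ (u + u)"
        using u by (simp add: power2_eq_square power_add algebra_simps)
      then have "s (z\<^sup>2 - 1) \<le> 2" using s_add_le [of "2 ^ (u + 1)" "2 ^ (u + u)"] 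
        by (simp only: s_pow)
      ultimately have "s w \<ge> m - 2" 
        using s_mod_le [of w m] s_mod_le [of "z\<^sup>2 - 1" m] by linarith
      then show False using sy y h 3 by (simp add: m_def)
    qed
    then show ?thesis ..
  qed
qed

text \<open>The number squared is \<open>3 + 2 ^ Suc h * y\<close>. Two ones would make the upper
  part of the square \<open>1 + 2 ^ c\<close> with \<open>c >= h\<close>, hence \<open>3 * y\<close>
  congruent to 1 modulo \<open>2 ^ 16\<close>. The inverse of 3 is 43691, which is
  \<open>(2 ^ 17 + 1) div 3\<close> and already has 9 ones.\<close>

lemma sparse_square_step_three:
  assumes y: "odd y" "s y \<le> 7" and h: "h \<ge> 16" and sq: "s (3 * y + 2 ^ h * y\<^sup>2) \<le> 2"
  shows False
proof -
  define v where "v = 3 * y + 2 ^ h * y\<^sup>2"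
  have ov: "odd v" using y h by (simp add: v_def)
  have v_gt: "v > 2 ^ h"
  proof -
    have "2 ^ h * 1 \<le> 2 ^ h * y\<^sup>2" using odd_pos [OF y(1)] by (intro mult_left_mono) auto
    moreover have "y > 0" using y by (auto intro: Nat.gr0I)
    ultimately show ?thesis unfolding v_def by linarith
  qed
  then have "v \<noteq> 1" by auto
  then have "s v = 2" using sq odd_s_ge_2 [OF ov] by (simp add: v_def)
  then obtain c where c: "v = 1 + 2 ^ c" using ov by (auto elim: odd_s_2)
  have "(2::nat) ^ h \<le> 2 ^ c" using v_gt c by linarith
  then have "h \<le> c" by simp
  then have d: "2 ^ 16 dvd (2::nat) ^ c" "2 ^ 16 dvd (2::nat) ^ h" using h by (intro le_imp_power_dvd; simp)+
  then obtain a b where ab: "(2::nat) ^ c = 2 ^ 16 * a" "(2::nat) ^ h = 2 ^ 16 * b" by (metis dvdE)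
  have "3 * y + 65536 * (b * y\<^sup>2) = 1 + 65536 * a"
    using c unfolding v_def ab by simp
  then have "(3 * y + 65536 * (b * y\<^sup>2)) mod 65536 = (1 + 65536 * a) mod 65536" by simp
  then have "(3 * y) mod 65536 = 1" by simp
  then have "(43691 * ((3 * y) mod 65536)) mod 65536 = 43691" by simp
  then have "(43691 * (3 * y)) mod 65536 = 43691" by (simp only: mod_mult_right_eq)
  moreover have "43691 * (3 * y) = y + 65536 * (2 * y)" by simp
  ultimately have "y mod 65536 = 43691" by (simp only: mod_mult_self2)
  then have "s (y mod 2 ^ 16) = 9" by simp
  then show False using s_mod_le [of y 16] y by simp
qed


text \<open>
  \<open>square_search L f x (2 ^ i) r e k\<close> explores, with recursion depth at most \<open>f\<close>, all \<open>n \<noteq> x\<close> congruent to \<open>x\<close> modulo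
  \<open>2 ^ (i + 1)\<close> with at most \<open>k\<close> further ones, where \<open>x\<^sup>2 = lo + 2 ^ (i + 2) * r\<close> and the digits \<open>lo\<close> of \<open>n\<^sup>2\<close> that are
  already determined contain \<open>e\<close> ones. The two branches with the constants 1024 and 65536 are cut because they are covered by the two
  lemmas above.
\<close>

fun square_search :: "nat list \<Rightarrow> nat \<Rightarrow> nat \<Rightarrow> nat \<Rightarrow> nat \<Rightarrow> nat \<Rightarrow> nat \<Rightarrow> bool" where
  "square_search L 0 x p r e k = False"
| "square_search L (Suc f) x p r e k =
    (if 4 \<le> e \<or> r = 0 \<and> 3 \<le> e \<or> k = 0 \<or> x = 1 \<and> p = 1024 \<or> x = 3 \<and> p = 65536 then True
     else square_search L f x (2 * p) (r div 2) (e + r mod 2) k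
       \<and> (e + s (r + x + p) \<le> 4 \<longrightarrow> x + 2 * p \<in> set L)
       \<and> square_search L f (x + 2 * p) (2 * p) ((r + x + p) div 2) (e + (r + x + p) mod 2) (k - 1))"

lemma square_search_numeral:
  "square_search L (numeral w) x p r e k =
    (if 4 \<le> e \<or> r = 0 \<and> 3 \<le> e \<or> k = 0 \<or> x = 1 \<and> p = 1024 \<or> x = 3 \<and> p = 65536 then True
     else square_search L (pred_numeral w) x (2 * p) (r div 2) (e + r mod 2) k
       \<and> (e + s (r + x + p) \<le> 4 \<longrightarrow> x + 2 * p \<in> set L)
       \<and> square_search L (pred_numeral w) (x + 2 * p) (2 * p) ((r + x + p) div 2) (e + (r + x + p) mod 2) (k - 1))"
  by (simp only: numeral_eq_Suc [of w] square_search.simps(2))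

text \<open>With \<open>n = x + 2 ^ Suc i * y\<close> the square is
  \<open>lo + 2 ^ (i + 2) * (r + x * y + 2 ^ i * y\<^sup>2)\<close>. The parity of \<open>y\<close>
  therefore fixes the next digit of \<open>n\<close> and, with it, one more digit of the square: an
  even \<open>y\<close> keeps \<open>r\<close>, an odd one replaces it by
  \<open>r + x + 2 ^ i\<close>.\<close>

lemma square_search_sound:
  assumes "square_search L f x (2 ^ i) r e k" "odd x" "x < 2 ^ Suc i" 
    "x\<^sup>2 = lo + 2 ^ (i + 2) * r" "lo < 2 ^ (i + 2)" "s lo = e"
    "n mod 2 ^ Suc i = x" "n \<noteq> x" "s n \<le> s x + k" "s (n\<^sup>2) \<le> 4"
  shows "n \<in> set L \<or> n mod 2 ^ 11 = 1 \<or> n mod 2 ^ 17 = 3"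
  using assms
proof (induction f arbitrary: x i r e k lo)
  case (Suc f)
  define p :: nat where "p = 2 ^ i"
  have p2: "(2::nat) ^ Suc i = 2 * p" "(2::nat) ^ (i + 2) = 4 * p" by (simp_all add: p_def)
  define y where "y = n div 2 ^ Suc i"
  have n: "n = x + 2 ^ Suc i * y" using Suc.prems(7) by (metis mod_mult_div_eq y_def)
  have y0: "y \<noteq> 0" using Suc.prems(8) n by (intro notI) simp
  have n2: "n\<^sup>2 = lo + 2 ^ (i + 2) * (r + x * y + p * y\<^sup>2)"
  proof -
    have "n\<^sup>2 = x\<^sup>2 + 4 * p * (x * y) + 4 * p * (p * y\<^sup>2)"
      unfolding n p2 by (simp add: power2_eq_square algebra_simps)
    then show ?thesis using Suc.prems(4) unfolding p2 by (simp add: algebra_simps)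
  qed
  have sn2: "s (n\<^sup>2) = e + s (r + x * y + p * y\<^sup>2)"
    unfolding n2 using s_split [OF Suc.prems(5)] Suc.prems(6) by simp
  have sn: "s n = s x + s y" using s_split [OF Suc.prems(3), of y] n by simp
  have "s (r + x * y + p * y\<^sup>2) \<ge> 1" using y0 by (intro s_pos) (simp add: p_def)
  then have e: "\<not> 4 \<le> e" using sn2 Suc.prems(10) by linarith
  have k: "k \<noteq> 0" using sn Suc.prems(9) s_pos [of y] y0 by linarith
  \<comment> \<open>With \<open>r = 0\<close> the undetermined part of the square is
    \<open>(x + p * y) * y\<close>, and its first factor is odd and above 1, so two more ones
    follow. Oddness needs \<open>i > 0\<close>; for \<open>i = 0\<close> the known part is below 4
    and has at most two ones.\<close>
  have r: "\<not> (r = 0 \<and> 3 \<le> e)"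
  proof
    assume re: "r = 0 \<and> 3 \<le> e"
    have "i \<noteq> 0"
    proof
      assume "i = 0"
      then have "lo < 4" using Suc.prems(5) by simp
      then have "lo = 0 \<or> lo = 1 \<or> lo = 2 \<or> lo = 3" by auto
      then show False using Suc.prems(6) re by auto
    qed
    then have "odd (x + p * y)" using Suc.prems(2) by (simp add: p_def)
    moreover have "x + p * y \<noteq> 1"
    proof -
      have "p * y > 0" using y0 by (simp add: p_def)
      then show ?thesis using odd_pos [OF Suc.prems(2)] by linarith
    qed
    ultimately have "s ((x + p * y) * y) \<ge> 2" using y0 by (intro s_odd_mult_ge_2) auto
    moreover have "(x + p * y) * y = r + x * y + p * y\<^sup>2" using re
      by (simp add: power2_eq_square algebra_simps)
    ultimately show False using sn2 re Suc.prems(10) by simp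
  qed
  show ?case
  proof (cases "x = 1 \<and> p = 1024 \<or> x = 3 \<and> p = 65536")
    case True
    then have "x = 1 \<and> (2::nat) ^ i = 2 ^ 10 \<or> x = 3 \<and> (2::nat) ^ i = 2 ^ 16" by (simp add: p_def)
    then have "x = 1 \<and> i = 10 \<or> x = 3 \<and> i = 16" by (simp only: power_inject_exp)
    then show ?thesis using Suc.prems(7) by auto
  next
    case False
    let ?r = "r + x + p"
    have rec: "square_search L f x (2 * p) (r div 2) (e + r mod 2) k"
      "e + s ?r \<le> 4 \<Longrightarrow> x + 2 * p \<in> set L"
      "square_search L f (x + 2 * p) (2 * p) (?r div 2) (e + ?r mod 2) (k - 1)"
      using Suc.prems(1) e r k False unfolding p_def [symmetric] square_search.simps by auto
    have low: "t + 2 ^ (i + 2) * (b mod 2) < 2 ^ (Suc i + 2)"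
      "s (t + 2 ^ (i + 2) * (b mod 2)) = s t + b mod 2" if "t < 2 ^ (i + 2)" for t b
    proof -
      have "2 ^ (i + 2) * (b mod 2) \<le> (2::nat) ^ (i + 2) * 1" by (intro mult_left_mono) auto
      moreover have "2 ^ (Suc i + 2) = 2 * (2::nat) ^ (i + 2)" by simp
      ultimately show "t + 2 ^ (i + 2) * (b mod 2) < 2 ^ (Suc i + 2)" using that by linarith
      show "s (t + 2 ^ (i + 2) * (b mod 2)) = s t + b mod 2"
        unfolding s_split [OF that] by (cases "odd b") (simp_all add: odd_iff_mod_2_eq_one)
    qed
    have up: "t + 2 ^ (i + 2) * b = (t + 2 ^ (i + 2) * (b mod 2)) + 2 ^ (Suc i + 2) * (b div 2)" for t b :: nat
    proof -
      have "2 ^ (i + 2) * b = 2 ^ (i + 2) * (b mod 2 + 2 * (b div 2))" by simp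
      also have "\<dots> = 2 ^ (i + 2) * (b mod 2) + 2 ^ (Suc i + 2) * (b div 2)"
        by (simp only: distrib_left power_Suc add_Suc ac_simps)
      finally show ?thesis by simp
    qed
    show ?thesis
    proof (cases "even y")
      case True
      then obtain z where z: "y = 2 * z" by blast
      show ?thesis
      proof (rule Suc.IH [of x "Suc i" "r div 2" "e + r mod 2" k "lo + 2 ^ (i + 2) * (r mod 2)"])
        show "square_search L f x (2 ^ Suc i) (r div 2) (e + r mod 2) k" using rec(1) by (simp only: p2)
        show "x < 2 ^ Suc (Suc i)" using Suc.prems(3) by simp
        show "x\<^sup>2 = lo + 2 ^ (i + 2) * (r mod 2) + 2 ^ (Suc i + 2) * (r div 2)"
          unfolding Suc.prems(4) by (rule up)
        have "n = x + 2 ^ Suc (Suc i) * z" using n z by simp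
        then show "n mod 2 ^ Suc (Suc i) = x" using \<open>x < 2 ^ Suc (Suc i)\<close> by simp
      qed (use Suc.prems low in auto)
    next
      case False
      then obtain z where z: "y = 2 * z + 1" by (auto elim: oddE)
      let ?x = "x + 2 * p"
      have x2: "?x\<^sup>2 = lo + 2 ^ (i + 2) * ?r"
      proof -
        have "?x\<^sup>2 = x\<^sup>2 + 4 * p * x + 4 * p * p" by (simp add: power2_eq_square algebra_simps)
        then show ?thesis using Suc.prems(4) unfolding p2 by (simp add: algebra_simps)
      qed
      have sx: "s ?x = s x + 1" using s_split [OF Suc.prems(3), of 1] unfolding p2 by simp
      show ?thesis
      proof (cases "z = 0")
        case True
        then have "n = ?x" using n z unfolding p2 by simp
        moreover have "s (?x\<^sup>2) = e + s ?r" unfolding x2 using s_split [OF Suc.prems(5)] Suc.prems(6) by simp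
        ultimately show ?thesis using rec(2) Suc.prems(10) by simp
      next
        case False
        show ?thesis
        proof (rule Suc.IH [of ?x "Suc i" "?r div 2" "e + ?r mod 2" "k - 1" "lo + 2 ^ (i + 2) * (?r mod 2)"])
          show "square_search L f ?x (2 ^ Suc i) (?r div 2) (e + ?r mod 2) (k - 1)" using rec(3) by (simp only: p2)
          show xl: "?x < 2 ^ Suc (Suc i)" using Suc.prems(3) unfolding p2 by (simp add: p_def)
          show "?x\<^sup>2 = lo + 2 ^ (i + 2) * (?r mod 2) + 2 ^ (Suc i + 2) * (?r div 2)"
            unfolding x2 by (rule up)
          have nz: "n = ?x + 2 ^ Suc (Suc i) * z" using n z unfolding p2 by (simp add: p_def algebra_simps)
          then show "n mod 2 ^ Suc (Suc i) = ?x" using xl by simp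
          show "n \<noteq> ?x" using nz False by simp
          show "s n \<le> s ?x + (k - 1)" using sx Suc.prems(9) k by simp
        qed (use Suc.prems low in auto)
      qed
    qed
  qed
qed simp

text \<open>The search starts from the single digit of an odd number and allows 8 further ones. The
  list consists of \<open>2 ^ m + 1\<close> for \<open>m\<close> from 1 to 10 and the sporadic
  values 7, 13, 15, 23, 47, 111; larger powers lie in the branch cut at 1024.\<close>

lemma sparse_square_search:
  "square_search [3, 5, 7, 9, 13, 15, 17, 23, 33, 47, 65, 111, 129, 257, 513, 1025] 60 1 1 0 1 8"
  by (simp add: square_search_numeral del: square_search.simps)

lemma sparse_square_cases:
  assumes n: "odd n" "s n \<le> 9" "s (n\<^sup>2) \<le> 4"
  shows "n \<in> {1, 7, 13, 15, 23, 47, 111} \<or> (\<exists>m \<ge> 1. n = 1 + 2 ^ m)"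
proof -
  \<comment> \<open>\<open>m\<close> is the position of the lowest one of \<open>n\<close> beyond
    the prefix \<open>c\<close>.\<close>
  have dec: "\<exists>m y. n = c + 2 ^ m * y \<and> odd y \<and> t \<le> m" 
    if "n mod 2 ^ t = c" "n \<noteq> c" for c t
  proof -
    have "n - c > 0" using that by (metis mod_less_eq_dividend le_neq_implies_less zero_less_diff)
    then obtain m y where my: "n - c = 2 ^ m * y" "odd y" by (rule s_shift_odd)
    have "2 ^ t dvd 2 ^ m * y" using that my by (metis dvd_minus_mod)
    moreover have "coprime (2 ^ t) y" using my(2) by (simp add: coprime_left_2_iff_odd)
    ultimately have "2 ^ t dvd (2::nat) ^ m" by (simp add: coprime_dvd_mult_left_iff)
    then have "t \<le> m" using power_dvd_imp_le [of "2::nat" t m] by simp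
    moreover have "n = c + 2 ^ m * y" using my(1) \<open>n - c > 0\<close> by linarith
    ultimately show ?thesis using my by blast
  qed
  have "n = 1 \<or> n \<in> set [3, 5, 7, 9, 13, 15, 17, 23, 33, 47, 65, 111, 129, 257, 513, 1025]
    \<or> n mod 2 ^ 11 = 1 \<or> n mod 2 ^ 17 = 3"
  proof (cases "n = 1")
    case False
    then show ?thesis using n
      by (intro disjI2 square_search_sound [of _ 60 1 0 0 1 8 1])
        (use sparse_square_search in \<open>simp_all add: odd_iff_mod_2_eq_one\<close>)
  qed simp
  then consider "n = 1" | "n \<in> {3, 5, 7, 9, 13, 15, 17, 23, 33, 47, 65, 111, 129, 257, 513, 1025}"
    | "n \<noteq> 1" "n mod 2 ^ 11 = 1" | "n \<noteq> 3" "n mod 2 ^ 17 = 3" by auto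
  then show ?thesis
  proof cases
    case 2
    have "\<exists>m\<ge>1. t = 1 + 2 ^ m" if "t \<in> {3, 5, 9, 17, 33, 65, 129, 257, 513, 1025}" for t :: nat
    proof -
      from that consider "t = 1 + 2 ^ 1" | "t = 1 + 2 ^ 2" | "t = 1 + 2 ^ 3" | "t = 1 + 2 ^ 4" | "t = 1 + 2 ^ 5"
        | "t = 1 + 2 ^ 6" | "t = 1 + 2 ^ 7" | "t = 1 + 2 ^ 8" | "t = 1 + 2 ^ 9" | "t = 1 + 2 ^ 10"
        by auto
      then show ?thesis by cases (blast intro: one_le_numeral order_refl)+
    qed
    with 2 show ?thesis by blast
  next
    case 3
    then obtain m y where my: "n = 1 + 2 ^ m * y" "odd y" "11 \<le> m" using dec [of 11 1] by blast
    \<comment> \<open>The cross term is doubled and so sits at \<open>Suc m\<close>; the square of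
      \<open>y\<close> sits only \<open>h = m - 1\<close> places higher.\<close>
    then obtain h where h: "m = Suc h" by (cases m) auto
    have "n\<^sup>2 = 1 + 2 ^ Suc m * (y + 2 ^ h * y\<^sup>2)"
      unfolding my h by (simp add: power2_eq_square algebra_simps)
    then have "s (n\<^sup>2) = 1 + s (y + 2 ^ h * y\<^sup>2)" 
      using s_split [OF one_less_power [of "2::nat" "Suc m"]] by (simp del: power_Suc)
    moreover have "s n = 1 + s y" using my s_split [OF one_less_power [of "2::nat" m], of y] by simp
    ultimately have "s y \<le> 8" "s (y + 2 ^ h * y\<^sup>2) \<le> 3" "10 \<le> h"
      using n(2,3) my(3) h by linarith+
    then have "y = 1" using sparse_square_step_one my(2) by blast
    then show ?thesis using my by auto
  next
    case 4
    then obtain m y where my: "n = 3 + 2 ^ m * y" "odd y" "17 \<le> m" using dec [of 17 3] by blast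
    then obtain h where h: "m = Suc h" by (cases m) auto
    have "(2::nat) ^ 17 \<le> 2 ^ m" using my by (intro power_increasing) auto
    then have sm: "3 < (2::nat) ^ m" "9 < (2::nat) ^ Suc m" by simp_all
    have "n\<^sup>2 = 9 + 2 ^ Suc m * (3 * y + 2 ^ h * y\<^sup>2)"
      unfolding my h by (simp add: power2_eq_square algebra_simps)
    then have "s (n\<^sup>2) = 2 + s (3 * y + 2 ^ h * y\<^sup>2)" using s_split [OF sm(2)] by (simp del: power_Suc)
    moreover have "s n = 2 + s y" using my s_split [OF sm(1), of y] by simp
    ultimately have "s y \<le> 7" "s (3 * y + 2 ^ h * y\<^sup>2) \<le> 2" "16 \<le> h"
      using n(2,3) my(3) h by linarith+
    then show ?thesis using sparse_square_step_three my(2) by blast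
  qed simp
qed

text \<open>
  \<open>multiple_search L m a f x (2 ^ i) c q k\<close> explores the \<open>n \<noteq> x\<close> congruent to \<open>x\<close> modulo \<open>2 ^ i\<close> with \<open>s (a * n) \<le> m\<close>;
  \<open>c\<close> is the carry of the multiplication and \<open>q\<close> the number of ones emitted so far. The case \<open>c = 0\<close> is a gap that splits
  the product.
\<close>

fun multiple_search :: "nat list \<Rightarrow> nat \<Rightarrow> nat \<Rightarrow> nat \<Rightarrow> nat \<Rightarrow> nat \<Rightarrow> nat \<Rightarrow> nat \<Rightarrow> nat \<Rightarrow> bool" where
  "multiple_search L m a 0 x p c q k = False"
| "multiple_search L m a (Suc f) x p c q k =
    (if m \<le> q \<or> c = 0 \<and> 2 \<le> q \<or> k = 0 then True
     else multiple_search L m a f x (2 * p) (c div 2) (q + c mod 2) k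
       \<and> (q + s (c + a) \<le> m \<longrightarrow> x + p \<in> set L)
       \<and> multiple_search L m a f (x + p) (2 * p) ((c + a) div 2) (q + (c + a) mod 2) (k - 1))"

lemma multiple_search_numeral:
  "multiple_search L m a (numeral w) x p c q k =
    (if m \<le> q \<or> c = 0 \<and> 2 \<le> q \<or> k = 0 then True
     else multiple_search L m a (pred_numeral w) x (2 * p) (c div 2) (q + c mod 2) k
       \<and> (q + s (c + a) \<le> m \<longrightarrow> x + p \<in> set L)
       \<and> multiple_search L m a (pred_numeral w) (x + p) (2 * p) ((c + a) div 2) (q + (c + a) mod 2) (k - 1))"
  by (simp only: numeral_eq_Suc [of w] multiple_search.simps(2))

text \<open>With \<open>n = x + 2 ^ i * y\<close> the product is
  \<open>lo + 2 ^ i * (c + a * y)\<close>, so each digit of \<open>n\<close> settles one digit of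
  the product. A vanishing carry means \<open>a * x < 2 ^ i\<close>; such a branch is not searched
  further but reported in the second alternative.\<close>

lemma multiple_search_sound:
  assumes "multiple_search L m a f x (2 ^ i) c q k" "odd a" "x < 2 ^ i"
    "a * x = lo + 2 ^ i * c" "lo < 2 ^ i" "s lo = q"
    "n mod 2 ^ i = x" "n \<noteq> x" "s n \<le> s x + k" "s (a * n) \<le> m"
  shows "n \<in> set L \<or> (\<exists>j. n mod 2 ^ j \<noteq> n \<and> a * (n mod 2 ^ j) < 2 ^ j \<and> 2 \<le> s (a * (n mod 2 ^ j)))"
  using assms
proof (induction f arbitrary: x i c q k lo)
  case (Suc f)
  define y where "y = n div 2 ^ i"
  have n: "n = x + 2 ^ i * y" using Suc.prems(7) by (metis mod_mult_div_eq y_def)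
  have y0: "y > 0" using Suc.prems(8) n by (intro Nat.gr0I) simp
  have "a * n = a * x + 2 ^ i * (a * y)" unfolding n by (simp add: algebra_simps)
  then have an: "a * n = lo + 2 ^ i * (c + a * y)" using Suc.prems(4) by (simp add: algebra_simps)
  have san: "s (a * n) = q + s (c + a * y)"
    unfolding an using s_split [OF Suc.prems(5)] Suc.prems(6) by simp
  have sn: "s n = s x + s y" using s_split [OF Suc.prems(3), of y] n by simp
  have "s (c + a * y) \<ge> 1" using y0 Suc.prems(2) by (intro s_pos) (auto intro: Nat.gr0I)
  then have q: "\<not> m \<le> q" using san Suc.prems(10) by linarith
  have k: "k \<noteq> 0" using sn Suc.prems(9) s_pos [of y] y0 by linarith
  show ?case
  proof (cases "c = 0 \<and> 2 \<le> q")
    case True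
    then have "a * x < 2 ^ i" "s (a * x) = q" using Suc.prems(4,5,6) by simp_all
    then show ?thesis using True Suc.prems(7,8) by (intro disjI2 exI [of _ i]) auto
  next
    case False
    with q k have rec: "multiple_search L m a f x (2 ^ Suc i) (c div 2) (q + c mod 2) k"
        "q + s (c + a) \<le> m \<Longrightarrow> x + 2 ^ i \<in> set L"
        "multiple_search L m a f (x + 2 ^ i) (2 ^ Suc i) ((c + a) div 2) (q + (c + a) mod 2) (k - 1)"
      using Suc.prems(1) by auto
    have low: "t + 2 ^ i * (b mod 2) < 2 ^ Suc i"
      "s (t + 2 ^ i * (b mod 2)) = s t + b mod 2" if "t < 2 ^ i" for t b
    proof -
      have "2 ^ i * (b mod 2) \<le> (2::nat) ^ i * 1" by (intro mult_left_mono) auto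
      then show "t + 2 ^ i * (b mod 2) < 2 ^ Suc i" using that unfolding power_Suc by linarith
      show "s (t + 2 ^ i * (b mod 2)) = s t + b mod 2"
        unfolding s_split [OF that] by (cases "odd b") (simp_all add: odd_iff_mod_2_eq_one)
    qed
    have up: "t + 2 ^ i * b = (t + 2 ^ i * (b mod 2)) + 2 ^ Suc i * (b div 2)" for t b :: nat
    proof -
      have "2 ^ i * b = 2 ^ i * (b mod 2 + 2 * (b div 2))" by simp
      also have "\<dots> = 2 ^ i * (b mod 2) + 2 ^ Suc i * (b div 2)"
        by (simp only: distrib_left power_Suc ac_simps)
      finally show ?thesis by simp
    qed
    note lo = low [OF Suc.prems(5)]
    show ?thesis
    proof (cases "even y")
      case True
      then obtain z where z: "y = 2 * z" by blast
      show ?thesis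
      proof (rule Suc.IH [OF rec(1) Suc.prems(2), of "lo + 2 ^ i * (c mod 2)"])
        show "x < 2 ^ Suc i" using Suc.prems(3) by simp
        show "a * x = lo + 2 ^ i * (c mod 2) + 2 ^ Suc i * (c div 2)"
          unfolding Suc.prems(4) by (rule up)
        have "n = x + 2 ^ Suc i * z" using n z by simp
        then show "n mod 2 ^ Suc i = x" using \<open>x < 2 ^ Suc i\<close> by simp
      qed (use Suc.prems(6,8-10) lo in simp_all)
    next
      case False
      then obtain z where z: "y = 2 * z + 1" by (auto elim: oddE)
      let ?x = "x + 2 ^ i"
      have ax: "a * ?x = lo + 2 ^ i * (c + a)"
        using Suc.prems(4) by (simp add: algebra_simps)
      have sx: "s ?x = s x + 1" using s_split [OF Suc.prems(3), of 1] by simp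
      show ?thesis
      proof (cases "z = 0")
        case True
        then have "n = ?x" using n z by simp
        moreover have "s (a * ?x) = q + s (c + a)"
          unfolding ax using s_split [OF Suc.prems(5)] Suc.prems(6) by simp
        ultimately show ?thesis using rec(2) Suc.prems(10) by simp
      next
        case False
        show ?thesis
        proof (rule Suc.IH [OF rec(3) Suc.prems(2), of "lo + 2 ^ i * ((c + a) mod 2)"])
          show xl: "?x < 2 ^ Suc i" using Suc.prems(3) by simp
          show "a * ?x = lo + 2 ^ i * ((c + a) mod 2) + 2 ^ Suc i * ((c + a) div 2)"
            unfolding ax by (rule up)
          have nz: "n = ?x + 2 ^ Suc i * z" using n z by (simp add: algebra_simps)
          then show "n mod 2 ^ Suc i = ?x" using xl by simp
          show "n \<noteq> ?x" using nz False by simp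
          show "s n \<le> s ?x + (k - 1)" using sx Suc.prems(9) k by simp
        qed (use Suc.prems(6,10) lo in simp_all)
      qed
    qed
  qed
qed simp

text \<open>The multiplier has the form \<open>Suc (2 * b)\<close> so that the forced lowest digit
  of an odd \<open>n\<close> emits one 1 and leaves the carry \<open>b\<close>; the search starts
  behind this digit.\<close>

lemma multiple_search_root:
  assumes L: "multiple_search L m (Suc (2 * b)) 60 1 2 b 1 8"
    and n: "odd n" "n \<noteq> 1" "s n \<le> 9" "s (Suc (2 * b) * n) \<le> m"
  shows "n \<in> set L \<or> (\<exists>j. n mod 2 ^ j \<noteq> n \<and> Suc (2 * b) * (n mod 2 ^ j) < 2 ^ j
    \<and> 2 \<le> s (Suc (2 * b) * (n mod 2 ^ j)))"
  using L n by (intro multiple_search_sound [of L m "Suc (2 * b)" 60 1 1 b 1 8 1 n])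
    (simp_all add: odd_iff_mod_2_eq_one)

lemma split_at_gap:
  assumes "n mod 2 ^ j \<noteq> n" "a * (n mod 2 ^ j) < 2 ^ j"
  shows "s (a * n) = s (a * (n mod 2 ^ j)) + s (a * (n div 2 ^ j))" "n div 2 ^ j > 0"
proof -
  have n: "n = n mod 2 ^ j + 2 ^ j * (n div 2 ^ j)" by simp
  have "a * n = a * (n mod 2 ^ j) + 2 ^ j * (a * (n div 2 ^ j))"
    by (subst n) (simp only: distrib_left ac_simps)
  then show "s (a * n) = s (a * (n mod 2 ^ j)) + s (a * (n div 2 ^ j))"
    using s_split [OF assms(2)] by metis
  show "n div 2 ^ j > 0" using n assms(1) by (intro Nat.gr0I) simp
qed

text \<open>A gap splits the product into two nonzero multiples of an odd number above 1, with at
  least two ones each. With only three ones allowed no gap occurs and the list is complete.\<close>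

lemma multiple_search_three:
  assumes L: "multiple_search L 3 (Suc (2 * b)) 60 1 2 b 1 8" "b \<noteq> 0" "1 \<in> set L"
    and n: "odd n" "s n \<le> 9" "s (Suc (2 * b) * n) \<le> 3"
  shows "n \<in> set L"
proof (cases "n = 1")
  case False
  let ?a = "Suc (2 * b)"
  show ?thesis
  proof (rule disjE [OF multiple_search_root [OF L(1) n(1) False n(2,3)]])
    assume "\<exists>j. n mod 2 ^ j \<noteq> n \<and> ?a * (n mod 2 ^ j) < 2 ^ j \<and> 2 \<le> s (?a * (n mod 2 ^ j))"
    then obtain j where j: "n mod 2 ^ j \<noteq> n" "?a * (n mod 2 ^ j) < 2 ^ j" "2 \<le> s (?a * (n mod 2 ^ j))"
      by blast
    moreover have "s (?a * (n div 2 ^ j)) \<ge> 2"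
      using split_at_gap(2) [OF j(1,2)] L(2) by (intro s_odd_mult_ge_2) auto
    ultimately show ?thesis using split_at_gap(1) [OF j(1,2)] n(3) by linarith
  qed
qed (use L in simp)

section \<open>Multiples with at most three ones, one multiplier at a time\<close>

lemma sparse_multiple_3:
  assumes "odd n" "s n \<le> 9" "s (3 * n) \<le> 3"
  shows "n \<in> set [1, 3, 7, 11, 23, 27, 43, 87, 91, 107, 171, 343, 347, 363, 427, 683, 1367, 1371, 1387, 1451, 1707, 2731, 5463, 5467, 5483, 5547, 5803, 6827, 10923, 21847, 21851, 21867, 21931, 22187, 23211, 27307, 43691]"
  \<comment> \<open>The bound \<open>s n <= 9\<close> is what makes the list finite: every
    \<open>(2 ^ (2 * j + 1) + 1) div 3\<close> has a triple with two ones.\<close>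
  by (rule multiple_search_three [of _ 1]) (use assms in \<open>simp_all add: multiple_search_numeral del: multiple_search.simps\<close>)

lemma sparse_multiple_7:
  assumes "odd n" "s n \<le> 9" "s (7 * n) \<le> 3"
  shows "n \<in> set [1, 3, 5, 7, 19, 23, 37, 39, 55, 147, 151, 183, 293, 295, 311, 439, 1171, 1175, 1207, 1463, 2341, 2343, 2359, 2487, 3511, 9363, 9367, 9399, 9655, 18725, 18727, 18743, 18871, 74899, 74903, 74935, 149797, 149799, 149815, 599187, 599191, 1198373, 1198375, 4793491, 9586981]"
  by (rule multiple_search_three [of _ 3]) (use assms in \<open>simp_all add: multiple_search_numeral del: multiple_search.simps\<close>)

lemma sparse_multiple_13:
  assumes "odd n" "s n \<le> 9" "s (13 * n) \<le> 3"
  shows "n \<in> set [1, 5, 21, 79, 197, 325, 709, 1261, 2521, 3781, 5061, 10085, 20165, 40645, 80661, 85701]"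
  by (rule multiple_search_three [of _ 6]) (use assms in \<open>simp_all add: multiple_search_numeral del: multiple_search.simps\<close>)

lemma sparse_multiple_15:
  assumes "odd n" "s n \<le> 9" "s (15 * n) \<le> 3"
  shows "n \<in> set [1]"
  by (rule multiple_search_three [of _ 7]) (use assms in \<open>simp_all add: multiple_search_numeral del: multiple_search.simps\<close>)

lemma sparse_multiple_23:
  assumes "odd n" "s n \<le> 9" "s (23 * n) \<le> 3"
  shows "n \<in> set [1, 3, 7, 23, 359, 1447, 2855, 5699, 6055, 11399, 45591]"
  by (rule multiple_search_three [of _ 11]) (use assms in \<open>simp_all add: multiple_search_numeral del: multiple_search.simps\<close>)

lemma sparse_multiple_47:
  assumes "odd n" "s n \<le> 9" "s (47 * n) \<le> 3"
  shows "n \<in> set [1, 11, 175, 719, 1743, 5583]"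
  by (rule multiple_search_three [of _ 23]) (use assms in \<open>simp_all add: multiple_search_numeral del: multiple_search.simps\<close>)

lemma sparse_multiple_111:
  assumes "odd n" "s n \<le> 9" "s (111 * n) \<le> 3"
  shows "n \<in> set [1, 591]"
  by (rule multiple_search_three [of _ 55]) (use assms in \<open>simp_all add: multiple_search_numeral del: multiple_search.simps\<close>)

lemma sparse_multiple_5:
  assumes "odd n" "s n \<le> 9" "s (5 * n) \<le> 3"
  shows "n \<in> set [1, 5, 7, 13, 29, 53, 77, 103, 109, 205, 413, 461, 821, 845, 1229, 1639, 1645, 1741, 3277, 6557, 6605, 7373, 13109, 13133, 13517, 19661, 26215, 26221, 26317, 27853, 52429]"
  by (rule multiple_search_three [of _ 2]) (use assms in \<open>simp_all add: multiple_search_numeral del: multiple_search.simps\<close>)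

lemma sparse_multiple_9:
  assumes "odd n" "s n \<le> 9" "s (9 * n) \<le> 3"
  shows "n \<in> set [1, 9, 29, 57, 121, 457, 569, 1821, 1849, 3641, 7289, 7737, 29129, 29241, 36409]"
  by (rule multiple_search_three [of _ 4]) (use assms in \<open>simp_all add: multiple_search_numeral del: multiple_search.simps\<close>)

lemma sparse_multiple_17:
  assumes "odd n" "s n \<le> 9" "s (17 * n) \<le> 3"
  shows "n \<in> set [1, 17, 121, 241, 497, 3857, 4337, 30841, 30961, 61681]"
  by (rule multiple_search_three [of _ 8]) (use assms in \<open>simp_all add: multiple_search_numeral del: multiple_search.simps\<close>)

lemma sparse_multiple_33:
  assumes "odd n" "s n \<le> 9" "s (33 * n) \<le> 3"
  shows "n \<in> set [1, 33, 497, 993, 2017, 31777, 33761]"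
  by (rule multiple_search_three [of _ 16]) (use assms in \<open>simp_all add: multiple_search_numeral del: multiple_search.simps\<close>)

lemma sparse_multiple_65:
  assumes "odd n" "s n \<le> 9" "s (65 * n) \<le> 3"
  shows "n \<in> set [1, 65, 2017, 4033, 8129, 258113, 266177]"
  by (rule multiple_search_three [of _ 32]) (use assms in \<open>simp_all add: multiple_search_numeral del: multiple_search.simps\<close>)

lemma sparse_multiple_129:
  assumes "odd n" "s n \<le> 9" "s (129 * n) \<le> 3"
  shows "n \<in> set [1, 129, 8129, 16257, 32641, 2080897, 2113409]"
  by (rule multiple_search_three [of _ 64]) (use assms in \<open>simp_all add: multiple_search_numeral del: multiple_search.simps\<close>)

lemma sparse_multiple_257:
  assumes "odd n" "s n \<le> 9" "s (257 * n) \<le> 3"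
  shows "n \<in> set [1, 257, 32641, 65281]"
  by (rule multiple_search_three [of _ 128]) (use assms in \<open>simp_all add: multiple_search_numeral del: multiple_search.simps\<close>)

lemma sparse_multiple_513:
  assumes "odd n" "s n \<le> 9" "s (513 * n) \<le> 3"
  shows "n \<in> set [1, 513]"
  by (rule multiple_search_three [of _ 256]) (use assms in \<open>simp_all add: multiple_search_numeral del: multiple_search.simps\<close>)

text \<open>Four ones are allowed here for the one critical constellation of
  \<open>pair_bound_wlog\<close>, where \<open>a = 3\<close>, \<open>s b = 9\<close>,
  \<open>s (3 * b) = 4\<close> and \<open>s (b\<^sup>2) = 5\<close>. A gap with two ones on either
  side is now possible and is treated in \<open>sparse_multiple_no_four\<close>.\<close>

lemma sparse_triple_search: "multiple_search [3, 7, 11, 15, 23, 27, 43, 47, 55, 59, 87, 91, 107, 171, 175, 183, 187, 215, 219, 235, 343, 347, 363, 427, 683, 687, 695, 699, 727, 731, 747, 855, 859, 875, 939, 1367, 1371, 1387, 1451, 1707, 2731, 2735, 2743, 2747, 2775, 2779, 2795, 2903, 2907, 2923, 2987, 3415, 3419, 3435, 3499, 3755, 5463, 5467, 5483, 5547, 5803, 6827, 10923, 10927, 10935, 10939, 10967, 10971, 10987, 11095, 11099, 11115, 11179, 11607, 11611, 11627, 11691, 11947, 13655, 13659, 13675, 13739, 13995, 15019, 21847, 21851, 21867, 21931, 22187, 23211, 27307, 43691] 4 (Suc (2 * 1)) 60 1 2 1 1 8"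
  by (simp add: multiple_search_numeral del: multiple_search.simps)

lemma sparse_triple_search_squares: "\<forall>n \<in> set [3, 7, 11, 15, 23, 27, 43, 47, 55, 59, 87, 91, 107, 171, 175, 183, 187, 215, 219, 235, 343, 347, 363, 427, 683, 687, 695, 699, 727, 731, 747, 855, 859, 875, 939, 1367, 1371, 1387, 1451, 1707, 2731, 2735, 2743, 2747, 2775, 2779, 2795, 2903, 2907, 2923, 2987, 3415, 3419, 3435, 3499, 3755, 5463, 5467, 5483, 5547, 5803, 6827, 10923, 10927, 10935, 10939, 10967, 10971, 10987, 11095, 11099, 11115, 11179, 11607, 11611, 11627, 11691, 11947, 13655, 13659, 13675, 13739, 13995, 15019, 21847, 21851, 21867, 21931, 22187, 23211, 27307, 43691]. s n = 9 \<longrightarrow> s (n\<^sup>2) \<noteq> 5"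
  by simp

section \<open>Pairs of clusters\<close>

text \<open>The exponent is unbounded, so a search is replaced by the method of
  \<open>sparse_square_step_one\<close>: the high part \<open>w\<close> of \<open>n\<close> is
  congruent to the negative of a small number modulo \<open>2 ^ a\<close>, which costs too many ones
  unless \<open>w\<close> is 0 or 1.\<close>

lemma sparse_multiple_large_power:
  assumes a: "a \<ge> 10" and n: "odd n" "s n \<le> 9" "s ((1 + 2 ^ a) * n) \<le> 3"
  shows "n = 1 \<or> n = 1 + 2 ^ a"
proof -
  define x w where "x = n mod 2 ^ a" and "w = n div 2 ^ a"
  have x: "x < 2 ^ a" by (simp add: x_def)
  have nx: "n = x + 2 ^ a * w" by (simp add: x_def w_def)
  have ox: "odd x" using n(1) nx a by simp
  have sn: "s n = s x + s w" unfolding nx by (rule s_split [OF x])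
  have "(1 + 2 ^ a) * n = x + 2 ^ a * (x + w + 2 ^ a * w)" unfolding nx by (simp add: algebra_simps)
  then have s3: "s x + s (x + w + 2 ^ a * w) \<le> 3" using n(3) s_split [OF x] by simp
  have sx: "s x \<ge> 1" using ox by (intro s_pos) (auto intro: Nat.gr0I)
  have neg: False if "(w + 1) mod 2 ^ a = 0"
  proof -
    have "s (w mod 2 ^ a) = a" using s_neg [OF that] by simp
    then show False using s_mod_le [of w a] sn sx n(2) a by linarith
  qed
  show ?thesis
  proof (cases "w = 0")
    case True
    then have "s x = 1" using s3 sx by simp
    then show ?thesis using odd_s_eq_1 [OF ox] True nx by simp
  next
    case False
    define u where "u = x + w + 2 ^ a * w"
    have ub: "2 ^ a < u"
    proof -
      have "2 ^ a * 1 \<le> 2 ^ a * w" using False by (intro mult_left_mono) auto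
      then show ?thesis unfolding u_def using False by linarith
    qed
    then have "s u \<ge> 1" by (intro s_pos) simp
    have dvdc: "2 ^ a dvd (2::nat) ^ c" if "(2::nat) ^ a < 2 * 2 ^ c" for c
    proof -
      have "(2::nat) ^ a < 2 ^ Suc c" using that by simp
      then have "a < Suc c" by (rule power_less_imp_less_exp [rotated]) simp
      then show ?thesis by (intro le_imp_power_dvd) simp
    qed
    consider "s x = 1" "s u = 1" | "s x = 1" "s u = 2" | "s x = 2" "s u = 1"
      using s3 sx \<open>s u \<ge> 1\<close> unfolding u_def by linarith
    then show ?thesis
    proof cases
      case 1
      then have "x = 1" using ox odd_s_eq_1 by blast
      obtain c where c: "u = 2 ^ c" using 1 by (auto simp: s_eq_1_iff)
      have "2 ^ a dvd u" using dvdc [of c] ub c by simp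
      then have "2 ^ a dvd (w + 1) + 2 ^ a * w" using \<open>x = 1\<close> by (simp add: u_def)
      then have "2 ^ a dvd w + 1" by (metis dvd_add_left_iff dvd_triv_left)
      then show ?thesis using neg by (simp add: mod_eq_0_iff_dvd)
    next
      case 2
      then have "x = 1" using ox odd_s_eq_1 by blast
      obtain i c where ic: "u = 2 ^ i + 2 ^ c" "i < c" using 2 by (auto elim: s_eq_2_cases)
      have "(2::nat) ^ i < 2 ^ c" using ic by simp
      then have dc: "2 ^ a dvd (2::nat) ^ c" using ub ic by (intro dvdc) linarith
      have eq: "w + 1 + 2 ^ a * w = 2 ^ i + 2 ^ c" using ic \<open>x = 1\<close> by (simp add: u_def)
      have w0: "(w + 1) mod 2 ^ a = 2 ^ i mod 2 ^ a"
      proof -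
        obtain b where b: "(2::nat) ^ c = 2 ^ a * b" using dc by (rule dvdE)
        have "(w + 1 + 2 ^ a * w) mod 2 ^ a = (2 ^ i + 2 ^ a * b) mod 2 ^ a" using eq b by simp
        then show ?thesis by simp
      qed
      have ia: "i < a"
      proof (rule ccontr)
        assume "\<not> i < a"
        then have "2 ^ a dvd (2::nat) ^ i" by (intro le_imp_power_dvd) simp
        then have "(w + 1) mod 2 ^ a = 0" unfolding w0 by (rule dvd_imp_mod_0)
        then show False by (rule neg)
      qed
      then have "(2::nat) ^ i < 2 ^ a" by (intro power_strict_increasing) auto
      then have w1: "(w + 1) mod 2 ^ a = 2 ^ i" unfolding w0 by (rule mod_less)
      show ?thesis
      proof (cases "i = 0")
        case True
        then have "w * (1 + 2 ^ a) = 2 ^ c" using eq by (simp add: algebra_simps)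
        then have "1 + 2 ^ a dvd (2::nat) ^ c" by (metis dvd_triv_right)
        moreover have "odd (1 + 2 ^ a :: nat)" using a by simp
        ultimately have "1 + 2 ^ a = (1::nat)" by (intro odd_dvd_pow2)
        then show ?thesis by simp
      next
        case False
        have i2: "(2::nat) ^ 1 \<le> 2 ^ i" using False by (intro power_increasing) auto
        have wm: "w mod 2 ^ a = 2 ^ i - 1"
        proof -
          have "(w mod 2 ^ a + 1) mod 2 ^ a = 2 ^ i" using w1 by (simp add: mod_Suc_eq)
          moreover have "w mod 2 ^ a + 1 \<noteq> 2 ^ a"
          proof
            assume "w mod 2 ^ a + 1 = 2 ^ a"
            with \<open>(w mod 2 ^ a + 1) mod 2 ^ a = 2 ^ i\<close> show False by simp
          qed
          moreover have "w mod 2 ^ a < 2 ^ a" by simp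
          ultimately show ?thesis by (simp add: mod_Suc split: if_splits)
        qed
        define v where "v = w div 2 ^ a"
        have wv: "w = (2 ^ i - 1) + 2 ^ a * v" using wm by (metis mod_mult_div_eq v_def)
        then have "w + 1 = 2 ^ i + 2 ^ a * v" using i2 by simp
        then have vw: "2 ^ a * (v + w) = 2 ^ c" using eq unfolding distrib_left by linarith
        show ?thesis
        \<comment> \<open>For \<open>v = 0\<close> the odd number \<open>2 ^ i - 1\<close> divides a
          power of two, so \<open>w = 1\<close>. Otherwise \<open>v\<close> is congruent to
          \<open>- (2 ^ i - 1)\<close> modulo \<open>2 ^ a\<close>, and \<open>w\<close> gets at
          least \<open>a + 1\<close> ones.\<close>
        proof (cases "v = 0")
          case True
          then have "2 ^ a * (2 ^ i - 1) = (2::nat) ^ c" using wv vw by simp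
          then have "2 ^ i - 1 dvd (2::nat) ^ c" by (metis dvd_triv_right)
          moreover have "odd (2 ^ i - 1 :: nat)" using False i2 by simp
          ultimately have "2 ^ i - 1 = (1::nat)" by (rule odd_dvd_pow2 [rotated])
          then show ?thesis using wv True \<open>x = 1\<close> nx by simp
        next
          case False
          obtain d where d: "v + w = 2 ^ d"
          proof -
            have "s (2 ^ a * (v + w)) = Suc 0" unfolding vw by simp
            then show ?thesis using that by (auto simp: s_eq_1_iff simp del: One_nat_def)
          qed
          have "2 ^ a * 1 \<le> 2 ^ a * v" using False by (intro mult_left_mono) auto
          then have "(2::nat) ^ a < 2 * 2 ^ d" using d wv False by linarith
          then have "2 ^ a dvd v + w" using dvdc d by simp
          moreover have "v + w = v + (2 ^ i - 1) + 2 ^ a * v" using wv by linarith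
          ultimately have "2 ^ a dvd v + (2 ^ i - 1) + 2 ^ a * v" by (simp only:)
          then have "2 ^ a dvd v + (2 ^ i - 1)" by (metis dvd_add_left_iff dvd_triv_left)
          then have "(v + (2 ^ i - 1)) mod 2 ^ a = 0" by simp
          from s_neg [OF this] have "s (v mod 2 ^ a) + s ((2 ^ i - 1 - 1) mod 2 ^ a) = a"
            using i2 by simp
          moreover have "(2::nat) ^ i - 1 - 1 = 2 * (2 ^ (i - 1) - 1)"
            using \<open>i \<noteq> 0\<close> by (cases i) auto
          then have "s (2 ^ i - 1 - 1) = i - 1" using s_pred_pow [of "i - 1"] by simp
          ultimately have "s v + (i - 1) \<ge> a"
            using s_mod_le [of v a] s_mod_le [of "2 ^ i - 1 - 1" a] by linarith
          moreover have "2 ^ i - 1 < (2::nat) ^ a" using \<open>(2::nat) ^ i < 2 ^ a\<close> by linarith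
          then have "s w = s (2 ^ i - 1) + s v" unfolding wv by (rule s_split)
          then have "s w = i + s v" by (simp only: s_pred_pow)
          ultimately show ?thesis using sn n a sx \<open>i \<noteq> 0\<close> by linarith
        qed
      qed
    next
      case 3
      then obtain e where e: "x = 1 + 2 ^ e" using ox by (auto elim: odd_s_2)
      obtain c where c: "u = 2 ^ c" using 3 by (auto simp: s_eq_1_iff)
      have "2 ^ a dvd u" using dvdc [of c] ub c by simp
      then have "2 ^ a dvd (w + x) + 2 ^ a * w" by (simp add: u_def ac_simps)
      then have "2 ^ a dvd w + x" by (metis dvd_add_left_iff dvd_triv_left)
      then have "(w + x) mod 2 ^ a = 0" by simp
      from s_neg [OF this] have "s (w mod 2 ^ a) + s ((x - 1) mod 2 ^ a) = a" using e by simp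
      moreover have "s (x - 1) = 1" using e by simp
      ultimately have "s w \<ge> a - 1"
        using s_mod_le [of w a] s_mod_le [of "x - 1" a] by linarith
      then show ?thesis using sn n a 3 by linarith
    qed
  qed
qed

lemma sparse_multiple_no_four:
  assumes n: "odd n" "s n = 9" "s (3 * n) = 4"
  shows "s (n\<^sup>2) \<noteq> 5"
proof -
  have "n \<noteq> 1" using n by auto
  have "s (Suc (2 * 1) * n) \<le> 4" "s n \<le> 9" using n by simp_all
  from multiple_search_root [OF sparse_triple_search n(1) \<open>n \<noteq> 1\<close> this(2,1)] show ?thesis
  proof
    assume "n \<in> set [3, 7, 11, 15, 23, 27, 43, 47, 55, 59, 87, 91, 107, 171, 175, 183, 187, 215, 219, 235, 343, 347, 363, 427, 683, 687, 695, 699, 727, 731, 747, 855, 859, 875, 939, 1367, 1371, 1387, 1451, 1707, 2731, 2735, 2743, 2747, 2775, 2779, 2795, 2903, 2907, 2923, 2987, 3415, 3419, 3435, 3499, 3755, 5463, 5467, 5483, 5547, 5803, 6827, 10923, 10927, 10935, 10939, 10967, 10971, 10987, 11095, 11099, 11115, 11179, 11607, 11611, 11627, 11691, 11947, 13655, 13659, 13675, 13739, 13995, 15019, 21847, 21851, 21867, 21931, 22187, 23211, 27307, 43691]"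
    then show ?thesis using sparse_triple_search_squares n(2) by blast
  next
    assume "\<exists>j. n mod 2 ^ j \<noteq> n \<and> Suc (2 * 1) * (n mod 2 ^ j) < 2 ^ j
      \<and> 2 \<le> s (Suc (2 * 1) * (n mod 2 ^ j))"
    then obtain j where j: "n mod 2 ^ j \<noteq> n" "3 * (n mod 2 ^ j) < 2 ^ j" "2 \<le> s (3 * (n mod 2 ^ j))"
      by auto
    define x where "x = n mod 2 ^ j"
    have "s (3 * (n div 2 ^ j)) \<ge> 2" 
      using split_at_gap(2) [OF j(1,2)] by (intro s_odd_mult_ge_2) auto
    then have sx: "s (3 * x) = 2" and sy: "s (3 * (n div 2 ^ j)) = 2"
      using split_at_gap(1) [OF j(1,2)] n(3) j(3) unfolding x_def by linarith+
    obtain v y where vy: "n div 2 ^ j = 2 ^ v * y" "odd y" "s y = s (n div 2 ^ j)"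
      using split_at_gap(2) [OF j(1,2)] by (rule s_shift_odd)
    define h where "h = j + v"
    have "n = x + 2 ^ j * (n div 2 ^ j)" by (simp add: x_def)
    then have nxy: "n = x + 2 ^ h * y" unfolding vy(1) h_def by (simp add: power_add)
    have "3 * (n div 2 ^ j) = 2 ^ v * (3 * y)" unfolding vy(1) by simp
    then have sy: "s (3 * y) = 2" using sy by (simp only: s_pow_mult)
    have "(2::nat) ^ j \<le> 2 ^ h" unfolding h_def by (intro power_increasing) auto
    then have xh: "3 * x < 2 ^ h" using j(2) unfolding x_def by linarith
    have "odd x"
    proof -
      have "j \<noteq> 0" using j(2,3) by (intro notI) simp
      then show ?thesis using n(1) nxy by (simp add: h_def)
    qed
    have sxy: "s x + s y = 9" using s_split [of x h y] xh nxy n(2) by simp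
    \<comment> \<open>These are the numbers \<open>(2 ^ (2 * j + 1) + 1) div 3\<close> with at most
      8 ones, the solutions of \<open>s (3 * t) = 2\<close>.\<close>
    have x: "x \<in> {1, 3, 11, 43, 171, 683, 2731, 10923}" and y: "y \<in> {1, 3, 11, 43, 171, 683, 2731, 10923}"
    proof -
      have nz: "s z \<ge> 1" if "odd z" for z using that by (intro s_pos) (auto intro: Nat.gr0I)
      have "t \<in> {1, 3, 11, 43, 171, 683, 2731, 10923}" if "odd t" "s t \<le> 8" "s (3 * t) = 2" for t
        using sparse_multiple_3 [of t] that by auto
      then show "x \<in> {1, 3, 11, 43, 171, 683, 2731, 10923}" "y \<in> {1, 3, 11, 43, 171, 683, 2731, 10923}"
        using sxy nz [OF \<open>odd x\<close>] nz [OF vy(2)] \<open>odd x\<close> vy(2) sx sy by simp_all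
    qed
    show ?thesis
    \<comment> \<open>From 28 on the blocks of the square do not overlap, because
      \<open>x\<^sup>2\<close> and \<open>x * y\<close> are below \<open>2 ^ 27\<close> and the
      cross term is doubled. Smaller shifts are checked one by one.\<close>
    proof (cases "h < 28")
      case True
      have chk: "\<forall>h \<in> set [0..<28]. \<forall>(x, y) \<in> set [(1, 10923), (3, 2731), (11, 683), (43, 171), (171, 43), (683, 11), (2731, 3), (10923, 1)].
        3 * x < 2 ^ h \<longrightarrow> s ((x + 2 ^ h * y)\<^sup>2) \<noteq> 5"
        by (simp add: upt_rec)
      have "\<forall>x \<in> {1, 3, 11, 43, 171, 683, 2731, 10923}. \<forall>y \<in> {1, 3, 11, 43, 171, 683, 2731, 10923}. s x + s y = 9 \<longrightarrow>
        (x, y) \<in> set [(1, 10923), (3, 2731), (11, 683), (43, 171), (171, 43), (683, 11), (2731, 3), (10923, 1)]"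
        by simp
      then have "(x, y) \<in> set [(1, 10923), (3, 2731), (11, 683), (43, 171), (171, 43), (683, 11), (2731, 3), (10923, 1)]"
        using x y sxy by blast
      moreover have "h \<in> set [0..<28]" using True by simp
      ultimately show ?thesis using chk xh unfolding nxy by blast
    next
      case False
      then obtain g where g: "h = Suc g" "27 \<le> g" by (cases h) auto
      have big: "(2::nat) ^ 27 \<le> 2 ^ g" using g(2) by (intro power_increasing) auto
      have "\<forall>x \<in> {1, 3, 11, 43, 171, 683, 2731, 10923}. \<forall>y \<in> {1, 3, 11, 43, 171, 683, 2731, 10923}.
        x\<^sup>2 < 2 ^ 27 \<and> x * y < (2 :: nat) ^ 27" by simp
      then have "x\<^sup>2 < 2 ^ 27" "x * y < 2 ^ 27" using x y by blast+
      moreover have "(2::nat) ^ Suc h = 4 * 2 ^ g" unfolding g(1) by simp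
      ultimately have b1: "x\<^sup>2 < 2 ^ Suc h" and b2: "x * y < 2 ^ g" using big by linarith+
      have "n\<^sup>2 = x\<^sup>2 + 2 ^ Suc h * (x * y + 2 ^ g * y\<^sup>2)"
        unfolding nxy g(1) by (simp add: power2_eq_square algebra_simps)
      then have "s (n\<^sup>2) = s (x\<^sup>2) + (s (x * y) + s (y\<^sup>2))"
        by (simp only: s_split [OF b1] s_split [OF b2])
      moreover have "\<forall>x \<in> {1, 3, 11, 43, 171, 683, 2731, 10923}. \<forall>y \<in> {1, 3, 11, 43, 171, 683, 2731, 10923}. s x + s y = 9 \<longrightarrow>
        s (x\<^sup>2) + (s (x * y) + s (y\<^sup>2)) \<noteq> 5" by simp
      ultimately show ?thesis using x y sxy by metis
    qed
  qed
qed

lemma pair_bound_few: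
  assumes "a \<in> {3, 7, 13, 15, 23, 47, 111, 5, 9, 17, 33, 65, 129, 257, 513}" and n: "odd n" "s n \<le> 9" "s (a * n) \<le> 3"
  shows "s a + s n < s (a\<^sup>2) + s (a * n) + s (n\<^sup>2)"
proof -
  from assms(1) consider "a = 3" | "a = 7" | "a = 13" | "a = 15" | "a = 23" | "a = 47" | "a = 111" | "a = 5" | "a = 9" | "a = 17" | "a = 33" | "a = 65" | "a = 129" | "a = 257" | "a = 513" by auto
  then show ?thesis
  proof cases
    case 1
    then show ?thesis using sparse_multiple_3 [OF n(1,2)] n(3) by auto
  next
    case 2
    then show ?thesis using sparse_multiple_7 [OF n(1,2)] n(3) by auto
  next
    case 3
    then show ?thesis using sparse_multiple_13 [OF n(1,2)] n(3) by auto
  next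
    case 4
    then show ?thesis using sparse_multiple_15 [OF n(1,2)] n(3) by auto
  next
    case 5
    then show ?thesis using sparse_multiple_23 [OF n(1,2)] n(3) by auto
  next
    case 6
    then show ?thesis using sparse_multiple_47 [OF n(1,2)] n(3) by auto
  next
    case 7
    then show ?thesis using sparse_multiple_111 [OF n(1,2)] n(3) by auto
  next
    case 8
    then show ?thesis using sparse_multiple_5 [OF n(1,2)] n(3) by auto
  next
    case 9
    then show ?thesis using sparse_multiple_9 [OF n(1,2)] n(3) by auto
  next
    case 10
    then show ?thesis using sparse_multiple_17 [OF n(1,2)] n(3) by auto
  next
    case 11
    then show ?thesis using sparse_multiple_33 [OF n(1,2)] n(3) by auto
  next
    case 12
    then show ?thesis using sparse_multiple_65 [OF n(1,2)] n(3) by auto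
  next
    case 13
    then show ?thesis using sparse_multiple_129 [OF n(1,2)] n(3) by auto
  next
    case 14
    then show ?thesis using sparse_multiple_257 [OF n(1,2)] n(3) by auto
  next
    case 15
    then show ?thesis using sparse_multiple_513 [OF n(1,2)] n(3) by auto
  qed
qed

lemma one_plus_pow_cases:
  assumes "1 \<le> m" "m < 10"
  shows "1 + 2 ^ m \<in> {3, 5, 9, 17, 33, 65, 129, 257, 513 :: nat}"
proof -
  have "m \<in> {1, 2, 3, 4, 5, 6, 7, 8, 9}" using assms by auto
  then show ?thesis by auto
qed

lemma s_one_plus_pow [simp]: "1 \<le> m \<Longrightarrow> s (Suc (2 ^ m)) = 2"
  using s_split [OF one_less_power [of "2::nat" m], of 1] by simp

lemma s_square_ge_2: "odd n \<Longrightarrow> n \<noteq> 1 \<Longrightarrow> s (n\<^sup>2) \<ge> 2"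
  unfolding power2_eq_square by (intro s_odd_mult_ge_2) (auto intro: Nat.gr0I)

text \<open>For \<open>m = 1\<close> the terms \<open>2 ^ Suc m\<close> and
  \<open>2 ^ (2 * m)\<close> coincide and 9 has only two ones; this exception makes the factor 3 the
  hardest one throughout.\<close>

lemma s_square_one_plus_pow: "2 \<le> m \<Longrightarrow> s ((1 + 2 ^ m)\<^sup>2) = 3"
proof -
  assume m: "2 \<le> m"
  then obtain h where h: "m = Suc h" "h \<ge> 1" by (cases m) auto
  have "(1 + 2 ^ m)\<^sup>2 = 1 + 2 ^ Suc m * (1 + 2 ^ h * (1::nat))"
    unfolding h by (simp add: power2_eq_square algebra_simps)
  moreover have "1 < (2::nat) ^ Suc m" "1 < (2::nat) ^ h" using h by (intro one_less_power; simp)+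
  ultimately have "s ((1 + 2 ^ m)\<^sup>2) = s 1 + (s 1 + s 1)"
    by (simp only: s_split)
  then show ?thesis by simp
qed

lemma pair_bound_few_power:
  assumes m: "1 \<le> m" and n: "odd n" "s n \<le> 9" "s ((1 + 2 ^ m) * n) \<le> 3"
  shows "2 + s n < s ((1 + 2 ^ m)\<^sup>2) + s ((1 + 2 ^ m) * n) + s (n\<^sup>2)"
proof (cases "m < 10")
  case True
  have "s (1 + 2 ^ m) = 2" using m by simp
  moreover have "1 + 2 ^ m \<in> {3, 7, 13, 15, 23, 47, 111, 5, 9, 17, 33, 65, 129, 257, 513 :: nat}"
    using one_plus_pow_cases [OF m True] by blast
  ultimately show ?thesis using pair_bound_few [OF _ n] by metis
next
  case False
  then have "n = 1 \<or> n = 1 + 2 ^ m" using sparse_multiple_large_power n by simp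
  moreover have "s ((1 + 2 ^ m)\<^sup>2) = 3" using False by (intro s_square_one_plus_pow) simp
  ultimately show ?thesis using m by (auto simp: power2_eq_square)
qed

text \<open>
  The bound 11 is sharp: \<open>a = b = 111\<close> gives 12 on both sides.
\<close>

lemma pair_bound_wlog:
  assumes prems: "odd a" "odd b" "s a + s b \<le> 11" and hyps: "s (a\<^sup>2) \<le> s (b\<^sup>2)"
  shows "s a + s b < s (a\<^sup>2) + s (a * b) + s (b\<^sup>2)"
proof -
  have sa: "s a \<ge> 1" "s b \<ge> 1" 
    using s_pos [OF odd_pos [OF prems(1)]] s_pos [OF odd_pos [OF prems(2)]] by simp_all
  show ?thesis
  proof (rule ccontr)
    assume neg: "\<not> ?thesis"
    have "s (b\<^sup>2) \<ge> 1" "s (a\<^sup>2) \<ge> 1" 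
      using s_pos [of "a\<^sup>2"] s_pos [of "b\<^sup>2"] odd_pos [OF prems(1)] odd_pos [OF prems(2)] by simp_all
    have a1: "a \<noteq> 1" using neg \<open>s (b\<^sup>2) \<ge> 1\<close> by auto
    then have p2: "s (a\<^sup>2) \<ge> 2" using s_square_ge_2 prems by blast
    have q2: "s (a * b) \<ge> 2" using s_odd_mult_ge_2 [OF prems(1) a1, of b] odd_pos [OF prems(2)] by simp
    have b1: "b \<noteq> 1" using p2 hyps by auto
    have sb: "s b \<ge> 2" "s a \<ge> 2" using odd_s_ge_2 prems a1 b1 by blast+
    \<comment> \<open>The three digit sums total at most 11, the product takes at least 2, and
      \<open>a\<close> has the sparser square.\<close>
    have "s (a\<^sup>2) \<le> 4" using neg q2 hyps prems(3) by linarith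
    then have "a \<in> {1, 7, 13, 15, 23, 47, 111} \<or> (\<exists>m \<ge> 1. a = 1 + 2 ^ m)"
      using prems sb by (intro sparse_square_cases) auto
    then consider m where "m \<ge> 1" "a = 1 + 2 ^ m" | "a \<in> {7, 13, 15, 23, 47, 111}" using a1 by auto
    note acase = this
    have q4: "s (a * b) \<ge> 4"
    proof (rule ccontr)
      assume "\<not> ?thesis"
      then have q: "s (a * b) \<le> 3" by simp
      have s9: "s b \<le> 9" using sb prems(3) by linarith
      show False
      proof (cases rule: acase)
        case 1
        then show False using pair_bound_few_power [of m b] s9 q prems neg by simp
      next
        case 2
        then show False using pair_bound_few [of a b] s9 q prems neg by auto
      qed
    qed
    \<comment> \<open>Among the sporadic factors only 111 has two ones more than its square, the
      others at most one more. Two factors lose 4 only if both are 111, which needs 12 ones; so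
      \<open>s (a * b) >= 4\<close> suffices.\<close>
    have pk: "s (t\<^sup>2) \<ge> 3 \<and> s t \<le> s (t\<^sup>2) + 2 \<and> (t \<noteq> 111 \<longrightarrow> s t \<le> s (t\<^sup>2) + 1)" 
      if "t \<in> {7, 13, 15, 23, 47, 111}" for t using that by auto
    show False
    proof (cases "s (b\<^sup>2) \<le> 4")
      case True
      then have "b \<in> {1, 7, 13, 15, 23, 47, 111} \<or> (\<exists>m \<ge> 1. b = 1 + 2 ^ m)"
        using prems sb by (intro sparse_square_cases) auto
      then have "(\<exists>m \<ge> 1. b = 1 + 2 ^ m) \<or> b \<in> {7, 13, 15, 23, 47, 111}" using b1 by auto
      then have "s b = 2 \<or> b \<in> {7, 13, 15, 23, 47, 111}" by auto
      moreover have "s a = 2 \<or> a \<in> {7, 13, 15, 23, 47, 111}" using acase by (cases rule: acase) auto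
      moreover have "\<not> (a = 111 \<and> b = 111)" using prems(3) by auto
      ultimately show False using pk [of a] pk [of b] neg q4 p2 hyps by auto
    next
      case False
      \<comment> \<open>The lower bounds 2, 4 and 5 already add up to 11, so all of them are
        attained.\<close>
      then have *: "s (a\<^sup>2) = 2" "s (a * b) = 4" "s (b\<^sup>2) = 5" "s a + s b = 11"
        using neg q4 p2 prems(3) by linarith+
      show False
      proof (cases rule: acase)
        case 1
        have "m = 1" using *(1) s_square_one_plus_pow [of m] 1 by (cases "m = 1") auto
        then have a3: "a = 3" using 1 by simp
        then have "s a = 2" by (simp del: numeral_3_eq_3)
        then have "s b = 9" using *(4) by linarith
        then show False using sparse_multiple_no_four [of b] prems(2) *(2,3) unfolding a3 by blast
      next
        case 2
        then show False using pk [OF 2] *(1) by simp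
      qed
    qed
  qed
qed

lemma pair_bound:
  assumes "odd a" "odd b" "s a + s b \<le> 11"
  shows "s a + s b < s (a\<^sup>2) + s (a * b) + s (b\<^sup>2)"
  using pair_bound_wlog [of a b] pair_bound_wlog [of b a] assms
  by (cases "s (a\<^sup>2) \<le> s (b\<^sup>2)") (simp_all add: ac_simps)

text \<open>One-sided form of \<open>pair_bound\<close>, used to compare an end of the square with
  its end cluster alone. If \<open>s a = 2\<close>, then \<open>s (a\<^sup>2) <= 3\<close> and
  \<open>pair_bound\<close> gives it. Otherwise \<open>s b <= 7\<close>, a failure would give
  \<open>s (b\<^sup>2) <= 4\<close>, and such \<open>b\<close> exceed their squares by at most two
  ones.\<close>

lemma half_bound:
  assumes ab: "odd a" "odd b" "s a + s b \<le> 10"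
  shows "s b \<le> s (a * b) + s (b\<^sup>2)"
proof (cases "a = 1 \<or> b = 1")
  case False
  have s2: "s a \<ge> 2" "s b \<ge> 2" using odd_s_ge_2 ab False by blast+
  have q: "s (a * b) \<ge> 2" using s_odd_mult_ge_2 [OF ab(1), of b] odd_pos [OF ab(2)] False by simp
  show ?thesis
  proof (cases "s a = 2")
    case True
    then obtain m where "a = 1 + 2 ^ m" "m \<ge> 1" using ab by (auto elim: odd_s_2)
    then have "a = 3 \<or> s (a\<^sup>2) = 3" using s_square_one_plus_pow [of m] by (cases "m = 1") auto
    then have "s (a\<^sup>2) \<le> 3" by auto
    then show ?thesis using pair_bound [OF ab(1,2)] True ab(3) by linarith
  next
    case f2: False
    show ?thesis
    proof (rule ccontr)
      assume neg: "\<not> ?thesis"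
      then have "s (b\<^sup>2) \<le> 4" using f2 s2 ab(3) q by linarith
      then have "b \<in> {1, 7, 13, 15, 23, 47, 111} \<or> (\<exists>m \<ge> 1. b = 1 + 2 ^ m)"
        using ab s2 by (intro sparse_square_cases) auto
      then show False using neg q False by auto
    qed
  qed
qed (use s_pos [of "b\<^sup>2"] odd_pos [OF ab(2)] in auto)

text \<open>Serves three clusters with ends 3 and \<open>1 + 2 ^ m\<close>: a middle cluster cannot
  have sparse products with both. The candidates for 3 come from its table, and large
  \<open>m\<close> from \<open>sparse_multiple_large_power\<close>.\<close>

lemma sparse_common_multiple:
  assumes n: "odd n" "s n = 6 \<or> s n = 7" "s (3 * n) \<le> 3" and m: "m \<ge> 2"
  shows "s ((1 + 2 ^ m) * n) \<ge> 4"
proof (rule ccontr)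
  assume "\<not> ?thesis"
  then have q: "s ((1 + 2 ^ m) * n) \<le> 3" by simp
  show False
  proof (cases "m < 10")
    case False
    have "s n \<le> 9" using n(2) by auto
    with False have "n = 1 \<or> n = 1 + 2 ^ m" using sparse_multiple_large_power [of m n] q n(1) by simp
    then show False using n(2) m by auto
  next
    case True
    then have "m \<in> {2, 3, 4, 5, 6, 7, 8, 9}" using m by auto
    moreover have "n \<in> set [343, 347, 363, 427, 683, 1367, 1371, 1387, 1451, 1707, 2731]" using n sparse_multiple_3 [of n] by auto
    ultimately show False using q by auto
  qed
qed

section \<open>Three to six clusters\<close>

lemma pow_mod_4: "(2::nat) < 2 ^ w \<Longrightarrow> 2 ^ w mod 4 = (0::nat)"
proof -
  assume "(2::nat) < 2 ^ w"
  then have "(2::nat) ^ 1 < 2 ^ w" by simp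
  then have "1 < w" by (rule power_less_imp_less_exp [rotated]) simp
  then have "2 ^ 2 dvd (2::nat) ^ w" by (intro le_imp_power_dvd) simp
  then show ?thesis by (simp add: dvd_imp_mod_0)
qed

lemma pow_mod_8: "(4::nat) < 2 ^ w \<Longrightarrow> 2 ^ w mod 8 = (0::nat)"
proof -
  assume "(4::nat) < 2 ^ w"
  then have "(2::nat) ^ 2 < 2 ^ w" by simp
  then have "2 < w" by (rule power_less_imp_less_exp [rotated]) simp
  then have "2 ^ 3 dvd (2::nat) ^ w" by (intro le_imp_power_dvd) simp
  then show ?thesis by (simp add: dvd_imp_mod_0)
qed

text \<open>With unequal exponents the sum is a power of two times an odd number above 1.\<close>

lemma power_sum_aligned:
  assumes xy: "odd x" "odd y" "s (2 ^ u * x + 2 ^ v * y) = 1"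
  obtains w where "u = v" "x + y = 2 ^ w"
proof -
  have less: False if "u < v" "odd x" "odd y" "2 ^ u * x + 2 ^ v * y = 2 ^ w" for u v w x y :: nat
  proof -
    have "2 ^ v = 2 ^ u * (2::nat) ^ (v - u)" using that(1) by (simp flip: power_add)
    then have "2 ^ u * (x + 2 ^ (v - u) * y) = 2 ^ w" using that(4) by (simp add: algebra_simps)
    then have "x + 2 ^ (v - u) * y dvd 2 ^ w" by (metis dvd_triv_right)
    moreover have "odd (x + 2 ^ (v - u) * y)" using that by simp
    ultimately have "x + 2 ^ (v - u) * y = 1" by (rule odd_dvd_pow2 [rotated])
    moreover have "2 ^ (v - u) * y > 0" using odd_pos [OF that(3)] by simp
    ultimately show False using odd_pos [OF that(2)] by linarith
  qed
  obtain w where w: "2 ^ u * x + 2 ^ v * y = 2 ^ w" using xy(3) by (auto simp: s_eq_1_iff)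
  have uv: "u = v"
    using less [of u v x y w] less [of v u y x w] xy w by (cases u v rule: linorder_cases) (auto simp: add.commute)
  then have "s (2 ^ u * (x + y)) = 1" using xy(3) by (simp add: algebra_simps)
  then have "s (x + y) = Suc 0" by simp
  then show ?thesis using uv that by (auto simp: s_eq_1_iff simp del: One_nat_def)
qed

lemma aligned_mod_4:
  assumes "odd x" "odd y" "s (2 ^ u * x + 2 ^ v * y) = 1" "2 < x + y"
  shows "(x + y) mod 4 = 0"
  using power_sum_aligned [OF assms(1-3)] assms(4) pow_mod_4 by metis

lemma aligned_mod_8:
  assumes "odd x" "odd y" "s (2 ^ u * x + 2 ^ v * y) = 1" "4 < x + y"
  shows "(x + y) mod 8 = 0"
  using power_sum_aligned [OF assms(1-3)] assms(4) pow_mod_8 by metis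

lemma mod_add_mult: "(a + b * c) mod m = (a mod m + (b mod m) * (c mod m)) mod (m::nat)"
proof -
  have "(a + b * c) mod m = (a mod m + (b * c) mod m) mod m" by (simp only: mod_add_eq)
  also have "\<dots> = (a mod m + ((b mod m) * (c mod m)) mod m) mod m" by (simp only: mod_mult_eq)
  finally show ?thesis by (simp only: mod_add_right_eq)
qed

lemma mod_4_of_mod_8: "n mod 8 = 0 \<Longrightarrow> n mod 4 = (0::nat)"
  by presburger

lemma mod_4_complement: "(a + b) mod 4 = 0 \<Longrightarrow> b mod 4 = 1 \<Longrightarrow> a mod 4 = (3::nat)"
  by presburger

lemma mod_8_complement: "(a + b) mod 8 = 0 \<Longrightarrow> b mod 8 = 1 \<Longrightarrow> a mod 8 = (7::nat)"
  by presburger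

lemma odd_mod_8: "odd n \<Longrightarrow> n mod 8 = 1 \<or> n mod 8 = 3 \<or> n mod 8 = 5 \<or> n mod 8 = (7::nat)"
  by presburger

lemma odd_mod_4: "odd n \<Longrightarrow> n mod 4 = 1 \<or> n mod 4 = (3::nat)"
  by presburger

lemma odd_square_mod_8: "odd n \<Longrightarrow> n\<^sup>2 mod 8 = (1::nat)"
proof -
  assume "odd n"
  then have "(n mod 8)\<^sup>2 mod 8 = 1" using odd_mod_8 [of n] by auto
  then show ?thesis by (simp only: power_mod)
qed

lemma odd_square_mod_4: "odd n \<Longrightarrow> n\<^sup>2 mod 4 = (1::nat)"
  using odd_square_mod_8 [of n] mod_mod_cancel [of 4 8 "n\<^sup>2"] by simp

lemma s_shifted_sum_pos: "odd x \<Longrightarrow> s (2 ^ u * x + y) \<ge> 1"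
  by (intro s_pos) (auto intro: odd_pos)

lemma odd_ge_3: "odd n \<Longrightarrow> n \<noteq> 1 \<Longrightarrow> n \<ge> (3::nat)"
  by presburger

lemma s_square_2_iff: "odd n \<Longrightarrow> s n \<le> 9 \<Longrightarrow> s (n\<^sup>2) = 2 \<Longrightarrow> n = 3"
proof -
  assume n: "odd n" "s n \<le> 9" "s (n\<^sup>2) = 2"
  then have "n \<in> {1, 7, 13, 15, 23, 47, 111} \<or> (\<exists>m \<ge> 1. n = 1 + 2 ^ m)"
    by (intro sparse_square_cases) auto
  moreover have "n \<notin> {1, 7, 13, 15, 23, 47, 111}" using n(3) by auto
  ultimately obtain m where m: "m \<ge> 1" "n = 1 + 2 ^ m" by blast
  have "m = 1" using s_square_one_plus_pow [of m] n(3) m by (cases "m = 1") auto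
  then show ?thesis using m by simp
qed

text \<open>7 and 23 are the sporadic factors whose squares have only three ones, so they need a
  better bound for the product.\<close>

lemma sparse_multiple_7_23:
  assumes "odd n" "s n \<le> 9" "a = 7 \<or> a = 23"
  shows "s (a * n) \<ge> 3"
  using assms(3) sparse_multiple_7 [OF assms(1,2)] sparse_multiple_23 [OF assms(1,2)]
  by (cases "s (a * n) \<le> 3") auto

text \<open>
  In the remaining lemmas of this section the arguments of \<open>s\<close> are the sums of colliding terms when the clusters are almost in arithmetic
  progression; the exponents are only known to be close to each other. A sum of two odd multiples of powers of two is a
  power of two only if the powers agree, so most cases are decided modulo 8.
\<close>

lemma four_cluster_bound:
  assumes o: "odd b2" "odd b3" "odd b4" and b4: "b4 \<noteq> 1" and k: "s b2 + s b3 + s b4 \<le> 10"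
  shows "s b3 + s b4 < s (2 ^ u1 * b3 + 2 ^ v1 * b2\<^sup>2) + s (2 ^ u2 * b4 + 2 ^ v2 * (b2 * b3))
    + s (2 ^ u3 * (b2 * b4) + 2 ^ v3 * b3\<^sup>2) + s (b3 * b4) + s (b4\<^sup>2)"
proof (rule ccontr)
  assume neg: "\<not> ?thesis"
  define x1 x2 x3 where x: "x1 = s (2 ^ u1 * b3 + 2 ^ v1 * b2\<^sup>2)" "x2 = s (2 ^ u2 * b4 + 2 ^ v2 * (b2 * b3))"
    "x3 = s (2 ^ u3 * (b2 * b4) + 2 ^ v3 * b3\<^sup>2)"
  have oo: "odd (b2 * b3)" "odd (b2 * b4)" "odd (b2\<^sup>2)" "odd (b3\<^sup>2)" using o by simp_all
  have x_pos: "x1 \<ge> 1" "x2 \<ge> 1" "x3 \<ge> 1" unfolding x by (intro s_shifted_sum_pos o oo)+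
  have sum: "x1 + x2 + x3 + s (b3 * b4) + s (b4\<^sup>2) \<le> s b3 + s b4" using neg unfolding x by simp
  have p: "s (b4\<^sup>2) \<ge> 2" using s_square_ge_2 o(3) b4 .
  have k2: "s b2 \<ge> 1" using s_pos [OF odd_pos [OF o(1)]] .
  have b3: "b3 \<noteq> 1"
  proof
    assume "b3 = 1"
    then show False using sum p x_pos by simp
  qed
  have g: "b3 \<ge> 3" "b4 \<ge> 3" using odd_ge_3 o b3 b4 by blast+
  have q: "s (b3 * b4) \<ge> 2" using s_odd_mult_ge_2 [OF o(2) b3, of b4] g by simp
  have b23: "b2 * b3 \<ge> 3" and b24: "b2 * b4 \<ge> 3"
    using mult_le_mono [of 1 b2 3 b3] mult_le_mono [of 1 b2 3 b4] odd_pos [OF o(1)] g by simp_all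
  have b33: "b3\<^sup>2 \<ge> 9" using mult_le_mono [of 3 b3 3 b3] g by (simp add: power2_eq_square)
  have b22: "b2\<^sup>2 \<ge> 1" using odd_pos [OF o(1)] by simp
  have A1: "(b3 + b2\<^sup>2) mod 4 = 0" if "x1 = 1"
    using aligned_mod_4 [OF o(2) oo(3)] that g b22 unfolding x by force
  have A2: "(b4 + b2 * b3) mod 8 = 0" if "x2 = 1"
    using aligned_mod_8 [OF o(3) oo(1)] that g b23 unfolding x by force
  have A3: "(b2 * b4 + b3\<^sup>2) mod 8 = 0" if "x3 = 1"
    using aligned_mod_8 [OF oo(2) oo(4)] that b24 b33 unfolding x by force
  have m4: "b2\<^sup>2 mod 4 = 1" "b3\<^sup>2 mod 4 = 1" "b3\<^sup>2 mod 8 = 1" 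
    using o by (simp_all add: odd_square_mod_4 odd_square_mod_8)
  have A1': "b3 mod 4 = 3" if "x1 = 1"
    using mod_4_complement [OF A1 [OF that] m4(1)] .
  have A2': "(b4 mod 4 + (b2 mod 4) * (b3 mod 4)) mod 4 = 0" if "x2 = 1"
  proof -
    have "(b4 + b2 * b3) mod 4 = 0" using mod_4_of_mod_8 [OF A2 [OF that]] .
    then show ?thesis by (simp only: mod_add_mult [of b4 b2 b3 4])
  qed
  have A3': "((b2 mod 4) * (b4 mod 4)) mod 4 = 3" if "x3 = 1"
  proof -
    have "(b2 * b4) mod 4 = 3"
      by (rule mod_4_complement [OF mod_4_of_mod_8 [OF A3 [OF that]] m4(2)])
    then show ?thesis by (simp only: mod_mult_eq)
  qed
  \<comment> \<open>Three powers of two are incompatible modulo 4.\<close>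
  have tot: "x1 + x2 + x3 \<ge> 4"
  proof (rule ccontr)
    assume "\<not> ?thesis"
    then have one: "x1 = 1" "x2 = 1" "x3 = 1" using x_pos by linarith+
    show False using A1' [OF one(1)] A2' [OF one(2)] A3' [OF one(3)] odd_mod_4 [OF o(1)] odd_mod_4 [OF o(3)]
      by auto
  qed
  show False
  proof (cases "s (b4\<^sup>2) = 2")
    case True
    have b4: "b4 = 3" using s_square_2_iff [OF o(3) _ True] k k2 by simp
    then have k3: "s b3 + s b2 \<le> 8" "x1 + x2 + x3 + s (b3 * 3) \<le> s b3" using k sum True by simp_all
    have C3: "b2 mod 8 = 5" if "x3 = 1"
    proof -
      have "(b2 * 3) mod 8 = 7" using mod_8_complement [OF A3 [OF that] m4(3)] unfolding b4 .
      then show ?thesis using odd_mod_8 [OF o(1)] mod_mult_left_eq [of b2 8 3] by auto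
    qed
    show False
    proof (cases "s (b3 * 3) = 2")
      case q2: True
      have "odd (b3 * 3)" using o by simp
      then obtain i where i: "b3 * 3 = 1 + 2 ^ i" using q2 by (rule odd_s_2)
      then have "(4::nat) < 2 ^ i" using g by linarith
      then have "(b3 * 3) mod 8 = 1" using pow_mod_8 [of i] i mod_add_eq [of "1::nat" 8 "2 ^ i"] by simp
      then have b38: "b3 mod 8 = 3" 
        using odd_mod_8 [OF o(2)] mod_mult_left_eq [of b3 8 3] by auto
      have "b3 \<noteq> 3" using k3 tot q2 by (intro notI) simp
      then have "4 < b3 + b2\<^sup>2" using g b22 by linarith
      then have "x1 \<noteq> 1" using aligned_mod_8 [OF o(2) oo(3), of u1 v1] odd_square_mod_8 [OF o(1)] b38
        mod_add_eq [of b3 8 "b2\<^sup>2"] unfolding x by auto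
      moreover have C2: "b2 mod 8 = 7" if "x2 = 1"
      proof -
        have "(3 + (b2 mod 8) * (b3 mod 8)) mod 8 = 0"
          using A2 [OF that] mod_add_mult [of 3 b2 b3 8] unfolding b4 by simp
        then show ?thesis using odd_mod_8 [OF o(1)] b38 by auto
      qed
      ultimately have t5: "x1 + x2 + x3 \<ge> 5" using x_pos C3 by (cases "x2 = 1"; cases "x3 = 1") auto
      then have "s b2 = 1" using k3 q2 k2 by linarith
      then have "b2 = 1" using odd_s_eq_1 o(1) by blast
      then have "x2 \<noteq> 1" "x3 \<noteq> 1" using C2 C3 by auto
      then show False using \<open>x1 \<noteq> 1\<close> x_pos k3 q2 k2 by linarith
    next
      case False
      then have q3: "s (b3 * 3) \<ge> 3" using q b4 by simp
      then have "s b2 = 1" "x1 + x2 + x3 = 4" using k3 tot k2 by linarith+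
      then have "b2 = 1" using odd_s_eq_1 o(1) by blast
      then have "x3 \<noteq> 1" using C3 by auto
      then have "x1 = 1" "x2 = 1" using \<open>x1 + x2 + x3 = 4\<close> x_pos by linarith+
      then show False using A1' A2' \<open>b2 = 1\<close> b4 by simp
    qed
  next
    case False
    \<comment> \<open>The bounds 4, 2 and 3 exhaust the at most 9 ones of \<open>b3\<close> and
      \<open>b4\<close>. It will follow that \<open>b3\<close> and \<open>b4\<close> are both 1
      modulo 4, which makes \<open>x1\<close> and \<open>x3\<close> at least 2 and their total with
      \<open>x2\<close> too large.\<close>
    then have eqs: "s b2 = 1" "s (b4\<^sup>2) = 3" "s (b3 * b4) = 2" "x1 + x2 + x3 = 4" 
      using p q tot sum k k2 by linarith+
    have b2: "b2 = 1" using odd_s_eq_1 o(1) eqs(1) by blast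
    have s9: "s b3 \<le> 9" "s b4 \<le> 9" using k k2 by linarith+
    have "b4 \<in> {1, 7, 13, 15, 23, 47, 111} \<or> (\<exists>m \<ge> 1. b4 = 1 + 2 ^ m)"
      using o eqs s9 by (intro sparse_square_cases) auto
    moreover have "\<not> (b4 = 7 \<or> b4 = 23)"
      using sparse_multiple_7_23 [OF o(2) s9(1), of b4] eqs(3) by (auto simp: mult.commute)
    moreover have "b4 \<notin> {1, 13, 15, 47, 111}" using eqs(2) by auto
    ultimately obtain m where m: "m \<ge> 1" "b4 = 1 + 2 ^ m" by auto
    have "m \<noteq> 1"
    proof
      assume "m = 1"
      then have "b4 = 3" using m by simp
      then show False using False by simp
    qed
    then have "(2::nat) ^ 2 \<le> 2 ^ m" using m by (intro power_increasing) auto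
    then have m41: "b4 mod 4 = 1" using pow_mod_4 [of m] m(2) mod_add_eq [of "1::nat" 4 "2 ^ m"] by simp
    have "odd (b3 * b4)" using o by simp
    then obtain i where i: "b3 * b4 = 1 + 2 ^ i" using eqs(3) by (rule odd_s_2)
    have "b3 * b4 \<ge> 9" using mult_le_mono [OF g] by simp
    then have "(2::nat) < 2 ^ i" using i by linarith
    then have "(b3 * b4) mod 4 = 1" using pow_mod_4 [of i] i mod_add_eq [of "1::nat" 4 "2 ^ i"] by simp
    then have "((b3 mod 4) * (b4 mod 4)) mod 4 = 1" by (simp only: mod_simps)
    then have m31: "b3 mod 4 = 1" using m41 by simp
    have "x1 \<noteq> 1" using A1' m31 by auto
    moreover have "x3 \<noteq> 1" using A3' b2 m41 by auto
    ultimately show False using eqs(4) x_pos by linarith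
  qed
qed

text \<open>Serves the tight case in which both outer clusters are 3. Modulo 4 the alignment makes
  \<open>3 * b3\<close> equal to 3, so in \<open>3 * b3 = 1 + 2 ^ i\<close> the power is 2 and
  \<open>b3 = 1\<close>. Then \<open>3 + b2\<^sup>2\<close> is 4 modulo 8 and a power of two, hence
  4.\<close>

lemma four_cluster_ends:
  assumes o: "odd b2" "odd b3" and one: "s (2 ^ u * (3 * b3) + 2 ^ v * b2\<^sup>2) = 1" and b3: "s (3 * b3) = 2"
  shows "b2 = 1 \<and> b3 = 1"
proof -
  have oo: "odd (3 * b3)" "odd (b2\<^sup>2)" using o by simp_all
  obtain i where i: "3 * b3 = 1 + 2 ^ i" using oo(1) b3 by (rule odd_s_2)
  have m: "b2\<^sup>2 mod 8 = 1" using o by (simp add: odd_square_mod_8)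
  have b2: "b2\<^sup>2 \<ge> 1" using odd_pos [OF o(1)] by simp
  have "2 < 3 * b3 + b2\<^sup>2" using odd_pos [OF o(2)] b2 by linarith
  then have "(3 * b3 + b2\<^sup>2) mod 4 = 0" by (rule aligned_mod_4 [OF oo one])
  then have m3: "(3 * b3) mod 4 = 3"
    by (rule mod_4_complement [OF _ odd_square_mod_4 [OF o(1)]])
  have "\<not> (2::nat) < 2 ^ i"
  proof
    assume "(2::nat) < 2 ^ i"
    then obtain a where "(2::nat) ^ i = 4 * a" using pow_mod_4 [of i] by (auto elim!: dvdE simp: mod_eq_0_iff_dvd)
    then show False using m3 unfolding i by simp
  qed
  then have "b3 = 1" using i odd_pos [OF o(2)] by linarith
  moreover have "\<not> 4 < 3 * b3 + b2\<^sup>2"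
    using aligned_mod_8 [OF oo one] m \<open>b3 = 1\<close> mod_add_eq [of "3::nat" 8 "b2\<^sup>2"] by auto
  ultimately have "b2\<^sup>2 = 1" using b2 by linarith
  then show ?thesis using \<open>b3 = 1\<close> by simp
qed

text \<open>Only the difference of the exponents matters. From \<open>D\<close> on the two numbers
  do not overlap and their digit sums add; below \<open>D\<close> there are finitely many
  cases.\<close>

lemma shifted_sum_lower:
  assumes D: "c < 2 ^ D" "d < 2 ^ D" "t \<le> s c + s d"
    and chk: "\<forall>i \<in> set [0..<D]. t \<le> s (c + 2 ^ i * d) \<and> t \<le> s (2 ^ i * c + d)"
  shows "t \<le> s (2 ^ u * c + 2 ^ v * d)"
proof (cases "u \<le> v")
  case True
  then have "2 ^ u * c + 2 ^ v * d = 2 ^ u * (c + 2 ^ (v - u) * d)"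
    by (simp add: algebra_simps flip: power_add)
  then have eq: "s (2 ^ u * c + 2 ^ v * d) = s (c + 2 ^ (v - u) * d)" by simp
  show ?thesis
  proof (cases "v - u < D")
    case False
    then have "(2::nat) ^ D \<le> 2 ^ (v - u)" by (intro power_increasing) auto
    then have "c < 2 ^ (v - u)" using D by linarith
    then show ?thesis using eq D s_split [of c "v - u" d] by simp
  qed (use chk eq in simp)
next
  case False
  then have "2 ^ u * c + 2 ^ v * d = 2 ^ v * (d + 2 ^ (u - v) * c)"
    by (simp add: algebra_simps flip: power_add)
  then have eq: "s (2 ^ u * c + 2 ^ v * d) = s (d + 2 ^ (u - v) * c)" by simp
  show ?thesis
  proof (cases "u - v < D")
    case False
    then have "(2::nat) ^ D \<le> 2 ^ (u - v)" by (intro power_increasing) auto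
    then have "d < 2 ^ (u - v)" using D by linarith
    then show ?thesis using eq D s_split [of d "u - v" c] by simp
  qed (use chk eq in \<open>simp add: add.commute\<close>)
qed

text \<open>683 and 2731 are the middle clusters that survive between two clusters 3. The bound 23
  comes from \<open>2731\<^sup>2 < 2 ^ 23\<close>.\<close>

lemma shifted_nine_sum:
  "3 \<le> s (2 ^ u * 9 + 2 ^ v * 683\<^sup>2)" "4 \<le> s (2 ^ u * 9 + 2 ^ v * 2731\<^sup>2)"
  by (rule shifted_sum_lower [where D = 23]; simp add: upt_rec)+

text \<open>The lighter end has at most 5 ones in its two terms, so the square of \<open>b1\<close>
  has at most 3 and \<open>b1\<close> is \<open>1 + 2 ^ m\<close>. The other end has a square with
  at most 4 ones, and the tables of sparse multiples decide its product with
  \<open>b2\<close>.\<close>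

lemma three_cluster_bound_wlog:
  assumes o: "odd b1" "odd b2" "odd b3" and k: "s b1 + s b2 + s b3 \<le> 11"
    and le: "s (b1\<^sup>2) + s (b1 * b2) \<le> s (b2 * b3) + s (b3\<^sup>2)"
  shows "s b1 + s b2 + s b3 < s (b1\<^sup>2) + s (b1 * b2) + s (2 ^ u * (b1 * b3) + 2 ^ v * b2\<^sup>2)
    + s (b2 * b3) + s (b3\<^sup>2)"
proof (rule ccontr)
  assume neg: "\<not> ?thesis"
  define x where "x = s (2 ^ u * (b1 * b3) + 2 ^ v * b2\<^sup>2)"
  define t where "t = s (b1\<^sup>2) + s (b1 * b2) + x + s (b2 * b3) + s (b3\<^sup>2)"
  have sum: "t \<le> s b1 + s b2 + s b3" using neg unfolding t_def x_def by simp
  have o13: "odd (b1 * b3)" "odd (b2\<^sup>2)" using o by simp_all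
  have x1: "x \<ge> 1" unfolding x_def by (intro s_shifted_sum_pos o13)
  have pos: "s b1 \<ge> 1" "s b2 \<ge> 1" "s b3 \<ge> 1" using s_pos odd_pos o by blast+
  have h: "s b3 \<le> s (b2 * b3) + s (b3\<^sup>2)" "s b1 \<le> s (b2 * b1) + s (b1\<^sup>2)"
    using half_bound [OF o(2,3)] half_bound [OF o(2,1)] k pos by simp_all
  have n1: "b1 \<noteq> 1"
  proof
    assume "b1 = 1"
    then show False using sum h(1) x1 unfolding t_def by simp
  qed
  have n3: "b3 \<noteq> 1"
  proof
    assume "b3 = 1"
    then show False using sum h(2) x1 unfolding t_def by (simp add: mult.commute)
  qed
  have p: "s (b1\<^sup>2) \<ge> 2" "s (b3\<^sup>2) \<ge> 2" using s_square_ge_2 o n1 n3 by blast+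
  have q: "s (b1 * b2) \<ge> 2" "s (b2 * b3) \<ge> 2"
    using s_odd_mult_ge_2 [OF o(1) n1, of b2] s_odd_mult_ge_2 [OF o(3) n3, of b2] odd_pos [OF o(2)]
    by (simp_all add: mult.commute)
  have k1: "s b1 \<ge> 2" "s b3 \<ge> 2" using odd_s_ge_2 o n1 n3 by blast+
  have s9: "s b1 \<le> 9" "s b2 \<le> 9" "s b3 \<le> 9" using k k1 pos by linarith+
  have "s (b1\<^sup>2) \<le> 3" using sum k le x1 q unfolding t_def by linarith
  then have "b1 \<in> {1, 7, 13, 15, 23, 47, 111} \<or> (\<exists>m \<ge> 1. b1 = 1 + 2 ^ m)"
    using o s9 by (intro sparse_square_cases) auto
  moreover have "b1 \<notin> {13, 15, 47, 111}" using \<open>s (b1\<^sup>2) \<le> 3\<close> by auto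
  moreover have "\<not> (b1 = 7 \<or> b1 = 23)"
  proof
    assume b1: "b1 = 7 \<or> b1 = 23"
    then have "s (b1 * b2) \<ge> 3" "s (b1\<^sup>2) = 3" using sparse_multiple_7_23 [OF o(2) s9(2)] by auto
    then show False using sum k le x1 unfolding t_def by linarith
  qed
  ultimately obtain m where m: "m \<ge> 1" "b1 = 1 + 2 ^ m" using n1 by auto
  then have k1: "s b1 = 2" by simp
  have pm: "m = 1 \<and> b1 = 3 \<and> s (b1\<^sup>2) = 2 \<or> m \<ge> 2 \<and> s (b1\<^sup>2) = 3"
  proof (cases "m = 1")
    case True
    then have "b1 = 3" using m by simp
    then show ?thesis using True by simp
  next
    case False
    then show ?thesis using s_square_one_plus_pow [of m] m by simp
  qed
  have m4: "(1 + 2 ^ m) mod 4 = (1 :: nat)" if "m \<ge> 2" for m :: nat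
  proof -
    have "2 ^ 2 dvd (2::nat) ^ m" using that by (rule le_imp_power_dvd)
    then show ?thesis by (auto elim!: dvdE)
  qed
  \<comment> \<open>Then the two colliding terms add up to 2 modulo 4, which no power of two above 2
    does.\<close>
  have x2: "x \<ge> 2" if "(b1 * b3) mod 4 = 1"
  proof -
    have "b1 * b3 \<ge> 9" using mult_le_mono [OF odd_ge_3 [OF o(1) n1] odd_ge_3 [OF o(3) n3]] by simp
    then have "x \<noteq> 1"
      using aligned_mod_4 [OF o13, of u v] that odd_square_mod_4 [OF o(2)] mod_add_eq [of "b1 * b3" 4 "b2\<^sup>2"]
      unfolding x_def by auto
    then show ?thesis using x1 by simp
  qed
  have "s (b3\<^sup>2) \<le> 4" using sum k p q x1 unfolding t_def by linarith
  then have "b3 \<in> {1, 7, 13, 15, 23, 47, 111} \<or> (\<exists>m \<ge> 1. b3 = 1 + 2 ^ m)"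
    using o s9 by (intro sparse_square_cases) auto
  then consider l where "l \<ge> 1" "b3 = 1 + 2 ^ l" | "b3 \<in> {7, 13, 15, 23, 47, 111}" using n3 by auto
  then show False
  proof cases
    case 1
    then have k3: "s b3 = 2" by simp
    have pl: "l = 1 \<and> b3 = 3 \<and> s (b3\<^sup>2) = 2 \<or> l \<ge> 2 \<and> s (b3\<^sup>2) = 3"
    proof (cases "l = 1")
      case True
      then have "b3 = 3" using 1 by simp
      then show ?thesis using True by simp
    next
      case False
      then show ?thesis using s_square_one_plus_pow [of l] 1 by simp
    qed
    have cm: "s (3 * b2) \<ge> 4 \<or> s ((1 + 2 ^ r) * b2) \<ge> 4" if "r \<ge> 2" "s b2 = 6 \<or> s b2 = 7" for r
      using sparse_common_multiple [OF o(2) that(2) _ that(1)] by linarith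
    consider "b1 = 3" "b3 = 3" | "b1 = 3" "l \<ge> 2" "s (b1\<^sup>2) = 2" "s (b3\<^sup>2) = 3"
      | "m \<ge> 2" "b3 = 3" "s (b1\<^sup>2) = 3" "s (b3\<^sup>2) = 2" | "m \<ge> 2" "l \<ge> 2" "s (b1\<^sup>2) = 3" "s (b3\<^sup>2) = 3"
      using pm pl by blast
    then show False
    proof cases
      case b: 1
      then have xx: "x \<ge> 2" using x2 by simp
      have t: "t = 4 + 2 * s (3 * b2) + x" unfolding t_def b by (simp add: mult.commute)
      then have "2 * s (3 * b2) + x \<le> s b2" "s b2 \<le> 7" using sum k1 k3 k by linarith+
      then have "s (3 * b2) = 2" "x + 4 \<le> s b2" using xx q b by (simp_all add: mult.commute)
      then have "b2 \<in> {683, 2731}"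
        using sparse_multiple_3 [OF o(2) s9(2)] xx \<open>s b2 \<le> 7\<close> by auto
      moreover have "x = s (2 ^ u * 9 + 2 ^ v * b2\<^sup>2)" unfolding x_def b by simp
      ultimately show False using shifted_nine_sum [of u v] \<open>x + 4 \<le> s b2\<close> by auto
    next
      case b: 2
      then have "6 \<le> s b2" "s b2 \<le> 7" "s (3 * b2) + s (b2 * b3) \<le> 5"
        using sum k k1 k3 q x1 unfolding t_def b(1) by linarith+
      moreover have "s (b2 * b3) = s ((1 + 2 ^ l) * b2)" unfolding 1(2) by (simp only: mult.commute)
      moreover have "s b2 = 6 \<or> s b2 = 7" using calculation by linarith
      moreover have "s (b1 * b2) = s (3 * b2)" unfolding b(1) ..
      ultimately show False using cm [OF b(2)] q by linarith
    next
      case b: 3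
      then have "6 \<le> s b2" "s b2 \<le> 7" "s (b1 * b2) + s (3 * b2) \<le> 5"
        using sum k k1 k3 q x1 unfolding t_def by (auto simp: mult.commute)
      moreover have "s (b1 * b2) = s ((1 + 2 ^ m) * b2)" unfolding m(2) ..
      moreover have "s b2 = 6 \<or> s b2 = 7" using calculation by linarith
      moreover have "s (b2 * b3) = s (3 * b2)" unfolding b(2) by (simp only: mult.commute)
      ultimately show False using cm [OF b(1)] q by linarith
    next
      \<comment> \<open>Both squares have three ones, both products at least two, and the middle sum
        two: 12 in all.\<close>
      case b: 4
      have "((b1 mod 4) * (b3 mod 4)) mod 4 = 1" using m4 b m 1 by simp
      then have "x \<ge> 2" using x2 by (simp only: mod_simps)
      then show False using sum k k1 k3 q b unfolding t_def by linarith
    qed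
  next
    case 2
    have q3: "s (b3 * b2) \<le> 3" using sum k x1 p q 2 unfolding t_def by (auto simp: mult.commute)
    have base: "5 + s (b3 * b2) + s (b3\<^sup>2) \<le> 2 + s b2 + s b3" "s (b3 * b2) + s (b3\<^sup>2) \<le> 6" "2 + s b2 + s b3 \<le> 11"
      using sum k k1 x1 p q unfolding t_def by (simp_all add: mult.commute)
    from 2 consider "b3 = 7" | "b3 = 13" | "b3 = 15" | "b3 = 23" | "b3 = 47" | "b3 = 111" by auto
    then show False
    proof cases
      case 1
      have "s (7 * b2) \<ge> 3" using sparse_multiple_7_23 [OF o(2) s9(2)] by simp
      then have "s (b1\<^sup>2) = 2" "s (b1 * b2) = 2"
        using sum k x1 p q 1 base unfolding t_def by (simp_all add: mult.commute)
      then have "s (3 * b2) = 2" using pm by auto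
      then show False using base 1 sparse_multiple_7 [OF o(2) s9(2)] q3 by auto
    next
      case 2 then show False using base sparse_multiple_13 [OF o(2) s9(2)] q3 by auto
    next
      case 3 then show False using base sparse_multiple_15 [OF o(2) s9(2)] q3 by auto
    next
      case 4 then show False using base sparse_multiple_23 [OF o(2) s9(2)] q3 by auto
    next
      case 5 then show False using base sparse_multiple_47 [OF o(2) s9(2)] q3 by auto
    next
      case 6 then show False using base sparse_multiple_111 [OF o(2) s9(2)] q3 by auto
    qed
  qed
qed

lemma three_cluster_bound:
  assumes o: "odd b1" "odd b2" "odd b3" and k: "s b1 + s b2 + s b3 \<le> 11"
  shows "s b1 + s b2 + s b3 < s (b1\<^sup>2) + s (b1 * b2) + s (2 ^ u * (b1 * b3) + 2 ^ v * b2\<^sup>2)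
    + s (b2 * b3) + s (b3\<^sup>2)"
  using three_cluster_bound_wlog [OF o k, of u v] three_cluster_bound_wlog [OF o(3,2,1), of u v] k
  by (cases "s (b1\<^sup>2) + s (b1 * b2) \<le> s (b2 * b3) + s (b3\<^sup>2)") (simp_all add: ac_simps)

text \<open>Here \<open>c\<close> stands for an odd square met by two cross terms that are powers of
  two. If \<open>x = y\<close>, alignment needs \<open>1 + c\<close> to be 0 modulo 4. Otherwise it
  needs \<open>1 + 2 ^ d + c\<close> to be 0 modulo 8, so \<open>2 ^ d\<close> would be 6 modulo
  8.\<close>

lemma three_powers_ne_one:
  assumes c: "c mod 8 = 1" "c \<noteq> 1"
  shows "s (2 ^ x + 2 ^ y + 2 ^ z * c) \<noteq> 1"
proof -
  have oc: "odd c" using c(1) by presburger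
  have main: False if "x \<le> y" and one: "s (2 ^ x + 2 ^ y + 2 ^ z * c) = 1" for x y z :: nat
  proof (cases "x = y")
    case True
    then have "2 ^ x + 2 ^ y + 2 ^ z * c = 2 ^ Suc x * 1 + 2 ^ z * c" by simp
    with one have one: "s (2 ^ Suc x * 1 + 2 ^ z * c) = 1" by (simp only:)
    have "2 < 1 + c" using c(2) odd_pos [OF oc] by linarith
    with aligned_mod_4 [OF odd_one oc one] have "(c + 1) mod 4 = 0" by (simp only: add.commute)
    then show False using c(1) by presburger
  next
    case False
    define d where "d = y - x"
    have d: "y = x + d" "d > 0" using that False by (auto simp: d_def)
    have "2 ^ x + 2 ^ y + 2 ^ z * c = 2 ^ x * (1 + 2 ^ d) + 2 ^ z * c"
      unfolding d(1) by (simp add: power_add algebra_simps)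
    with one have one: "s (2 ^ x * (1 + 2 ^ d) + 2 ^ z * c) = 1" by (simp only:)
    have od: "odd (1 + 2 ^ d :: nat)" using d by simp
    have "(2::nat) \<le> 2 ^ d" using power_increasing [of 1 d "2::nat"] d by simp
    then have big: "4 < 1 + 2 ^ d + c" using c(2) odd_pos [OF oc] by linarith
    have m: "(1 + 2 ^ d + c) mod 8 = 0" by (rule aligned_mod_8 [OF od oc one big])
    have low: "(2::nat) ^ d mod 8 \<in> {0, 2, 4}"
    proof (cases "(4::nat) < 2 ^ d")
      case True
      then show ?thesis using pow_mod_8 by simp
    next
      case False
      moreover have "even ((2::nat) ^ d)" using d(2) by simp
      moreover have "(2::nat) ^ d > 0" by simp
      moreover have "n = 2 \<or> n = 4" if "\<not> 4 < n" "even n" "n > 0" for n :: nat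
        using that by presburger
      ultimately have "(2::nat) ^ d = 2 \<or> (2::nat) ^ d = 4" by blast
      then show ?thesis by auto
    qed
    have "n mod 8 \<notin> {0, 2, 4}" if "(1 + n + c) mod 8 = 0" for n :: nat
      using that c(1) by simp presburger
    from this [OF m] low show False by (rule notE)
  qed
  show ?thesis using main [of x y z] main [of y x z] by (cases "x \<le> y") (auto simp: add.commute)
qed

lemma s_pow_minus_1: "n + 1 = 2 ^ w \<Longrightarrow> n = 2 ^ s n - 1"
proof -
  assume "n + 1 = 2 ^ w"
  then have "n = 2 ^ w - 1" by simp
  then show ?thesis by (metis s_pred_pow)
qed

text \<open>The outer clusters are 1, and \<open>x1\<close> to \<open>x5\<close> are the middle
  groups. If four of them, \<open>x3\<close> aside, are single ones, the positions align exactly and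
  \<open>b3\<close> is forced to be \<open>2 ^ j - 1\<close>; the middle group is then too heavy.
  Every other group adds at least one more.\<close>

lemma five_cluster_bound:
  assumes o: "odd b2" "odd b3" "odd b4" and k: "s b2 + s b3 + s b4 \<le> 9"
    and x1_def: "x1 = s (2 ^ (e1 + e3 + 1) * b3 + 2 ^ (2 * e2) * b2\<^sup>2)"
    and x2_def: "x2 = s (2 ^ (e1 + e4) * b4 + 2 ^ (e2 + e3) * (b2 * b3))"
    and x3_def: "x3 = s (2 ^ (e1 + e5 + 1) + 2 ^ (e2 + e4 + 1) * (b2 * b4) + 2 ^ (2 * e3) * b3\<^sup>2)"
    and x4_def: "x4 = s (2 ^ (e2 + e5) * b2 + 2 ^ (e3 + e4) * (b3 * b4))"
    and x5_def: "x5 = s (2 ^ (e3 + e5 + 1) * b3 + 2 ^ (2 * e4) * b4\<^sup>2)"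
  shows "s b3 < x1 + x2 + x3 + x4 + x5"
proof (rule ccontr)
  assume neg: "\<not> ?thesis"
  have oo: "odd (b2\<^sup>2)" "odd (b2 * b3)" "odd (b3 * b4)" "odd (b4\<^sup>2)" "odd (b3\<^sup>2)" using o by simp_all
  have pos: "x1 \<ge> 1" "x2 \<ge> 1" "x4 \<ge> 1" "x5 \<ge> 1"
    unfolding x1_def x2_def x4_def x5_def by (intro s_shifted_sum_pos o oo)+
  have pos3: "x3 \<ge> 1" unfolding x3_def by (intro s_pos) simp
  have kk: "s b2 \<ge> 1" "s b4 \<ge> 1" using s_pos odd_pos o by blast+
  have sum: "x1 + x2 + x3 + x4 + x5 \<le> s b3" "s b3 \<le> 7" using neg k kk by linarith+
  define A1 A2 A4 A5 where A: "A1 \<longleftrightarrow> e1 + e3 + 1 = 2 * e2" "A2 \<longleftrightarrow> e1 + e4 = e2 + e3"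
    "A4 \<longleftrightarrow> e2 + e5 = e3 + e4" "A5 \<longleftrightarrow> e3 + e5 + 1 = 2 * e4"
  have P1: "A1 \<and> (\<exists>w. b3 + b2\<^sup>2 = 2 ^ w)" if "x1 = 1"
    using power_sum_aligned [OF o(2) oo(1)] that unfolding x1_def A by metis
  have P2: "A2 \<and> (\<exists>w. b4 + b2 * b3 = 2 ^ w)" if "x2 = 1"
    using power_sum_aligned [OF o(3) oo(2)] that unfolding x2_def A by metis
  have P4: "A4 \<and> (\<exists>w. b2 + b3 * b4 = 2 ^ w)" if "x4 = 1"
    using power_sum_aligned [OF o(1) oo(3)] that unfolding x4_def A by metis
  have P5: "A5 \<and> (\<exists>w. b3 + b4\<^sup>2 = 2 ^ w)" if "x5 = 1"
    using power_sum_aligned [OF o(2) oo(4)] that unfolding x5_def A by metis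
  define c where "c = b3\<^sup>2 + 2 + 4 * (b2 * b4)"
  \<comment> \<open>Any three of the four alignments imply \<open>e1 + e5 = 2 * e3\<close> and
    \<open>e2 + e4 = 2 * e3 + 1\<close>, so the middle terms share one power of two.\<close>
  have three: "x3 = s c" if "A1 \<and> A2 \<and> A4 \<or> A1 \<and> A2 \<and> A5 \<or> A1 \<and> A4 \<and> A5 \<or> A2 \<and> A4 \<and> A5"
  proof -
    have "e1 + e5 = 2 * e3" "e2 + e4 = 2 * e3 + 1" using that unfolding A by linarith+
    then have "2 ^ (e1 + e5 + 1) + 2 ^ (e2 + e4 + 1) * (b2 * b4) + 2 ^ (2 * e3) * b3\<^sup>2 = 2 ^ (2 * e3) * c"
      unfolding c_def by (simp add: algebra_simps)
    then show ?thesis unfolding x3_def by simp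
  qed
  have c2: "s c \<ge> 2"
  proof (rule odd_s_ge_2)
    show "odd c" unfolding c_def using oo by simp
    show "c \<noteq> 1" unfolding c_def by simp
  qed
  have b3_pow: "b3 = 2 ^ s b3 - 1" if "b3 + 1 = 2 ^ w" for w using s_pow_minus_1 [OF that] .
  have Q: "x1 = 1 \<Longrightarrow> A1" "x2 = 1 \<Longrightarrow> A2" "x4 = 1 \<Longrightarrow> A4" "x5 = 1 \<Longrightarrow> A5"
    using P1 P2 P4 P5 by blast+
  have "x1 = 1 \<or> x1 \<ge> 2" "x2 = 1 \<or> x2 \<ge> 2" "x4 = 1 \<or> x4 \<ge> 2" "x5 = 1 \<or> x5 \<ge> 2"
    using pos by linarith+
  \<comment> \<open>The cases count how many of \<open>x1\<close>, \<open>x2\<close>,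
    \<open>x4\<close>, \<open>x5\<close> equal 1. Three of the four always include \<open>x1\<close>
    or \<open>x5\<close>.\<close>
  then consider (all) "x1 = 1" "x2 = 1" "x4 = 1" "x5 = 1"
    | (three) "A1 \<and> A2 \<and> A4 \<or> A1 \<and> A2 \<and> A5 \<or> A1 \<and> A4 \<and> A5 \<or> A2 \<and> A4 \<and> A5" "x1 + x2 + x4 + x5 \<ge> 5"
        "x1 = 1 \<or> x5 = 1"
    | (two) "x1 + x2 + x4 + x5 \<ge> 6" "x1 = 1 \<or> x2 = 1 \<or> x4 = 1 \<or> x5 = 1"
    | (none) "x1 + x2 + x4 + x5 \<ge> 8"
    using Q by (elim disjE) simp_all
  then show False
  proof cases
    case all
    then have x3: "x3 = s c" using three P1 P2 P4 by blast
    have k3: "s b3 \<ge> 6" "s b2 + s b4 \<le> 3" using sum all x3 c2 k by linarith+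
    obtain w2 w4 where w: "b4 + b2 * b3 = 2 ^ w2" "b2 + b3 * b4 = 2 ^ w4" using all P2 P4 by blast
    obtain w1 w5 where w': "b3 + b2\<^sup>2 = 2 ^ w1" "b3 + b4\<^sup>2 = 2 ^ w5" using all P1 P5 by blast
    \<comment> \<open>If one neighbour is 1 and the other has two ones, then \<open>b3 = 63\<close>
      and the other neighbour must be 65; but 63 + 4225 = 4288 is no power of two.\<close>
    have one_other: False if "b3 + 1 = 2 ^ w" "s b3 = 6" "b + b3 = 2 ^ v" "b3 + b\<^sup>2 = 2 ^ v'" "odd b" "s b = 2"
      for b w v v'
    proof -
      note h = that
      have b3: "b3 = 63" using b3_pow [OF h(1)] h(2) by simp
      obtain d where d: "b = 1 + 2 ^ d" "d \<ge> 1" using h(5,6) by (rule odd_s_2)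
      have "2 ^ 6 * 1 + 2 ^ d * 1 = (2::nat) ^ v" using h(3) unfolding b3 d by simp
      then have "s (2 ^ 6 * 1 + 2 ^ d * 1) = 1" by (simp only: s_pow)
      then have "6 = d" by (rule power_sum_aligned [OF odd_one odd_one])
      then have "2 ^ v' = (4288::nat)" using h(4) unfolding b3 d(1) by simp
      then have "s ((2::nat) ^ v') = s 4288" by (simp only:)
      then show False by simp
    qed
    consider "s b2 = 1" "s b4 = 1" | "s b2 = 1" "s b4 = 2" "s b3 = 6" | "s b2 = 2" "s b4 = 1" "s b3 = 6"
      using k3 kk k by linarith
    then show False
    proof cases
      case 1
      then have b: "b2 = 1" "b4 = 1" using odd_s_eq_1 o by blast+
      then have "b3 = 2 ^ s b3 - 1" using b3_pow w' by simp
      moreover have "s b3 = 6 \<or> s b3 = 7" using k3 sum by linarith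
      ultimately have "b3 = 63 \<or> b3 = 127" by auto
      then have "s c \<ge> 8" unfolding c_def b by auto
      then show False using x3 sum pos by linarith
    next
      case 2
      then have b: "b2 = 1" using odd_s_eq_1 o by blast
      show False using one_other [of w1 b4 w2 w5] w w' b 2 o by simp
    next
      case 3
      then have b: "b4 = 1" using odd_s_eq_1 o by blast
      show False using one_other [of w5 b2 w4 w1] w w' b 3 o by simp
    qed
  next
    case three': three
    then have x3: "x3 = s c" by (intro three)
    then have "s b3 = 7" using sum c2 three'(2) by linarith
    then have "s b2 = 1" "s b4 = 1" using k kk by linarith+
    then have b: "b2 = 1" "b4 = 1" using odd_s_eq_1 o by blast+
    have "\<exists>w. b3 + 1 = 2 ^ w" using three'(3) P1 P5 b by auto
    then have "b3 = 127" using b3_pow \<open>s b3 = 7\<close> by auto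
    then have "s c = 9" unfolding c_def b by simp
    then show False using x3 sum by linarith
  next
    case two
    then have "x3 = 1" "s b3 = 7" using sum pos3 by linarith+
    then have "s b2 = 1" "s b4 = 1" using k kk by linarith+
    then have b: "b2 = 1" "b4 = 1" using odd_s_eq_1 o by blast+
    have "\<exists>w. b3 + 1 = 2 ^ w" using two(2) P1 P2 P4 P5 b by (auto simp: add.commute)
    then have "b3 = 127" using b3_pow \<open>s b3 = 7\<close> by auto
    then have "x3 = s (2 ^ (e1 + e5 + 1) + 2 ^ (e2 + e4 + 1) + 2 ^ (2 * e3) * 16129)"
      unfolding x3_def b by simp
    moreover have "s (2 ^ (e1 + e5 + 1) + 2 ^ (e2 + e4 + 1) + 2 ^ (2 * e3) * 16129) \<noteq> 1"
      by (rule three_powers_ne_one) simp_all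
    ultimately show False using \<open>x3 = 1\<close> by (simp only:)
  next
    case none
    then show False using sum pos3 by linarith
  qed
qed

text \<open>Serves the tight case with outer clusters 1 and 3. The first condition makes
  \<open>b3\<close> one less than a power of two, and \<open>b4\<close> comes from the table for 3.
  Then \<open>b4 + b3\<close> is a power of two only for 1 and 63, and there 190 is not.\<close>

lemma five_cluster_end:
  assumes o: "odd b3" "odd b4" and k: "s b3 + s b4 = 7" and b4: "s (3 * b4) = 2"
    and one: "s (2 ^ u1 * b3 + 2 ^ v1 * 1\<^sup>2) = 1" "s (2 ^ u2 * b4 + 2 ^ v2 * b3) = 1"
      "s (2 ^ u3 * (b3 * 3) + 2 ^ v3 * b4\<^sup>2) = 1"
  shows False
proof -
  obtain w1 where w1: "b3 + 1\<^sup>2 = 2 ^ w1" using power_sum_aligned [OF o(1) _ one(1)] by auto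
  obtain w2 where w2: "b4 + b3 = 2 ^ w2" using power_sum_aligned [OF o(2,1) one(2)] by auto
  obtain w3 where w3: "b3 * 3 + b4\<^sup>2 = 2 ^ w3" using power_sum_aligned [OF _ _ one(3)] o by auto
  have kk: "s b3 \<ge> 1" "s b4 \<ge> 1" using s_pos odd_pos o by blast+
  have "s b4 \<le> 9" "s b4 \<le> 6" using k kk by linarith+
  then have "b4 \<in> {1, 3, 11, 43, 171, 683}" using sparse_multiple_3 [OF o(2)] b4 by auto
  moreover have b3: "b3 = 2 ^ (7 - s b4) - 1"
    using s_pow_minus_1 [of b3 w1] w1 k by (metis add_diff_cancel_right' one_power2)
  ultimately have "b4 = 1 \<and> b3 = 63 \<or> b4 + b3 \<in> {34, 26, 50, 174, 684}" by auto
  moreover have "s (b4 + b3) = 1" "s (b3 * 3 + b4\<^sup>2) = 1" unfolding w2 w3 by simp_all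
  ultimately show False by auto
qed

text \<open>Both numbers are one less than a power of two, and their sum is again a power of two
  only if one of them is 1.\<close>

lemma six_cluster_middle:
  assumes o: "odd b3" "odd b4" and k: "s b3 + s b4 = 7"
    and one: "s (2 ^ u1 * b3 + 2 ^ v1) = 1" "s (2 ^ u2 * b4 + 2 ^ v2 * b3) = 1" "s (2 ^ u3 * b4 + 2 ^ v3) = 1"
  shows "b3 = 1 \<and> b4 = 63 \<or> b3 = 63 \<and> b4 = 1"
proof -
  have "s (2 ^ u1 * b3 + 2 ^ v1 * 1) = 1" "s (2 ^ u3 * b4 + 2 ^ v3 * 1) = 1" using one by simp_all
  then obtain w1 w3 where w: "b3 + 1 = 2 ^ w1" "b4 + 1 = 2 ^ w3" 
    using power_sum_aligned [OF o(1) odd_one] power_sum_aligned [OF o(2) odd_one] by metis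
  obtain w2 where w2: "b4 + b3 = 2 ^ w2" using power_sum_aligned [OF o(2,1) one(2)] by auto
  have kk: "s b3 \<ge> 1" "s b4 \<ge> 1" using s_pos odd_pos o by blast+
  have b: "b3 = 2 ^ s b3 - 1" "b4 = 2 ^ s b4 - 1" using w s_pow_minus_1 by blast+
  have "s (b4 + b3) = 1" unfolding w2 by simp
  moreover have "s b3 \<in> {1, 2, 3, 4, 5, 6}" using k kk by auto
  moreover have "s b4 = 7 - s b3" using k by simp
  ultimately show ?thesis using b by auto
qed

section \<open>Digit sums of separated sums\<close>

text \<open>At most \<open>2 ^ l\<close> terms below \<open>2 ^ m\<close> can overflow by
  \<open>l\<close> digits, so the part over \<open>X\<close> stays below the lowest position of
  \<open>Y\<close>.\<close>

lemma s_sum_cut: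
  fixes p b :: "'i \<Rightarrow> nat"
  assumes fin: "finite X" "finite Y" and card: "card X \<le> 2 ^ l"
    and b: "\<And>i. i \<in> X \<Longrightarrow> b i < 2 ^ m"
    and sep: "\<And>i j. i \<in> X \<Longrightarrow> j \<in> Y \<Longrightarrow> p i + (m + l) \<le> p j" and disj: "X \<inter> Y = {}"
  shows "s (\<Sum>i\<in>X \<union> Y. b i * 2 ^ p i) = s (\<Sum>i\<in>X. b i * 2 ^ p i) + s (\<Sum>i\<in>Y. b i * 2 ^ p i)"
proof (cases "X = {} \<or> Y = {}")
  case False
  define x where "x = Min (p ` Y)"
  have xY: "x \<le> p j" if "j \<in> Y" for j using that fin by (simp add: x_def)
  have "x \<in> p ` Y" unfolding x_def using False fin by (intro Min_in) auto
  then have xX: "p i + (m + l) \<le> x" if "i \<in> X" for i using sep that by auto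
  have "(\<Sum>i\<in>X. b i * 2 ^ p i) < (\<Sum>i\<in>X. 2 ^ (x - l))"
  proof (rule sum_strict_mono)
    fix i assume i: "i \<in> X"
    have "b i * 2 ^ p i < 2 ^ m * 2 ^ p i" using b [OF i] by simp
    also have "\<dots> = 2 ^ (m + p i)" by (simp add: power_add)
    also have "\<dots> \<le> 2 ^ (x - l)" using xX [OF i] by (intro power_increasing) auto
    finally show "b i * 2 ^ p i < 2 ^ (x - l)" .
  qed (use fin False in auto)
  also have "\<dots> = card X * 2 ^ (x - l)" by simp
  also have "\<dots> \<le> 2 ^ l * 2 ^ (x - l)" using card by (intro mult_right_mono) auto
  also have "\<dots> = 2 ^ x"
  proof -
    have "l \<le> x" using xX False by fastforce
    then show ?thesis by (simp flip: power_add)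
  qed
  finally have less: "(\<Sum>i\<in>X. b i * 2 ^ p i) < 2 ^ x" .
  have "(\<Sum>i\<in>Y. b i * 2 ^ p i) = (\<Sum>i\<in>Y. 2 ^ x * (b i * 2 ^ (p i - x)))"
    using xY by (intro sum.cong) (simp_all add: ac_simps flip: power_add)
  also have "\<dots> = 2 ^ x * (\<Sum>i\<in>Y. b i * 2 ^ (p i - x))" by (simp add: sum_distrib_left)
  finally have Y: "(\<Sum>i\<in>Y. b i * 2 ^ p i) = 2 ^ x * (\<Sum>i\<in>Y. b i * 2 ^ (p i - x))" .
  show ?thesis unfolding sum.union_disjoint [OF fin disj] Y using s_split [OF less] by simp
qed auto

lemma s_sum_pos:
  assumes "finite X" "i \<in> X" "b i > 0"
  shows "s (\<Sum>i\<in>X. b i * 2 ^ p i) \<ge> 1"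
proof (rule s_pos)
  have "b i * 2 ^ p i \<le> (\<Sum>i\<in>X. b i * 2 ^ p i)" using assms by (intro member_le_sum) auto
  moreover have "b i * 2 ^ p i > 0" using assms by simp
  ultimately show "0 < (\<Sum>i\<in>X. b i * 2 ^ p i)" by linarith
qed

lemma s_sum_groups:
  fixes p b :: "'i \<Rightarrow> nat"
  assumes "sorted_wrt (\<lambda>X Y. \<forall>i\<in>X. \<forall>j\<in>Y. p i + (m + l) \<le> p j) Xs"
    and "\<And>X. X \<in> set Xs \<Longrightarrow> finite X \<and> card X \<le> 2 ^ l \<and> (\<forall>i\<in>X. b i < 2 ^ m)" and "m + l > 0"
  shows "s (\<Sum>i\<in>\<Union>(set Xs). b i * 2 ^ p i) = (\<Sum>X\<leftarrow>Xs. s (\<Sum>i\<in>X. b i * 2 ^ p i))"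
  using assms
proof (induction Xs)
  case (Cons X Xs)
  have sep: "p i + (m + l) \<le> p j" if "i \<in> X" "j \<in> \<Union>(set Xs)" for i j
    using Cons.prems(1) that by auto
  have disj: "X \<inter> \<Union>(set Xs) = {}"
  proof (rule ccontr)
    assume "X \<inter> \<Union>(set Xs) \<noteq> {}"
    then obtain i where "i \<in> X" "i \<in> \<Union>(set Xs)" by blast
    from sep [OF this] show False using Cons.prems(3) by simp
  qed
  have "s (\<Sum>i\<in>X \<union> \<Union>(set Xs). b i * 2 ^ p i) = s (\<Sum>i\<in>X. b i * 2 ^ p i) + s (\<Sum>i\<in>\<Union>(set Xs). b i * 2 ^ p i)"
    by (rule s_sum_cut [OF _ _ _ _ sep disj]) (use Cons.prems(2) in auto)
  moreover have "s (\<Sum>i\<in>\<Union>(set Xs). b i * 2 ^ p i) = (\<Sum>X\<leftarrow>Xs. s (\<Sum>i\<in>X. b i * 2 ^ p i))"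
    by (rule Cons.IH) (use Cons.prems in auto)
  ultimately show ?case by simp
qed simp

definition isolated :: "('i \<Rightarrow> nat) \<Rightarrow> nat \<Rightarrow> 'i set \<Rightarrow> 'i \<Rightarrow> bool" where
  "isolated p d X i \<longleftrightarrow> (\<forall>j\<in>X. j \<noteq> i \<longrightarrow> p j + d \<le> p i \<or> p i + d \<le> p j)"

lemma isolated_subset: "isolated p d X i \<Longrightarrow> Y \<subseteq> X \<Longrightarrow> isolated p d Y i"
  by (auto simp: isolated_def)

text \<open>Two cuts, one below and one above the position of \<open>i\<close>, leave its term
  alone.\<close>

lemma s_sum_isolated:
  fixes p b :: "'i \<Rightarrow> nat"
  assumes X: "finite X" "card X \<le> 2 ^ l" "i \<in> X" and b: "\<And>i. i \<in> X \<Longrightarrow> b i < 2 ^ m"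
    and iso: "isolated p d X i" and d: "m + l \<le> d" "d > 0"
  shows "s (b i) \<le> s (\<Sum>i\<in>X. b i * 2 ^ p i)"
proof -
  define L where "L = {j \<in> X. p j + d \<le> p i}"
  define U where "U = {j \<in> X. p i + d \<le> p j}"
  have X_eq: "X = L \<union> ({i} \<union> U)" using iso X(3) unfolding L_def U_def isolated_def by blast
  have fin: "finite L" "finite U" "L \<subseteq> X" using X(1) by (auto simp: L_def U_def)
  have "card L \<le> 2 ^ l" using card_mono [OF X(1) fin(3)] X(2) by linarith
  then have "s (\<Sum>i\<in>L \<union> ({i} \<union> U). b i * 2 ^ p i)
      = s (\<Sum>i\<in>L. b i * 2 ^ p i) + s (\<Sum>i\<in>{i} \<union> U. b i * 2 ^ p i)"
    using fin b d by (intro s_sum_cut [where m = m and l = l]) (auto simp: L_def U_def)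
  moreover have "s (\<Sum>i\<in>{i} \<union> U. b i * 2 ^ p i)
      = s (\<Sum>i\<in>{i}. b i * 2 ^ p i) + s (\<Sum>i\<in>U. b i * 2 ^ p i)"
    using fin b d X(3) by (intro s_sum_cut [where m = m and l = l]) (auto simp: U_def)
  ultimately show ?thesis using X_eq by simp
qed

text \<open>Pigeonhole: there are \<open>N + 1\<close> disjoint open windows and at most
  \<open>N\<close> positions.\<close>

lemma free_window:
  fixes p :: "'i \<Rightarrow> nat"
  assumes X: "finite X" "card X \<le> N" and w: "w > 0"
  shows "\<exists>t\<le>N. \<forall>j\<in>X. p j \<le> a + t * w \<or> a + (t + 1) * w \<le> p j"
proof (rule ccontr)
  assume "\<not> ?thesis"
  then have "\<forall>t\<in>{..N}. \<exists>j\<in>X. a + t * w < p j \<and> p j < a + (t + 1) * w"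
    by (meson atMost_iff not_le)
  then obtain f where f: "\<And>t. t \<le> N \<Longrightarrow> f t \<in> X \<and> a + t * w < p (f t) \<and> p (f t) < a + (t + 1) * w"
    by (metis atMost_iff)
  have lt: "p (f t) < p (f u)" if "t < u" "u \<le> N" for t u
  proof -
    have "(t + 1) * w \<le> u * w" using that by (intro mult_right_mono) auto
    then show ?thesis using f [of t] f [of u] that by linarith
  qed
  have "inj_on f {..N}"
    by (rule linorder_inj_onI) (use lt in fastforce)+
  then have "card {..N} \<le> card X" using f X(1) by (intro card_inj_on_le [of f]) auto
  then show False using X(2) by simp
qed

text \<open>
  Positions more than \<open>N\<close> windows apart are separated by a window without any term, and no carry crosses it. The
  flag marks the members of the chain whose own digit sum may be counted.
\<close>

lemma s_sum_chain:
  fixes p b :: "'i \<Rightarrow> nat"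
  assumes d: "d = (N + 1) * (m + l)" "N \<le> 2 ^ l" "m + l > 0"
  shows "finite X \<Longrightarrow> card X \<le> N \<Longrightarrow> (\<And>i. i \<in> X \<Longrightarrow> 0 < b i \<and> b i < 2 ^ m) \<Longrightarrow>
    fst ` set xs \<subseteq> X \<Longrightarrow> sorted_wrt (\<lambda>x y. p (fst x) + d \<le> p (fst y)) xs \<Longrightarrow>
    (\<And>i. (i, True) \<in> set xs \<Longrightarrow> isolated p d X i) \<Longrightarrow>
    (\<Sum>(i, t)\<leftarrow>xs. if t then s (b i) else 1) \<le> s (\<Sum>i\<in>X. b i * 2 ^ p i)"
proof (induction xs arbitrary: X)
  case (Cons x xs)
  obtain i t where x: "x = (i, t)" by fastforce
  have dw: "m + l \<le> d" "d > 0" using d by (simp_all add: d(1))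
  have single: "(if t then s (b i) else 1) \<le> s (\<Sum>i\<in>Y. b i * 2 ^ p i)" if Y: "Y \<subseteq> X" "i \<in> Y" for Y
  proof (cases t)
    case True
    have "finite Y" "card Y \<le> 2 ^ l"
      using Cons.prems(1,2) Y card_mono [of X Y] d(2) finite_subset by auto
    moreover have "isolated p d Y i" using Cons.prems(6) [of i] True x isolated_subset Y by fastforce
    ultimately show ?thesis using s_sum_isolated [of Y l i b m p d] Cons.prems(3) Y dw True by auto
  next
    case False
    have "finite Y" using Cons.prems(1) Y finite_subset by blast
    then show ?thesis using s_sum_pos [of Y i b p] Cons.prems(3) Y False by auto
  qed
  show ?case
  proof (cases "xs = []")
    case True
    then show ?thesis using single [of X] Cons.prems(4) x by simp
  next
    case False
    \<comment> \<open>The empty window is sought just above the head of the chain. Since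
      \<open>d\<close> covers \<open>N + 1\<close> windows, all later members lie beyond it.\<close>
    obtain u where u: "u \<le> N" "\<forall>j\<in>X. p j \<le> p i + u * (m + l) \<or> p i + (u + 1) * (m + l) \<le> p j"
      using free_window [OF Cons.prems(1,2) d(3), of p "p i"] by blast
    define L where "L = {j \<in> X. p j \<le> p i + u * (m + l)}"
    define U where "U = {j \<in> X. p i + (u + 1) * (m + l) \<le> p j}"
    have X_eq: "X = L \<union> U" using u by (auto simp: L_def U_def)
    have fin: "finite L" "finite U" "L \<subseteq> X" "U \<subseteq> X" using Cons.prems(1) by (auto simp: L_def U_def)
    have cards: "card L \<le> N" "card U \<le> N"
      using card_mono [OF Cons.prems(1) fin(3)] card_mono [OF Cons.prems(1) fin(4)] Cons.prems(2) by linarith+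
    have "p j + (m + l) \<le> p k" if "j \<in> L" "k \<in> U" for j k
    proof -
      have "(u + 1) * (m + l) = u * (m + l) + (m + l)" by (simp add: algebra_simps)
      then show ?thesis using that unfolding L_def U_def by simp
    qed
    note sep = this
    have "L \<inter> U = {}"
    proof (rule ccontr)
      assume "L \<inter> U \<noteq> {}"
      then obtain j where "j \<in> L" "j \<in> U" by blast
      from sep [OF this] show False using d(3) by simp
    qed
    then have "s (\<Sum>i\<in>L \<union> U. b i * 2 ^ p i) = s (\<Sum>i\<in>L. b i * 2 ^ p i) + s (\<Sum>i\<in>U. b i * 2 ^ p i)"
      using fin cards d(2) Cons.prems(3) sep by (intro s_sum_cut [where m = m and l = l]) auto
    moreover have "i \<in> L" using Cons.prems(4) x by (simp add: L_def)
    then have "(if t then s (b i) else 1) \<le> s (\<Sum>i\<in>L. b i * 2 ^ p i)" by (intro single fin)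
    moreover have "(\<Sum>(i, t)\<leftarrow>xs. if t then s (b i) else 1) \<le> s (\<Sum>i\<in>U. b i * 2 ^ p i)"
    proof (rule Cons.IH)
      show "fst ` set xs \<subseteq> U"
      proof
        fix j assume "j \<in> fst ` set xs"
        then have "p i + d \<le> p j" "j \<in> X" using Cons.prems(4,5) x by auto
        moreover have "(u + 1) * (m + l) \<le> d" unfolding d(1) using u(1) by (intro mult_right_mono) auto
        ultimately show "j \<in> U" by (simp add: U_def)
      qed
      show "isolated p d U i" if "(i, True) \<in> set xs" for i
        using Cons.prems(6) [of i] that isolated_subset fin(4) by fastforce
    qed (use fin cards Cons.prems in auto)
    ultimately show ?thesis using X_eq x by simp
  qed
qed simp

section \<open>The square as a sum over unordered index pairs\<close>

definition pairs :: "nat \<Rightarrow> (nat \<times> nat) set" where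
  "pairs r = {(i, j). i \<le> j \<and> j < r}"

lemma pairs_0: "pairs 0 = {}"
  by (auto simp: pairs_def)

lemma pairs_Suc: "pairs (Suc r) = pairs r \<union> (\<lambda>i. (i, r)) ` {..r}"
  by (auto simp: pairs_def)

lemma pairs_disjoint: "pairs r \<inter> (\<lambda>i. (i, r)) ` {..r} = {}"
  by (auto simp: pairs_def)

lemma finite_pairs [simp]: "finite (pairs r)"
  by (induction r) (simp_all add: pairs_0 pairs_Suc)

lemma card_pairs: "2 * card (pairs r) = r * (r + 1)"
proof (induction r)
  case (Suc r)
  have "card (pairs (Suc r)) = card (pairs r) + card ((\<lambda>i. (i, r)) ` {..r})"
    unfolding pairs_Suc by (rule card_Un_disjoint) (simp_all add: pairs_disjoint)
  also have "card ((\<lambda>i. (i, r)) ` {..r}) = r + 1" by (subst card_image) (auto simp: inj_on_def)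
  finally show ?case using Suc.IH by simp
qed (simp add: pairs_0)

lemma square_sum_pairs:
  fixes B e :: "nat \<Rightarrow> nat"
  shows "(\<Sum>i<r. B i * 2 ^ e i)\<^sup>2
    = (\<Sum>(i, j)\<in>pairs r. (if i = j then (B i)\<^sup>2 else 2 * (B i * B j)) * 2 ^ (e i + e j))"
    (is "_ = sum ?f _")
proof (induction r)
  case (Suc r)
  let ?n = "\<Sum>i<r. B i * 2 ^ e i"
  have "sum ?f (pairs (Suc r)) = sum ?f (pairs r) + sum ?f ((\<lambda>i. (i, r)) ` {..r})"
    unfolding pairs_Suc by (rule sum.union_disjoint) (simp_all add: pairs_disjoint)
  also have "sum ?f ((\<lambda>i. (i, r)) ` {..r}) = (\<Sum>i\<le>r. ?f (i, r))"
    by (subst sum.reindex) (auto simp: inj_on_def)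
  also have "\<dots> = (\<Sum>i<r. ?f (i, r)) + ?f (r, r)"
    by (simp add: lessThan_Suc_atMost [symmetric])
  also have "(\<Sum>i<r. ?f (i, r)) = (\<Sum>i<r. 2 * (B r * 2 ^ e r) * (B i * 2 ^ e i))"
    by (rule sum.cong) (auto simp: power_add)
  also have "\<dots> = 2 * (B r * 2 ^ e r) * ?n" by (simp add: sum_distrib_left)
  finally show ?case using Suc.IH by (simp add: power2_eq_square algebra_simps power_add)
qed (simp add: pairs_0)

section \<open>Squares of separated clusters\<close>

declare One_nat_def [simp del]  \<comment> \<open>keeps the index in \<open>e 1\<close> and \<open>B 1\<close> in one normal form\<close>

lemma pairs_3: "pairs 3 = {(0,0), (0,1), (1,1), (0,2), (1,2), (2,2)}"
  and pairs_4: "pairs 4 = {(0,0), (0,1), (1,1), (0,2), (1,2), (2,2), (0,3), (1,3), (2,3), (3,3)}"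
  and pairs_5: "pairs 5 = {(0,0), (0,1), (1,1), (0,2), (1,2), (2,2), (0,3), (1,3), (2,3), (3,3),
    (0,4), (1,4), (2,4), (3,4), (4,4)}"
  and pairs_6: "pairs 6 = {(0,0), (0,1), (1,1), (0,2), (1,2), (2,2), (0,3), (1,3), (2,3), (3,3),
    (0,4), (1,4), (2,4), (3,4), (4,4), (0,5), (1,5), (2,5), (3,5), (4,5), (5,5)}"
  by (simp_all add: eval_nat_numeral pairs_Suc pairs_0 atMost_Suc insert_commute One_nat_def)

lemma lessThan_explicit:
  "{..<3} = {0, 1, 2 :: nat}" "{..<4} = {0, 1, 2, 3 :: nat}" "{..<5} = {0, 1, 2, 3, 4 :: nat}"
  "{..<6} = {0, 1, 2, 3, 4, 5 :: nat}"
  by auto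

text \<open>This is the case of six distinct positions. One of the three has at most 3 ones and is
  dominated by its own square; \<open>pair_bound\<close> covers the other two.\<close>

lemma separated_three_bound:
  assumes o: "odd a" "odd b" "odd c" and k: "s a + s b + s c \<le> 11"
  shows "s a + s b + s c < s (a\<^sup>2) + s (a * b) + s (a * c) + s (b\<^sup>2) + s (b * c) + s (c\<^sup>2)"
proof -
  have sq: "s x \<le> s (x\<^sup>2)" if "odd x" "s x \<le> 3" for x
  proof (rule ccontr)
    assume neg: "\<not> ?thesis"
    have "x \<noteq> 1" using neg by (intro notI) simp
    then have "s (x\<^sup>2) = 2" "s x = 3" using s_square_ge_2 [OF that(1)] neg that(2) by linarith+
    then have "x = 3" using s_square_2_iff [OF that(1)] by simp
    then show False using \<open>s x = 3\<close> by simp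
  qed
  have p: "s (a * b) \<ge> 1" "s (a * c) \<ge> 1" "s (b * c) \<ge> 1" using o by (auto intro!: s_pos intro: odd_pos)
  have pos: "s a \<ge> 1" "s b \<ge> 1" "s c \<ge> 1" using s_pos odd_pos o by blast+
  consider "s a \<le> 3" | "s b \<le> 3" | "s c \<le> 3" using k by linarith
  then show ?thesis
  proof cases
    case 1
    have "s b + s c \<le> 11" using k by linarith
    from pair_bound [OF o(2,3) this] sq [OF o(1) 1] p show ?thesis by linarith
  next
    case 2
    have "s a + s c \<le> 11" using k by linarith
    from pair_bound [OF o(1,3) this] sq [OF o(2) 2] p show ?thesis by linarith
  next
    case 3
    have "s a + s b \<le> 11" using k by linarith
    from pair_bound [OF o(1,2) this] sq [OF o(3) 3] p show ?thesis by linarith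
  qed
qed

text \<open>
  The constant in \<open>D\<close> comes from the at most 66 terms of the square, each below \<open>2 ^ (2 * M + 1)\<close>, whose sum can
  overflow by at most 7 digits; the factor 100 in \<open>gap\<close> leaves room for chains of approximate equalities of positions.
\<close>

locale separated_clusters =
  fixes r M :: nat and B e :: "nat \<Rightarrow> nat" and n D T K :: nat
  assumes r: "2 \<le> r" "r \<le> 11"
    and B: "\<And>i. i < r \<Longrightarrow> odd (B i)" "\<And>i. i < r \<Longrightarrow> B i < 2 ^ M"
    and D_eq: "D = 67 * (2 * M + 8)"
    and gap: "\<And>i. Suc i < r \<Longrightarrow> e i + 100 * D \<le> e (Suc i)"
    and n_eq: "n = (\<Sum>i<r. B i * 2 ^ e i)"
    and T_eq: "T = s (n\<^sup>2)"
    and K_eq: "K = (\<Sum>i<r. s (B i))" and K_le: "K \<le> 11"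
begin

definition pos :: "nat \<times> nat \<Rightarrow> nat" where
  "pos x = e (fst x) + e (snd x)"

definition wt :: "nat \<times> nat \<Rightarrow> nat" where
  "wt x = (if fst x = snd x then (B (fst x))\<^sup>2 else 2 * (B (fst x) * B (snd x)))"

abbreviation iso :: "nat \<times> nat \<Rightarrow> bool" where
  "iso x \<equiv> isolated pos D (pairs r) x"

lemma pos_simp [simp]: "pos (i, j) = e i + e j"
  by (simp add: pos_def)

lemma wt_simps [simp]: "wt (i, i) = (B i)\<^sup>2" "i \<noteq> j \<Longrightarrow> wt (i, j) = 2 * (B i * B j)"
  by (simp_all add: wt_def)

lemma T_sum: "T = s (\<Sum>x\<in>pairs r. wt x * 2 ^ pos x)"
  unfolding T_eq n_eq square_sum_pairs by (intro arg_cong [of _ _ s] sum.cong) (auto simp: wt_def pos_def)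

lemma D_pos: "D > 0"
  by (simp add: D_eq)

lemma e_less: "i < j \<Longrightarrow> j < r \<Longrightarrow> e i + 100 * D \<le> e j"
proof (induction j)
  case (Suc j)
  show ?case
  proof (cases "i = j")
    case False
    then have "e i + 100 * D \<le> e j" using Suc by simp
    then show ?thesis using gap [of j] Suc.prems by linarith
  qed (use gap Suc.prems in simp)
qed simp

lemma e_le: "i \<le> j \<Longrightarrow> j < r \<Longrightarrow> e i \<le> e j"
  using e_less [of i j] by (cases "i = j") auto

lemma wt_bounds: "x \<in> pairs r \<Longrightarrow> 0 < wt x \<and> wt x < 2 ^ (2 * M + 1)"
proof -
  assume "x \<in> pairs r"
  then obtain i j where x: "x = (i, j)" "i < r" "j < r" by (auto simp: pairs_def)
  have "B i * B j < 2 ^ M * 2 ^ M" using B(2) x by (intro mult_strict_mono) auto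
  moreover have "B i > 0" "B j > 0" using B(1) x odd_pos by blast+
  moreover have "(2::nat) ^ (2 * M + 1) = 2 * (2 ^ M * 2 ^ M)" by (simp add: mult_2 power_add)
  moreover have "wt x = B i * B j \<or> wt x = 2 * (B i * B j)"
    unfolding x(1) wt_def by (simp add: power2_eq_square)
  moreover have "0 < B i * B j" using \<open>B i > 0\<close> \<open>B j > 0\<close> by simp
  ultimately show ?thesis by linarith
qed

lemma card_le: "card (pairs r) \<le> 66"
proof -
  have "r * (r + 1) \<le> 11 * 12" using r by (intro mult_le_mono) auto
  then show ?thesis using card_pairs [of r] by simp
qed

lemma chain_sorted:
  assumes "fst ` set xs \<subseteq> pairs r" "sorted_wrt (\<lambda>x y. pos (fst x) + D \<le> pos (fst y)) xs"
    and "\<forall>y\<in>set xs. snd y \<longrightarrow> iso (fst y)"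
  shows "(\<Sum>(x, t)\<leftarrow>xs. if t then s (wt x) else 1) \<le> T"
  unfolding T_sum
proof (rule s_sum_chain [where N = 66 and m = "2 * M + 1" and l = 7])
  show "D = (66 + 1) * (2 * M + 1 + 7)" by (simp add: D_eq)
qed (use assms card_le wt_bounds in \<open>auto simp del: pos_simp\<close>)

lemma chain:
  assumes "fst ` set xs \<subseteq> pairs r" "successively (\<lambda>x y. pos (fst x) + D \<le> pos (fst y)) xs"
    and "\<forall>y\<in>set xs. snd y \<longrightarrow> iso (fst y)"
  shows "(\<Sum>(x, t)\<leftarrow>xs. if t then s (wt x) else 1) \<le> T"
proof (rule chain_sorted [OF assms(1) _ assms(3)])
  have "transp (\<lambda>x y. pos (fst x) + D \<le> pos (fst y))" by (rule transpI) linarith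
  then show "sorted_wrt (\<lambda>x y. pos (fst x) + D \<le> pos (fst y)) xs"
    using assms(2) successively_conv_sorted_wrt by blast
qed

lemma groups_sorted:
  assumes "sorted_wrt (\<lambda>X Y. \<forall>x\<in>X. \<forall>y\<in>Y. pos x + D \<le> pos y) Xs" "\<Union>(set Xs) = pairs r"
  shows "T = (\<Sum>X\<leftarrow>Xs. s (\<Sum>x\<in>X. wt x * 2 ^ pos x))"
proof -
  have sub: "X \<subseteq> pairs r" if "X \<in> set Xs" for X using assms(2) that by blast
  have "finite X \<and> card X \<le> 2 ^ 7 \<and> (\<forall>x\<in>X. wt x < 2 ^ (2 * M + 1))" if "X \<in> set Xs" for X
  proof (intro conjI ballI)
    show "finite X" using sub [OF that] finite_pairs by (rule finite_subset)
    have "card X \<le> 66" using card_mono [OF finite_pairs sub [OF that]] card_le by (rule order_trans)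
    then show "card X \<le> 2 ^ 7" by simp
    show "wt x < 2 ^ (2 * M + 1)" if "x \<in> X" for x
      using wt_bounds [of x] sub [OF \<open>X \<in> set Xs\<close>] that by blast
  qed
  moreover have le: "2 * M + 1 + 7 \<le> D" by (simp add: D_eq)
  have "sorted_wrt (\<lambda>X Y. \<forall>x\<in>X. \<forall>y\<in>Y. pos x + (2 * M + 1 + 7) \<le> pos y) Xs"
    by (rule sorted_wrt_mono_rel [OF _ assms(1)]) (meson add_left_mono le order_trans)
  ultimately show ?thesis
    unfolding T_sum assms(2) [symmetric] by (intro s_sum_groups [where m = "2 * M + 1" and l = 7]) auto
qed

text \<open>Being below is transitive for sets only through a nonempty middle set, hence the last
  hypothesis.\<close>

lemma groups:
  assumes "successively (\<lambda>X Y. \<forall>x\<in>X. \<forall>y\<in>Y. pos x + D \<le> pos y) Xs" "\<Union>(set Xs) = pairs r"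
    and "{} \<notin> set Xs"
  shows "T = (\<Sum>X\<leftarrow>Xs. s (\<Sum>x\<in>X. wt x * 2 ^ pos x))"
proof (rule groups_sorted [OF _ assms(2)])
  let ?P = "\<lambda>X Y. \<forall>x\<in>X. \<forall>y\<in>Y. pos x + D \<le> pos y"
  have "?P X Z" if "Y \<in> set Xs" "?P X Y" "?P Y Z" for X Y Z
  proof (intro ballI)
    fix x z assume "x \<in> X" "z \<in> Z"
    obtain y where "y \<in> Y" using \<open>Y \<in> set Xs\<close> assms(3) by (metis equals0I)
    then show "pos x + D \<le> pos z" using that \<open>x \<in> X\<close> \<open>z \<in> Z\<close> by (meson le_add1 order_trans)
  qed
  then have "successively ?P Xs \<longleftrightarrow> sorted_wrt ?P Xs"
    by (intro successively_iff_sorted_wrt_strong) blast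
  then show "sorted_wrt ?P Xs" using assms(1) by blast
qed

text \<open>This pair, \<open>(0, 1)\<close> and their two mirror images are isolated however the
  clusters are spaced, so their digit sums always count in full.\<close>

lemma iso_first: "iso (0, 0)"
  unfolding isolated_def
proof (intro ballI impI)
  fix x assume x: "x \<in> pairs r" "x \<noteq> (0, 0)"
  obtain i j where ij: "x = (i, j)" by fastforce
  then have "e 0 + 100 * D \<le> e j" "e 0 \<le> e i" using x e_less [of 0 j] e_le [of 0 i] by (auto simp: pairs_def)
  then show "pos x + D \<le> pos (0, 0) \<or> pos (0, 0) + D \<le> pos x" unfolding ij by simp
qed

lemma iso_second: "iso (0, 1)"
  unfolding isolated_def
proof (intro ballI impI)
  fix x assume x: "x \<in> pairs r" "x \<noteq> (0, 1)"
  obtain i j where ij: "x = (i, j)" by fastforce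
  have l: "i \<le> j" "j < r" using x ij by (auto simp: pairs_def)
  consider "j = 0" "i = 0" | "j = 1" "i = 1" | "j \<ge> 2" using x ij l by fastforce
  then show "pos x + D \<le> pos (0, 1) \<or> pos (0, 1) + D \<le> pos x"
  proof cases
    case 3
    then show ?thesis using e_less [of 1 j] e_le [of 0 i] l unfolding ij by simp
  qed (use e_less [of 0 1] r in \<open>simp_all add: ij\<close>)
qed

lemma iso_last: "iso (r - 1, r - 1)"
  unfolding isolated_def
proof (intro ballI impI)
  fix x assume x: "x \<in> pairs r" "x \<noteq> (r - 1, r - 1)"
  obtain i j where ij: "x = (i, j)" by fastforce
  then have "e i + 100 * D \<le> e (r - 1)" "e j \<le> e (r - 1)"
    using x e_less [of i "r - 1"] e_le [of j "r - 1"] r by (auto simp: pairs_def)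
  then show "pos x + D \<le> pos (r - 1, r - 1) \<or> pos (r - 1, r - 1) + D \<le> pos x" unfolding ij by simp
qed

lemma iso_before_last: "iso (r - 2, r - 1)"
  unfolding isolated_def
proof (intro ballI impI)
  fix x assume x: "x \<in> pairs r" "x \<noteq> (r - 2, r - 1)"
  obtain i j where ij: "x = (i, j)" by fastforce
  have l: "i \<le> j" "j < r" using x ij by (auto simp: pairs_def)
  have e: "e (r - 2) + 100 * D \<le> e (r - 1)" using e_less [of "r - 2" "r - 1"] r by simp
  consider "j = r - 1" "i = r - 1" | "j = r - 1" "i < r - 2" | "j \<le> r - 2" using x ij l by fastforce
  then show "pos x + D \<le> pos (r - 2, r - 1) \<or> pos (r - 2, r - 1) + D \<le> pos x"
  proof cases
    case 2
    then show ?thesis using e_less [of i "r - 2"] r unfolding ij by simp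
  next
    case 3
    then show ?thesis using e e_le [of i "r - 2"] e_le [of j "r - 2"] r l unfolding ij by simp
  qed (use e in \<open>simp_all add: ij\<close>)
qed

section \<open>Case distinction by the number of clusters\<close>

lemma three_clusters:
  assumes r3: "r = 3"
  shows "K < T"
proof -
  have e: "e 0 + 100 * D \<le> e 1" "e 1 + 100 * D \<le> e 2" using e_less r3 by simp_all
  have K: "K = s (B 0) + s (B 1) + s (B 2)" unfolding K_eq r3 lessThan_explicit by simp
  have o: "odd (B 0)" "odd (B 1)" "odd (B 2)" using B r3 by simp_all
  have iso: "iso (0, 0)" "iso (0, 1)" "iso (1, 2)" "iso (2, 2)"
    using iso_first iso_second iso_last iso_before_last unfolding r3 by (simp_all add: One_nat_def)
  show ?thesis
  \<comment> \<open>Only \<open>(0, 2)\<close> and \<open>(1, 1)\<close> can collide; otherwise all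
    six products count separately.\<close>
  proof (cases "e 0 + e 2 < 2 * e 1 + D \<and> 2 * e 1 < e 0 + e 2 + D")
    case True
    have "T = s ((B 0)\<^sup>2) + s (B 0 * B 1) + s (2 * (B 0 * B 2) * 2 ^ (e 0 + e 2) + (B 1)\<^sup>2 * 2 ^ (e 1 + e 1))
      + s (B 1 * B 2) + s ((B 2)\<^sup>2)"
      by (subst groups [of "[{(0,0)}, {(0,1)}, {(0,2), (1,1)}, {(1,2)}, {(2,2)}]"])
        (use e D_pos True in \<open>auto simp: r3 pairs_3\<close>)
    also have "2 * (B 0 * B 2) * 2 ^ (e 0 + e 2) = 2 ^ (e 0 + e 2 + 1) * (B 0 * B 2)"
      by (simp only: power_add power_one_right ac_simps)
    also have "(B 1)\<^sup>2 * 2 ^ (e 1 + e 1) = 2 ^ (e 1 + e 1) * (B 1)\<^sup>2" by (rule mult.commute)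
    finally show ?thesis using three_cluster_bound [OF o, of "e 0 + e 2 + 1" "e 1 + e 1"] K K_le by simp
  next
    case False
    have iso': "iso (0, 2)" "iso (1, 1)" 
      unfolding r3 pairs_3 isolated_def using e D_pos False by auto
    have "s ((B 0)\<^sup>2) + s (B 0 * B 1) + s (B 0 * B 2) + s ((B 1)\<^sup>2) + s (B 1 * B 2) + s ((B 2)\<^sup>2) \<le> T"
    proof (cases "e 0 + e 2 + D \<le> 2 * e 1")
      case True
      then show ?thesis using chain [of "map (\<lambda>x. (x, True)) [(0,0), (0,1), (0,2), (1,1), (1,2), (2,2)]"] e iso iso'
        by (auto simp: r3 pairs_3)
    next
      case F: False
      then show ?thesis using chain [of "map (\<lambda>x. (x, True)) [(0,0), (0,1), (1,1), (0,2), (1,2), (2,2)]"] e iso iso' False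
        by (auto simp: r3 pairs_3)
    qed
    then show ?thesis using separated_three_bound [OF o] K K_le by simp
  qed
qed

lemma two_clusters:
  assumes r2: "r = 2"
  shows "K < T"
proof -
  have iso: "iso (0, 0)" "iso (0, 1)" "iso (1, 1)"
    using iso_first iso_second iso_last unfolding r2 by (simp_all add: One_nat_def)
  have two: "{..<2} = {0, 1 :: nat}" "pairs 2 = {(0,0), (0,1), (1,1)}" by (auto simp: pairs_def)
  have "e 0 + 100 * D \<le> e 1" using e_less r2 by simp
  then have "s ((B 0)\<^sup>2) + s (B 0 * B 1) + s ((B 1)\<^sup>2) \<le> T"
    using chain [of "map (\<lambda>x. (x, True)) [(0,0), (0,1), (1,1)]"] iso by (auto simp: r2 two)
  moreover have "K = s (B 0) + s (B 1)" unfolding K_eq r2 two by simp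
  moreover have "odd (B 0)" "odd (B 1)" using B r2 by simp_all
  ultimately show ?thesis using pair_bound [of "B 0" "B 1"] K_le by simp
qed

lemma four_clusters:
  assumes r4: "r = 4"
  shows "K < T"
proof (rule ccontr)
  assume neg: "\<not> ?thesis"
  have e: "e 0 + 100 * D \<le> e 1" "e 1 + 100 * D \<le> e 2" "e 2 + 100 * D \<le> e 3" using e_less r4 by simp_all
  have K: "K = s (B 0) + s (B 1) + s (B 2) + s (B 3)" unfolding K_eq r4 lessThan_explicit by simp
  have o: "odd (B 0)" "odd (B 1)" "odd (B 2)" "odd (B 3)" using B r4 by simp_all
  have iso: "iso (0, 0)" "iso (0, 1)" "iso (2, 3)" "iso (3, 3)"
    using iso_first iso_second iso_last iso_before_last unfolding r4 by (simp_all add: One_nat_def)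
  define L where "L = s ((B 0)\<^sup>2) + s (B 0 * B 1)"
  define R where "R = s (B 2 * B 3) + s ((B 3)\<^sup>2)"
  have sk: "s (B 0) \<ge> 1" "s (B 1) \<ge> 1" "s (B 2) \<ge> 1" "s (B 3) \<ge> 1" using s_pos odd_pos o by blast+
  have T0: "L + R + 3 \<le> T"
    using chain [of "[((0,0),True), ((0,1),True), ((0,2),False), ((0,3),False), ((1,3),False), ((2,3),True), ((3,3),True)]"] e iso
    by (auto simp: r4 pairs_4 L_def R_def)
  have T1: "L + s (B 0 * B 2) + 2 + R \<le> T" if far: "e 0 + e 2 + D \<le> 2 * e 1 \<or> 2 * e 1 + D \<le> e 0 + e 2"
  proof -
    have "iso (0, 2)" unfolding r4 pairs_4 isolated_def using e D_pos far by auto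
    then show ?thesis
      using chain [of "[((0,0),True), ((0,1),True), ((0,2),True), ((0,3),False), ((1,3),False), ((2,3),True), ((3,3),True)]"] e iso
      by (auto simp: r4 pairs_4 L_def R_def)
  qed
  have T2: "L + s (B 1 * B 3) + 2 + R \<le> T" if far: "e 1 + e 3 + D \<le> 2 * e 2 \<or> 2 * e 2 + D \<le> e 1 + e 3"
  proof -
    have "iso (1, 3)" unfolding r4 pairs_4 isolated_def using e D_pos far by auto
    then show ?thesis
      using chain [of "[((0,0),True), ((0,1),True), ((0,2),False), ((0,3),False), ((1,3),True), ((2,3),True), ((3,3),True)]"] e iso
      by (auto simp: r4 pairs_4 L_def R_def)
  qed
  have T3: "L + s (B 1 * B 2) + 3 + R \<le> T" if far: "e 0 + e 3 + D \<le> e 1 + e 2 \<or> e 1 + e 2 + D \<le> e 0 + e 3"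
  proof -
    have iso': "iso (1, 2)" unfolding r4 pairs_4 isolated_def using e D_pos far by auto
    show ?thesis
    proof (cases "e 0 + e 3 + D \<le> e 1 + e 2")
      case True
      then show ?thesis
        using chain [of "[((0,0),True), ((0,1),True), ((0,2),False), ((0,3),False), ((1,2),True), ((1,3),False), ((2,3),True), ((3,3),True)]"]
          e iso iso' by (auto simp: r4 pairs_4 L_def R_def)
    next
      case False
      then show ?thesis
        using chain [of "[((0,0),True), ((0,1),True), ((0,2),False), ((1,2),True), ((0,3),False), ((1,3),False), ((2,3),True), ((3,3),True)]"]
          e iso iso' far by (auto simp: r4 pairs_4 L_def R_def)
    qed
  qed
  have T4: "T = L + s (2 ^ (e 0 + e 2 + 1) * (B 0 * B 2) + 2 ^ (e 1 + e 1) * (B 1)\<^sup>2)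
      + s (2 ^ (e 0 + e 3 + 1) * (B 0 * B 3) + 2 ^ (e 1 + e 2 + 1) * (B 1 * B 2))
      + s (2 ^ (e 1 + e 3 + 1) * (B 1 * B 3) + 2 ^ (e 2 + e 2) * (B 2)\<^sup>2) + R"
    \<comment> \<open>The near equality of \<open>e 0 + e 3\<close> and \<open>e 1 + e 2\<close>
      combines with either of the other two to give the remaining one with error up to
      \<open>2 * D\<close>.\<close>
    if near: "e 0 + e 2 < 2 * e 1 + 2 * D" "2 * e 1 < e 0 + e 2 + 2 * D" "e 1 + e 3 < 2 * e 2 + 2 * D"
      "2 * e 2 < e 1 + e 3 + 2 * D" "e 0 + e 3 < e 1 + e 2 + D" "e 1 + e 2 < e 0 + e 3 + D"
  proof -
    have "T = L + s (2 * (B 0 * B 2) * 2 ^ (e 0 + e 2) + (B 1)\<^sup>2 * 2 ^ (e 1 + e 1))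
      + s (2 * (B 0 * B 3) * 2 ^ (e 0 + e 3) + 2 * (B 1 * B 2) * 2 ^ (e 1 + e 2))
      + s (2 * (B 1 * B 3) * 2 ^ (e 1 + e 3) + (B 2)\<^sup>2 * 2 ^ (e 2 + e 2)) + R"
      by (subst groups [of "[{(0,0)}, {(0,1)}, {(0,2), (1,1)}, {(0,3), (1,2)}, {(1,3), (2,2)}, {(2,3)}, {(3,3)}]"])
        (use e D_pos near in \<open>auto simp: r4 pairs_4 L_def R_def\<close>)
    then show ?thesis by (simp only: power_add power_one_right ac_simps)
  qed
  have TK: "T \<le> K" "T \<le> 11" using neg K_le by simp_all
  have end_ge: "s (a\<^sup>2) + s (a * b) \<ge> 4" if "odd a" "odd b" "a \<noteq> 1" for a b
    using s_square_ge_2 [OF that(1,3)] s_odd_mult_ge_2 [OF that(1,3), of b] odd_pos [OF that(2)] by simp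
  have half: "s (B 3) \<le> R" "s (B 0) \<le> L"
    using half_bound [OF o(3,4)] half_bound [OF o(2,1)] K K_le sk by (simp_all add: L_def R_def mult.commute)
  show False
  proof (cases "B 0 = 1")
    case B0: True
    then have L: "L = 1 + s (B 1)" by (simp add: L_def)
    have B3: "B 3 \<noteq> 1"
    proof
      assume "B 3 = 1"
      then show False using T0 TK K L B0 by (simp add: R_def)
    qed
    have R4: "R \<ge> 4" using end_ge [OF o(4,3) B3] by (simp add: R_def mult.commute)
    have far3: "\<not> (e 0 + e 3 + D \<le> e 1 + e 2 \<or> e 1 + e 2 + D \<le> e 0 + e 3)"
    proof
      assume "e 0 + e 3 + D \<le> e 1 + e 2 \<or> e 1 + e 2 + D \<le> e 0 + e 3"
      note t = T3 [OF this]
      show False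
      proof (cases "B 1 = 1")
        case True
        then show False using t TK K L half B0 by simp
      next
        case False
        then have "s (B 1) \<ge> 2" "s (B 1 * B 2) \<ge> 2"
          using odd_s_ge_2 [OF o(2)] s_odd_mult_ge_2 [OF o(2) False, of "B 2"] odd_pos [OF o(3)] by simp_all
        then show False using t TK K L R4 B0 by simp
      qed
    qed
    \<comment> \<open>With \<open>B 0 = 1\<close> the isolated cross term contributes
      \<open>s (B 2)\<close>, so the chain alone dominates all four summands of
      \<open>K\<close>.\<close>
    have far1: "\<not> (e 0 + e 2 + D \<le> 2 * e 1 \<or> 2 * e 1 + D \<le> e 0 + e 2)"
      using T1 TK K L half B0 by fastforce
    have near: "e 0 + e 2 < 2 * e 1 + D" "2 * e 1 < e 0 + e 2 + D" "e 0 + e 3 < e 1 + e 2 + D" "e 1 + e 2 < e 0 + e 3 + D"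
      using far1 far3 by linarith+
    have "T = L + s (2 ^ (e 0 + e 2 + 1) * (B 0 * B 2) + 2 ^ (e 1 + e 1) * (B 1)\<^sup>2)
      + s (2 ^ (e 0 + e 3 + 1) * (B 0 * B 3) + 2 ^ (e 1 + e 2 + 1) * (B 1 * B 2))
      + s (2 ^ (e 1 + e 3 + 1) * (B 1 * B 3) + 2 ^ (e 2 + e 2) * (B 2)\<^sup>2) + R"
      by (rule T4) (use near in linarith)+
    moreover have "s (B 1) + s (B 2) + s (B 3) \<le> 10" using K K_le sk by linarith
    ultimately show False
      using four_cluster_bound [OF o(2-4) B3, of "e 0 + e 2 + 1" "e 1 + e 1" "e 0 + e 3 + 1" "e 1 + e 2 + 1"
        "e 1 + e 3 + 1" "e 2 + e 2"] TK K L B0 by (simp add: R_def)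
  next
    case B0: False
    have L4: "L \<ge> 4" using end_ge [OF o(1,2) B0] by (simp add: L_def)
    show False
    proof (cases "B 3 = 1")
      case B3: True
      then have R: "R = s (B 2) + 1" by (simp add: R_def)
      have far3: "\<not> (e 0 + e 3 + D \<le> e 1 + e 2 \<or> e 1 + e 2 + D \<le> e 0 + e 3)"
      proof
        assume "e 0 + e 3 + D \<le> e 1 + e 2 \<or> e 1 + e 2 + D \<le> e 0 + e 3"
        note t = T3 [OF this]
        show False
        proof (cases "B 2 = 1")
          case True
          then show False using t TK K R half B3 by simp
        next
          case False
          then have "s (B 2) \<ge> 2" "s (B 1 * B 2) \<ge> 2"
            using odd_s_ge_2 [OF o(3)] s_odd_mult_ge_2 [OF o(3) False, of "B 1"] odd_pos [OF o(2)]
            by (simp_all add: mult.commute)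
          then show False using t TK K R L4 B3 by simp
        qed
      qed
      have far2: "\<not> (e 1 + e 3 + D \<le> 2 * e 2 \<or> 2 * e 2 + D \<le> e 1 + e 3)"
        using T2 TK K R half B3 by fastforce
      have near: "e 1 + e 3 < 2 * e 2 + D" "2 * e 2 < e 1 + e 3 + D" "e 0 + e 3 < e 1 + e 2 + D" "e 1 + e 2 < e 0 + e 3 + D"
        using far2 far3 by linarith+
      have "T = L + s (2 ^ (e 0 + e 2 + 1) * (B 0 * B 2) + 2 ^ (e 1 + e 1) * (B 1)\<^sup>2)
        + s (2 ^ (e 0 + e 3 + 1) * (B 0 * B 3) + 2 ^ (e 1 + e 2 + 1) * (B 1 * B 2))
        + s (2 ^ (e 1 + e 3 + 1) * (B 1 * B 3) + 2 ^ (e 2 + e 2) * (B 2)\<^sup>2) + R"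
        by (rule T4) (use near in linarith)+
      moreover have "s (B 2) + s (B 1) + s (B 0) \<le> 10" using K K_le sk by linarith
      ultimately show False
        using four_cluster_bound [OF o(3,2,1) B0, of "e 1 + e 3 + 1" "e 2 + e 2" "e 0 + e 3 + 1" "e 1 + e 2 + 1"
          "e 0 + e 2 + 1" "e 1 + e 1"] TK K R B3 by (simp add: L_def ac_simps)
    next
      case B3: False
      have R4: "R \<ge> 4" using end_ge [OF o(4,3) B3] by (simp add: R_def mult.commute)
      \<comment> \<open>Two ends of 4 and three middle positions use up all 11 ones, so every bound
        is attained; this will force both outer clusters to be 3.\<close>
      have eqs: "T = 11" "L = 4" "R = 4" "K = 11" using T0 TK L4 R4 K_le by linarith+
      have p: "s ((B 0)\<^sup>2) \<ge> 2" "s ((B 3)\<^sup>2) \<ge> 2" "s (B 0 * B 1) \<ge> 2" "s (B 2 * B 3) \<ge> 2"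
        using s_square_ge_2 o B0 B3 s_odd_mult_ge_2 [OF o(1) B0, of "B 1"] s_odd_mult_ge_2 [OF o(4) B3, of "B 2"]
          odd_pos [OF o(2)] odd_pos [OF o(3)] by (simp_all add: mult.commute)
      have b: "s ((B 0)\<^sup>2) = 2" "s ((B 3)\<^sup>2) = 2" "s (B 2 * B 3) = 2" using eqs p unfolding L_def R_def by linarith+
      have "s (B 0) \<le> 9" "s (B 3) \<le> 9" using K K_le sk by linarith+
      then have "B 0 = 3" "B 3 = 3" using s_square_2_iff o b by blast+
      have more: False if "L + 4 + R \<le> T" using that eqs by simp
      have near1: "e 0 + e 2 < 2 * e 1 + D" "2 * e 1 < e 0 + e 2 + D"
      proof -
        have "\<not> e 0 + e 2 + D \<le> 2 * e 1"
          using more chain [of "[((0,0),True), ((0,1),True), ((0,2),False), ((1,1),False), ((1,2),False), ((1,3),False), ((2,3),True), ((3,3),True)]"]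
            e iso by (auto simp: r4 pairs_4 L_def R_def)
        moreover have "\<not> 2 * e 1 + D \<le> e 0 + e 2"
          using more chain [of "[((0,0),True), ((0,1),True), ((1,1),False), ((0,2),False), ((1,2),False), ((1,3),False), ((2,3),True), ((3,3),True)]"]
            e iso by (auto simp: r4 pairs_4 L_def R_def)
        ultimately show "e 0 + e 2 < 2 * e 1 + D" "2 * e 1 < e 0 + e 2 + D" by linarith+
      qed
      have far3: "\<not> (e 0 + e 3 + D \<le> e 1 + e 2 \<or> e 1 + e 2 + D \<le> e 0 + e 3)"
      proof
        assume far: "e 0 + e 3 + D \<le> e 1 + e 2 \<or> e 1 + e 2 + D \<le> e 0 + e 3"
        have "s (B 1 * B 2) \<ge> 1" using odd_pos [OF o(2)] odd_pos [OF o(3)] by (intro s_pos) simp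
        then show False using T3 [OF far] eqs by simp
      qed
      have T: "T = L + s (2 ^ (e 0 + e 2 + 1) * (B 0 * B 2) + 2 ^ (e 1 + e 1) * (B 1)\<^sup>2)
        + s (2 ^ (e 0 + e 3 + 1) * (B 0 * B 3) + 2 ^ (e 1 + e 2 + 1) * (B 1 * B 2))
        + s (2 ^ (e 1 + e 3 + 1) * (B 1 * B 3) + 2 ^ (e 2 + e 2) * (B 2)\<^sup>2) + R"
        by (rule T4) (use near1 far3 in linarith)+
      have "s (2 ^ (e 0 + e 2 + 1) * (B 0 * B 2) + 2 ^ (e 1 + e 1) * (B 1)\<^sup>2) \<ge> 1"
        "s (2 ^ (e 0 + e 3 + 1) * (B 0 * B 3) + 2 ^ (e 1 + e 2 + 1) * (B 1 * B 2)) \<ge> 1"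
        "s (2 ^ (e 1 + e 3 + 1) * (B 1 * B 3) + 2 ^ (e 2 + e 2) * (B 2)\<^sup>2) \<ge> 1"
        by (rule s_shifted_sum_pos; use o in simp)+
      then have "s (2 ^ (e 0 + e 2 + 1) * (B 0 * B 2) + 2 ^ (e 1 + e 1) * (B 1)\<^sup>2) = 1"
        using T eqs by linarith
      then have "B 1 = 1 \<and> B 2 = 1"
        using four_cluster_ends [OF o(2,3), of "e 0 + e 2 + 1" "e 1 + e 1"] b(3)
        unfolding \<open>B 0 = 3\<close> \<open>B 3 = 3\<close> by (simp only: mult.commute)
      then show False using K eqs \<open>B 0 = 3\<close> \<open>B 3 = 3\<close> by simp
    qed
  qed
qed

lemma five_clusters:
  assumes r5: "r = 5"
  shows "K < T"
proof (rule ccontr)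
  assume neg: "\<not> ?thesis"
  have e: "e 0 + 100 * D \<le> e 1" "e 1 + 100 * D \<le> e 2" "e 2 + 100 * D \<le> e 3" "e 3 + 100 * D \<le> e 4"
    using e_less r5 by simp_all
  have K: "K = s (B 0) + s (B 1) + s (B 2) + s (B 3) + s (B 4)" unfolding K_eq r5 lessThan_explicit by simp
  have o: "odd (B 0)" "odd (B 1)" "odd (B 2)" "odd (B 3)" "odd (B 4)" using B r5 by simp_all
  have iso: "iso (0, 0)" "iso (0, 1)" "iso (3, 4)" "iso (4, 4)"
    using iso_first iso_second iso_last iso_before_last unfolding r5 by (simp_all add: One_nat_def)
  define L where "L = s ((B 0)\<^sup>2) + s (B 0 * B 1)"
  define R where "R = s (B 3 * B 4) + s ((B 4)\<^sup>2)"
  define g1 where "g1 = s (2 ^ (e 0 + e 2 + 1) * (B 0 * B 2) + 2 ^ (2 * e 1) * (B 1)\<^sup>2)"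
  define g2 where "g2 = s (2 ^ (e 0 + e 3) * (B 0 * B 3) + 2 ^ (e 1 + e 2) * (B 1 * B 2))"
  define g3 where "g3 = s (2 ^ (e 0 + e 4 + 1) * (B 0 * B 4) + 2 ^ (e 1 + e 3 + 1) * (B 1 * B 3) + 2 ^ (2 * e 2) * (B 2)\<^sup>2)"
  define g4 where "g4 = s (2 ^ (e 1 + e 4) * (B 1 * B 4) + 2 ^ (e 2 + e 3) * (B 2 * B 3))"
  define g5 where "g5 = s (2 ^ (e 2 + e 4 + 1) * (B 2 * B 4) + 2 ^ (2 * e 3) * (B 3)\<^sup>2)"
  note ex = r5 pairs_5 L_def R_def
  have sk: "s (B 0) \<ge> 1" "s (B 1) \<ge> 1" "s (B 2) \<ge> 1" "s (B 3) \<ge> 1" "s (B 4) \<ge> 1" using s_pos odd_pos o by blast+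
  have T0: "L + R + 5 \<le> T"
    using chain [of "[((0,0),True), ((0,1),True), ((0,2),False), ((0,3),False), ((0,4),False), ((1,4),False),
      ((2,4),False), ((3,4),True), ((4,4),True)]"] e iso by (auto simp: ex)
  have T4: "T = L + g1 + g2 + g3 + g4 + g5 + R"
    if near: "e 0 + e 2 < 2 * e 1 + 3 * D" "2 * e 1 < e 0 + e 2 + 3 * D" "e 2 + e 4 < 2 * e 3 + 3 * D"
      "2 * e 3 < e 2 + e 4 + 3 * D" "e 0 + e 3 < e 1 + e 2 + 3 * D" "e 1 + e 2 < e 0 + e 3 + 3 * D"
  proof -
    have T: "T = L + s (2 * (B 0 * B 2) * 2 ^ (e 0 + e 2) + (B 1)\<^sup>2 * 2 ^ (e 1 + e 1))
      + s (2 * (B 0 * B 3) * 2 ^ (e 0 + e 3) + 2 * (B 1 * B 2) * 2 ^ (e 1 + e 2))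
      + s (2 * (B 0 * B 4) * 2 ^ (e 0 + e 4) + (2 * (B 1 * B 3) * 2 ^ (e 1 + e 3) + (B 2)\<^sup>2 * 2 ^ (e 2 + e 2)))
      + s (2 * (B 1 * B 4) * 2 ^ (e 1 + e 4) + 2 * (B 2 * B 3) * 2 ^ (e 2 + e 3))
      + s (2 * (B 2 * B 4) * 2 ^ (e 2 + e 4) + (B 3)\<^sup>2 * 2 ^ (e 3 + e 3)) + R"
    proof -
      let ?Xs = "[{(0,0)}, {(0,1)}, {(0,2), (1,1)}, {(0,3), (1,2)}, {(0,4), (1,3), (2,2)},
          {(1,4), (2,3)}, {(2,4), (3,3)}, {(3,4)}, {(4,4)}]"
      have "successively (\<lambda>X Y. \<forall>x\<in>X. \<forall>y\<in>Y. pos x + D \<le> pos y) ?Xs"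
      proof -
        \<comment> \<open>\<open>G\<close> is the first difference. Every \<open>e i\<close> is
          \<open>e 0 + i * G\<close> up to an error of \<open>20 * D\<close>, which a difference of
          at least \<open>100 * D\<close> absorbs.\<close>
        obtain G where G: "e 1 = e 0 + G" "100 * D \<le> G" using e(1) by (metis add.assoc le_Suc_ex le_add1)
        have "e 2 \<le> e 0 + 2 * G + 3 * D" "e 0 + 2 * G \<le> e 2 + 3 * D"
          using near(1,2) G(1) by linarith+
        moreover from this have "e 3 \<le> e 0 + 3 * G + 6 * D" "e 0 + 3 * G \<le> e 3 + 6 * D"
          using near(5,6) G(1) by linarith+
        moreover from calculation have "e 4 \<le> e 0 + 4 * G + 20 * D" "e 0 + 4 * G \<le> e 4 + 20 * D"
          using near(3,4) by linarith+
        ultimately show ?thesis using G D_pos by simp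
      qed
      moreover have "\<Union>(set ?Xs) = pairs r" unfolding r5 pairs_5 by (simp add: insert_commute)
      ultimately have "T = (\<Sum>X\<leftarrow>?Xs. s (\<Sum>x\<in>X. wt x * 2 ^ pos x))" by (rule groups) simp
      then show ?thesis by (simp add: L_def R_def)
    qed
    have shift: "2 * (x * y) * 2 ^ p = 2 ^ (p + 1) * (x * y)" "x\<^sup>2 * 2 ^ (p + p) = 2 ^ (2 * p) * x\<^sup>2" for x y p :: nat
      by (simp_all add: power_add mult_2)
    note T
    also have "s (2 * (B 0 * B 2) * 2 ^ (e 0 + e 2) + (B 1)\<^sup>2 * 2 ^ (e 1 + e 1)) = g1"
      unfolding g1_def shift ..
    also have "s (2 * (B 0 * B 4) * 2 ^ (e 0 + e 4) + (2 * (B 1 * B 3) * 2 ^ (e 1 + e 3) + (B 2)\<^sup>2 * 2 ^ (e 2 + e 2))) = g3"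
      unfolding g3_def shift add.assoc ..
    also have "s (2 * (B 2 * B 4) * 2 ^ (e 2 + e 4) + (B 3)\<^sup>2 * 2 ^ (e 3 + e 3)) = g5"
      unfolding g5_def shift ..
    also have "2 * (B 0 * B 3) * 2 ^ (e 0 + e 3) + 2 * (B 1 * B 2) * 2 ^ (e 1 + e 2)
      = 2 * (2 ^ (e 0 + e 3) * (B 0 * B 3) + 2 ^ (e 1 + e 2) * (B 1 * B 2))" by simp
    also have "2 * (B 1 * B 4) * 2 ^ (e 1 + e 4) + 2 * (B 2 * B 3) * 2 ^ (e 2 + e 3)
      = 2 * (2 ^ (e 1 + e 4) * (B 1 * B 4) + 2 ^ (e 2 + e 3) * (B 2 * B 3))" by simp
    finally show ?thesis unfolding g2_def g4_def s_double .
  qed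
  have gpos: "g1 \<ge> 1" "g2 \<ge> 1" "g3 \<ge> 1" "g4 \<ge> 1" "g5 \<ge> 1"
    unfolding g1_def g2_def g3_def g4_def g5_def add.assoc by (rule s_shifted_sum_pos; use o in simp)+
  have TK: "T \<le> K" "T \<le> 11" using neg K_le by simp_all
  have end_ge: "s (a\<^sup>2) \<ge> 2" "s (a * b) \<ge> 2" "s (b * a) \<ge> 2" if "odd a" "odd b" "a \<noteq> 1" for a b
    using s_square_ge_2 [OF that(1,3)] s_odd_mult_ge_2 [OF that(1,3), of b] odd_pos [OF that(2)]
    by (simp_all add: mult.commute)
  have tight: "g1 = 1 \<and> g2 = 1 \<and> g3 = 1 \<and> g4 = 1 \<and> g5 = 1" if "L + R = 6"
  proof -
    have more: False if "L + 6 + R \<le> T" using that TK \<open>L + R = 6\<close> by simp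
    have far1: "\<not> e 0 + e 2 + D \<le> 2 * e 1" "\<not> 2 * e 1 + D \<le> e 0 + e 2"
      using more chain [of "[((0,0),True), ((0,1),True), ((0,2),False), ((1,1),False), ((1,2),False), ((1,3),False), ((1,4),False),
          ((2,4),False), ((3,4),True), ((4,4),True)]"]
        chain [of "[((0,0),True), ((0,1),True), ((1,1),False), ((0,2),False), ((1,2),False), ((1,3),False), ((1,4),False),
          ((2,4),False), ((3,4),True), ((4,4),True)]"] e iso by (auto simp: ex)
    have far2: "\<not> e 1 + e 3 + D \<le> 2 * e 2" "\<not> 2 * e 2 + D \<le> e 1 + e 3"
      using more chain [of "[((0,0),True), ((0,1),True), ((0,2),False), ((1,2),False), ((1,3),False), ((2,2),False), ((2,3),False),
          ((2,4),False), ((3,4),True), ((4,4),True)]"]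
        chain [of "[((0,0),True), ((0,1),True), ((0,2),False), ((1,2),False), ((2,2),False), ((1,3),False), ((2,3),False),
          ((2,4),False), ((3,4),True), ((4,4),True)]"] e iso by (auto simp: ex)
    have far3: "\<not> e 2 + e 4 + D \<le> 2 * e 3" "\<not> 2 * e 3 + D \<le> e 2 + e 4"
      using more chain [of "[((0,0),True), ((0,1),True), ((0,2),False), ((0,3),False), ((1,3),False), ((2,3),False), ((2,4),False),
          ((3,3),False), ((3,4),True), ((4,4),True)]"]
        chain [of "[((0,0),True), ((0,1),True), ((0,2),False), ((0,3),False), ((1,3),False), ((2,3),False), ((3,3),False),
          ((2,4),False), ((3,4),True), ((4,4),True)]"] e iso by (auto simp: ex)
    have "T = L + g1 + g2 + g3 + g4 + g5 + R"
      by (rule T4) (use far1 far2 far3 in linarith)+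
    then show ?thesis using gpos that TK by linarith
  qed
  show False
  proof (cases "B 0 = 1")
    case B0: True
    show False
    proof (cases "B 4 = 1")
      case B4: True
      have LR: "L = 1 + s (B 1)" "R = s (B 3) + 1" using B0 B4 by (simp_all add: L_def R_def)
      have near1: "\<not> (e 0 + e 2 + D \<le> 2 * e 1 \<or> 2 * e 1 + D \<le> e 0 + e 2)"
      proof
        assume far: "e 0 + e 2 + D \<le> 2 * e 1 \<or> 2 * e 1 + D \<le> e 0 + e 2"
        have "iso (0, 2)" unfolding r5 pairs_5 isolated_def using e D_pos far by auto
        then have "L + s (B 0 * B 2) + 4 + R \<le> T"
          using chain [of "[((0,0),True), ((0,1),True), ((0,2),True), ((0,3),False), ((0,4),False), ((1,4),False),
            ((2,4),False), ((3,4),True), ((4,4),True)]"] e iso by (auto simp: ex)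
        then show False using TK K LR B0 B4 by simp
      qed
      have near2: "\<not> (e 2 + e 4 + D \<le> 2 * e 3 \<or> 2 * e 3 + D \<le> e 2 + e 4)"
      proof
        assume far: "e 2 + e 4 + D \<le> 2 * e 3 \<or> 2 * e 3 + D \<le> e 2 + e 4"
        have "iso (2, 4)" unfolding r5 pairs_5 isolated_def using e D_pos far by auto
        then have "L + s (B 2 * B 4) + 4 + R \<le> T"
          using chain [of "[((0,0),True), ((0,1),True), ((0,2),False), ((0,3),False), ((0,4),False), ((1,4),False),
            ((2,4),True), ((3,4),True), ((4,4),True)]"] e iso by (auto simp: ex)
        then show False using TK K LR B0 B4 by simp
      qed
      have B2: "B 2 \<noteq> 1"
        using T0 TK K LR B0 B4 by (intro notI) simp
      have near3: "\<not> e 1 + e 2 + 3 * D \<le> e 0 + e 3"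
      proof
        \<comment> \<open>The slack of \<open>3 * D\<close> survives the near equalities at the ends
          and also separates \<open>e 1 + e 3\<close> from \<open>e 0 + e 4\<close>, so the chain
          gains the two positions of \<open>(1, 2)\<close> and \<open>(1, 3)\<close>.\<close>
        assume far: "e 1 + e 2 + 3 * D \<le> e 0 + e 3"
        have "iso (1, 2)" unfolding r5 pairs_5 isolated_def using e D_pos far near1 near2 by auto
        then have "L + s (B 1 * B 2) + 6 + R \<le> T"
          using chain [of "[((0,0),True), ((0,1),True), ((0,2),False), ((1,2),True), ((0,3),False), ((1,3),False), ((0,4),False),
            ((1,4),False), ((2,4),False), ((3,4),True), ((4,4),True)]"] e iso far near1 near2 by (auto simp: ex)
        then show False using TK K K_le LR B0 B4 sk end_ge(3) [OF o(3,2) B2] by simp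
      qed
      have near4: "\<not> e 0 + e 3 + 3 * D \<le> e 1 + e 2"
      proof
        assume far: "e 0 + e 3 + 3 * D \<le> e 1 + e 2"
        have "iso (2, 3)" unfolding r5 pairs_5 isolated_def using e D_pos far near1 near2 by auto
        then have "L + s (B 2 * B 3) + 6 + R \<le> T"
          using chain [of "[((0,0),True), ((0,1),True), ((0,2),False), ((0,3),False), ((0,4),False), ((1,3),False), ((1,4),False),
            ((2,3),True), ((2,4),False), ((3,4),True), ((4,4),True)]"] e iso far near1 near2 by (auto simp: ex)
        then show False using TK K K_le LR B0 B4 sk end_ge(2) [OF o(3,4) B2] by simp
      qed
      have "T = L + g1 + g2 + g3 + g4 + g5 + R"
        by (rule T4) (use near1 near2 near3 near4 in linarith)+
      moreover have "s (B 2) < g1 + g2 + g3 + g4 + g5"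
        by (rule five_cluster_bound [OF o(2-4), of g1 "e 0" "e 2" "e 1" g2 "e 3" g3 "e 4" g4 g5])
          (use K K_le B0 B4 in \<open>simp_all add: g1_def g2_def g3_def g4_def g5_def\<close>)
      ultimately show False using TK K LR B0 B4 by simp
    next
      case B4: False
      have p: "s ((B 4)\<^sup>2) \<ge> 2" "s (B 3 * B 4) \<ge> 2" using end_ge [OF o(5,4) B4] by simp_all
      have "L = 1 + s (B 1)" using B0 by (simp add: L_def)
      \<comment> \<open>The ends take at least 2 and 4 ones and the middle 5, so all bounds are
        attained.\<close>
      then have eqs: "s (B 1) = 1" "s ((B 4)\<^sup>2) = 2" "s (B 3 * B 4) = 2" "L + R = 6" "K = 11"
        using T0 TK K_le p sk unfolding R_def by linarith+
      have "s (B 4) \<le> 9" using K K_le sk by linarith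
      then have B4: "B 4 = 3" using s_square_2_iff [OF o(5)] eqs by simp
      have B1: "B 1 = 1" using odd_s_eq_1 [OF o(2)] eqs by simp
      have "s (B 2) + s (B 3) = 7" using K eqs B0 B4 by simp
      then show False using tight [OF eqs(4)] eqs(3)
          five_cluster_end [OF o(3,4), of "e 0 + e 2 + 1" "2 * e 1" "e 0 + e 3" "e 1 + e 2" "e 2 + e 4 + 1" "2 * e 3"]
        unfolding g1_def g2_def g5_def B0 B1 B4 by (simp add: mult.commute)
    qed
  next
    case B0: False
    have p: "s ((B 0)\<^sup>2) \<ge> 2" "s (B 0 * B 1) \<ge> 2" using end_ge [OF o(1,2) B0] by simp_all
    show False
    proof (cases "B 4 = 1")
      case B4: True
      have "R = s (B 3) + 1" using B4 by (simp add: R_def)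
      then have eqs: "s (B 3) = 1" "s ((B 0)\<^sup>2) = 2" "s (B 0 * B 1) = 2" "L + R = 6" "K = 11"
        using T0 TK K_le p sk unfolding L_def by linarith+
      have "s (B 0) \<le> 9" using K K_le sk by linarith
      then have B0: "B 0 = 3" using s_square_2_iff [OF o(1)] eqs by simp
      have B3: "B 3 = 1" using odd_s_eq_1 [OF o(4)] eqs by simp
      have "s (B 2) + s (B 1) = 7" using K eqs B0 B4 by simp
      then show False using tight [OF eqs(4)] eqs(3)
          five_cluster_end [OF o(3,2), of "e 2 + e 4 + 1" "2 * e 3" "e 1 + e 4" "e 2 + e 3" "e 0 + e 2 + 1" "2 * e 1"]
        unfolding g1_def g4_def g5_def B0 B3 B4 by (simp add: mult.commute)
    next
      case B4: False
      have "s ((B 4)\<^sup>2) \<ge> 2" "s (B 3 * B 4) \<ge> 2" using end_ge [OF o(5,4) B4] by simp_all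
      then show False using T0 TK p unfolding L_def R_def by linarith
    qed
  qed
qed

text \<open>The 11 positions use up everything: the ends consist of single ones, so the two outer
  clusters on each side are 1, and each middle group is a power of two. This leaves 1 and 63 for the
  inner clusters, and the group with the square of 63 is no power of two.\<close>

lemma six_clusters:
  assumes r6: "r = 6"
  shows "K < T"
proof (rule ccontr)
  assume neg: "\<not> ?thesis"
  have e: "e 0 + 100 * D \<le> e 1" "e 1 + 100 * D \<le> e 2" "e 2 + 100 * D \<le> e 3" "e 3 + 100 * D \<le> e 4" "e 4 + 100 * D \<le> e 5"
    using e_less r6 by simp_all
  have K: "K = s (B 0) + s (B 1) + s (B 2) + s (B 3) + s (B 4) + s (B 5)" unfolding K_eq r6 lessThan_explicit by simp
  have o: "odd (B 0)" "odd (B 1)" "odd (B 2)" "odd (B 3)" "odd (B 4)" "odd (B 5)" using B r6 by simp_all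
  have iso: "iso (0, 0)" "iso (0, 1)" "iso (4, 5)" "iso (5, 5)"
    using iso_first iso_second iso_last iso_before_last unfolding r6 by (simp_all add: One_nat_def)
  define L where "L = s ((B 0)\<^sup>2) + s (B 0 * B 1)"
  define R where "R = s (B 4 * B 5) + s ((B 5)\<^sup>2)"
  note ex = r6 pairs_6 L_def R_def
  have pos: "s ((B 0)\<^sup>2) \<ge> 1" "s (B 0 * B 1) \<ge> 1" "s (B 4 * B 5) \<ge> 1" "s ((B 5)\<^sup>2) \<ge> 1"
    using odd_pos o by (auto intro!: s_pos)
  have TK: "T \<le> K" "T \<le> 11" using neg K_le by simp_all
  have "L + R + 7 \<le> T"
    using chain [of "[((0,0),True), ((0,1),True), ((0,2),False), ((0,3),False), ((0,4),False), ((0,5),False), ((1,5),False),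
      ((2,5),False), ((3,5),False), ((4,5),True), ((5,5),True)]"] e iso by (auto simp: ex)
  then have eqs: "s ((B 0)\<^sup>2) = 1" "s (B 0 * B 1) = 1" "s (B 4 * B 5) = 1" "s ((B 5)\<^sup>2) = 1" "T = 11" "K = 11" "L = 2" "R = 2"
    using TK K_le pos unfolding L_def R_def by linarith+
  have "(B 0)\<^sup>2 = 1" "B 0 * B 1 = 1" "B 4 * B 5 = 1" "(B 5)\<^sup>2 = 1"
    by (rule odd_s_eq_1; use o eqs in simp)+
  then have b: "B 0 = 1" "B 1 = 1" "B 4 = 1" "B 5 = 1" by simp_all
  have more: False if "L + 8 + R \<le> T" using that eqs by simp
  have far1: "\<not> e 0 + e 2 + D \<le> 2 * e 1" "\<not> 2 * e 1 + D \<le> e 0 + e 2"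
    using more chain [of "[((0,0),True), ((0,1),True), ((0,2),False), ((1,1),False), ((1,2),False), ((1,3),False), ((1,4),False),
        ((1,5),False), ((2,5),False), ((3,5),False), ((4,5),True), ((5,5),True)]"]
      chain [of "[((0,0),True), ((0,1),True), ((1,1),False), ((0,2),False), ((1,2),False), ((1,3),False), ((1,4),False),
        ((1,5),False), ((2,5),False), ((3,5),False), ((4,5),True), ((5,5),True)]"] e iso by (auto simp: ex)
  have far2: "\<not> e 1 + e 3 + D \<le> 2 * e 2" "\<not> 2 * e 2 + D \<le> e 1 + e 3"
    using more chain [of "[((0,0),True), ((0,1),True), ((0,2),False), ((1,2),False), ((1,3),False), ((2,2),False), ((2,3),False),
        ((2,4),False), ((2,5),False), ((3,5),False), ((4,5),True), ((5,5),True)]"]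
      chain [of "[((0,0),True), ((0,1),True), ((0,2),False), ((1,2),False), ((2,2),False), ((1,3),False), ((2,3),False),
        ((2,4),False), ((2,5),False), ((3,5),False), ((4,5),True), ((5,5),True)]"] e iso by (auto simp: ex)
  have far3: "\<not> e 2 + e 4 + D \<le> 2 * e 3" "\<not> 2 * e 3 + D \<le> e 2 + e 4"
    using more chain [of "[((0,0),True), ((0,1),True), ((0,2),False), ((0,3),False), ((1,3),False), ((2,3),False), ((2,4),False),
        ((3,3),False), ((3,4),False), ((3,5),False), ((4,5),True), ((5,5),True)]"]
      chain [of "[((0,0),True), ((0,1),True), ((0,2),False), ((0,3),False), ((1,3),False), ((2,3),False), ((3,3),False),
        ((2,4),False), ((3,4),False), ((3,5),False), ((4,5),True), ((5,5),True)]"] e iso by (auto simp: ex)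
  have far4: "\<not> e 3 + e 5 + D \<le> 2 * e 4" "\<not> 2 * e 4 + D \<le> e 3 + e 5"
    using more chain [of "[((0,0),True), ((0,1),True), ((0,2),False), ((0,3),False), ((0,4),False), ((1,4),False), ((2,4),False),
        ((3,4),False), ((3,5),False), ((4,4),False), ((4,5),True), ((5,5),True)]"]
      chain [of "[((0,0),True), ((0,1),True), ((0,2),False), ((0,3),False), ((0,4),False), ((1,4),False), ((2,4),False),
        ((3,4),False), ((4,4),False), ((3,5),False), ((4,5),True), ((5,5),True)]"] e iso by (auto simp: ex)
  define g where "g X = s (\<Sum>x\<in>X. wt x * 2 ^ pos x)" for X
  have "T = L + g {(0,2), (1,1)} + g {(0,3), (1,2)} + g {(0,4), (1,3), (2,2)} + g {(0,5), (1,4), (2,3)}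
      + g {(1,5), (2,4), (3,3)} + g {(2,5), (3,4)} + g {(3,5), (4,4)} + R"
  proof -
    let ?Xs = "[{(0,0)}, {(0,1)}, {(0,2), (1,1)}, {(0,3), (1,2)}, {(0,4), (1,3), (2,2)}, {(0,5), (1,4), (2,3)},
        {(1,5), (2,4), (3,3)}, {(2,5), (3,4)}, {(3,5), (4,4)}, {(4,5)}, {(5,5)}]"
    have near: "e 0 + e 2 < 2 * e 1 + D" "2 * e 1 < e 0 + e 2 + D" "e 1 + e 3 < 2 * e 2 + D" "2 * e 2 < e 1 + e 3 + D"
      "e 2 + e 4 < 2 * e 3 + D" "2 * e 3 < e 2 + e 4 + D" "e 3 + e 5 < 2 * e 4 + D" "2 * e 4 < e 3 + e 5 + D"
      using far1 far2 far3 far4 by linarith+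
    have "successively (\<lambda>X Y. \<forall>x\<in>X. \<forall>y\<in>Y. pos x + D \<le> pos y) ?Xs"
    proof -
      obtain G where G: "e 1 = e 0 + G" "100 * D \<le> G" using e(1) by (metis add.assoc le_Suc_ex le_add1)
      have "e 2 \<le> e 0 + 2 * G + D" "e 0 + 2 * G \<le> e 2 + D"
        using near(1,2) G(1) by linarith+
      moreover from this have "e 3 \<le> e 0 + 3 * G + 3 * D" "e 0 + 3 * G \<le> e 3 + 3 * D"
        using near(3,4) G(1) by linarith+
      moreover from calculation have "e 4 \<le> e 0 + 4 * G + 8 * D" "e 0 + 4 * G \<le> e 4 + 8 * D"
        using near(5,6) by linarith+
      moreover from calculation have "e 5 \<le> e 0 + 5 * G + 20 * D" "e 0 + 5 * G \<le> e 5 + 20 * D"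
        using near(7,8) by linarith+
      ultimately show ?thesis using G D_pos by simp
    qed
    moreover have "\<Union>(set ?Xs) = pairs r" unfolding r6 pairs_6 by (simp add: insert_commute)
    ultimately have "T = (\<Sum>X\<leftarrow>?Xs. g X)" unfolding g_def by (rule groups) simp
    then show ?thesis by (simp add: g_def L_def R_def)
  qed
  moreover have gpos: "g X \<ge> 1" if "finite X" "x \<in> X" "X \<subseteq> pairs r" for X x
    unfolding g_def using s_sum_pos [OF that(1,2)] wt_bounds [of x] that by blast
  have "g {(0,2), (1,1)} \<ge> 1" "g {(0,3), (1,2)} \<ge> 1" "g {(0,4), (1,3), (2,2)} \<ge> 1" "g {(0,5), (1,4), (2,3)} \<ge> 1"
      "g {(1,5), (2,4), (3,3)} \<ge> 1" "g {(2,5), (3,4)} \<ge> 1" "g {(3,5), (4,4)} \<ge> 1"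
    by (rule gpos, simp, rule insertI1, simp add: r6 pairs_6)+
  ultimately have g: "g {(0,2), (1,1)} = 1" "g {(0,3), (1,2)} = 1" "g {(0,4), (1,3), (2,2)} = 1"
      "g {(1,5), (2,4), (3,3)} = 1" "g {(3,5), (4,4)} = 1"
    using eqs by linarith+
  have "s (2 ^ (e 0 + e 2 + 1) * B 2 + 2 ^ (e 1 + e 1)) = 1"
    using g(1) by (simp add: g_def b power_add ac_simps)
  moreover have "s (2 ^ (e 0 + e 3) * B 3 + 2 ^ (e 1 + e 2) * B 2) = 1"
  proof -
    have "2 * B 3 * 2 ^ (e 0 + e 3) + 2 * B 2 * 2 ^ (e 1 + e 2) = 2 * (2 ^ (e 0 + e 3) * B 3 + 2 ^ (e 1 + e 2) * B 2)"
      by simp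
    moreover have "s (2 * B 3 * 2 ^ (e 0 + e 3) + 2 * B 2 * 2 ^ (e 1 + e 2)) = 1"
      using g(2) by (simp add: g_def b del: s_double)
    ultimately show ?thesis by (simp only: s_double)
  qed
  moreover have "s (2 ^ (e 3 + e 5 + 1) * B 3 + 2 ^ (e 4 + e 4)) = 1"
    using g(5) by (simp add: g_def b power_add ac_simps)
  moreover have "s (B 2) + s (B 3) = 7" using K eqs b by simp
  ultimately consider "B 2 = 1" "B 3 = 63" | "B 2 = 63" "B 3 = 1"
    using six_cluster_middle [OF o(3,4)] by blast
  then show False
  proof cases
    case 1
    have "s (2 ^ (e 1 + e 5 + 1) + 2 ^ (e 2 + e 4 + 1) + 2 ^ (e 3 + e 3) * 3969) = 1"
      using g(4) by (simp add: g_def b 1 power_add ac_simps)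
    then show False using three_powers_ne_one [of 3969] by simp
  next
    case 2
    have "s (2 ^ (e 0 + e 4 + 1) + 2 ^ (e 1 + e 3 + 1) + 2 ^ (e 2 + e 2) * 3969) = 1"
      using g(3) by (simp add: g_def b 2 power_add ac_simps)
    then show False using three_powers_ne_one [of 3969] by simp
  qed
qed

lemma many_clusters:
  assumes r7: "7 \<le> r"
  shows "K < T"
proof -
  define xs where "xs = map (\<lambda>j. ((0, j), False)) [0..<r] @ map (\<lambda>i. ((i, r - 1), False)) [1..<r]"
  have "(\<Sum>(x, t)\<leftarrow>xs. if t then s (wt x) else 1) \<le> T"
  proof (rule chain_sorted)
    show "fst ` set xs \<subseteq> pairs r" using r by (auto simp: xs_def pairs_def)
    have less: "e i + D \<le> e j" if "i < j" "j < r" for i j using e_less [OF that] by linarith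
    have "e 0 + e j + D \<le> e i + e (r - 1)" if "j < r" "1 \<le> i" "i < r" for i j
    proof -
      have "e j \<le> e (r - 1)" using that by (intro e_le) linarith+
      then show ?thesis using less [of 0 i] that by simp
    qed
    then show "sorted_wrt (\<lambda>x y. pos (fst x) + D \<le> pos (fst y)) xs"
      unfolding xs_def sorted_wrt_append sorted_wrt_map using less by (auto simp: sorted_wrt_iff_nth_less)
  qed (auto simp: xs_def)
  moreover have "(\<Sum>(x, t)\<leftarrow>xs. if t then s (wt x) else 1) = r + (r - 1)"
    by (simp add: xs_def comp_def sum_list_triv)
  ultimately show ?thesis using r7 K_le by linarith
qed

lemma more_ones: "K < T"
proof -
  consider "r = 2" | "r = 3" | "r = 4" | "r = 5" | "r = 6" | "7 \<le> r" using r by linarith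
  then show ?thesis
    by cases (rule two_clusters three_clusters four_clusters five_clusters six_clusters many_clusters, assumption)+
qed

end

section \<open>Decomposition into clusters\<close>

text \<open>
  In a list of pairs \<open>(b, g)\<close> the number \<open>g\<close> is the distance from the start of the cluster \<open>b\<close> to the start of the next one.
\<close>

fun cluster_value :: "(nat \<times> nat) list \<Rightarrow> nat" where
  "cluster_value [] = 0"
| "cluster_value ((b, g) # xs) = b + 2 ^ g * cluster_value xs"

definition cluster_list :: "nat \<Rightarrow> (nat \<times> nat) list \<Rightarrow> bool" where
  "cluster_list m xs \<longleftrightarrow> (\<forall>(b, g)\<in>set xs. odd b \<and> b < 2 ^ m \<and> b < 2 ^ g)"

definition min_gap :: "nat \<Rightarrow> nat" where
  "min_gap m = 100 * (67 * (2 * m + 8))"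

text \<open>The \<open>g\<close> of the last cluster has no successor and is not
  constrained.\<close>

definition separated_list :: "nat \<Rightarrow> (nat \<times> nat) list \<Rightarrow> bool" where
  "separated_list m xs \<longleftrightarrow> (\<forall>i. Suc i < length xs \<longrightarrow> min_gap m \<le> snd (xs ! i))"

lemma cluster_value_merge:
  "cluster_value (xs @ (b, g) # (b', g') # ys) = cluster_value (xs @ (b + 2 ^ g * b', g + g') # ys)"
  by (induction xs rule: cluster_value.induct) (simp_all add: algebra_simps power_add)

lemma cluster_value_sum:
  "cluster_value xs = (\<Sum>i<length xs. fst (xs ! i) * 2 ^ (\<Sum>j<i. snd (xs ! j)))"
proof (induction xs rule: cluster_value.induct)
  case (2 b g xs)
  have "(\<Sum>i<length ((b, g) # xs). fst (((b, g) # xs) ! i) * 2 ^ (\<Sum>j<i. snd (((b, g) # xs) ! j)))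
      = b + (\<Sum>i<length xs. fst (xs ! i) * 2 ^ (g + (\<Sum>j<i. snd (xs ! j))))"
    by (simp add: sum.lessThan_Suc_shift del: sum.lessThan_Suc)
  also have "\<dots> = b + 2 ^ g * cluster_value xs"
    by (simp add: 2 power_add sum_distrib_left ac_simps)
  finally show ?case by simp
qed simp

lemma s_cluster_value: "cluster_list m xs \<Longrightarrow> s (cluster_value xs) = (\<Sum>i<length xs. s (fst (xs ! i)))"
proof (induction xs rule: cluster_value.induct)
  case (2 b g xs)
  then have "b < 2 ^ g" "cluster_list m xs" by (auto simp: cluster_list_def)
  then show ?case using 2
    by (simp add: s_split sum.lessThan_Suc_shift del: sum.lessThan_Suc)
qed simp

text \<open>A distance \<open>g < min_gap m\<close> puts the merged cluster below
  \<open>2 ^ (m + min_gap m)\<close>: one cluster fewer at a scale that depends on \<open>m\<close>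
  only.\<close>

lemma merge_clusters:
  assumes xs: "cluster_list m xs" "\<not> separated_list m xs"
  shows "\<exists>ys. cluster_list (m + min_gap m) ys \<and> length xs = Suc (length ys) \<and> ys \<noteq> []
    \<and> cluster_value ys = cluster_value xs"
proof -
  obtain i where i: "Suc i < length xs" "snd (xs ! i) < min_gap m"
    using xs(2) by (auto simp: separated_list_def)
  obtain b g b' g' where bg: "xs ! i = (b, g)" "xs ! Suc i = (b', g')" by (metis surj_pair)
  define us vs where "us = take i xs" and "vs = drop (Suc (Suc i)) xs"
  have xs_eq: "xs = us @ (b, g) # (b', g') # vs"
    unfolding us_def vs_def using i(1) bg
    by (metis Cons_nth_drop_Suc Suc_lessD id_take_nth_drop)
  define ys where "ys = us @ (b + 2 ^ g * b', g + g') # vs"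
  have b: "odd b" "b < 2 ^ g" "odd b'" "b' < 2 ^ m" "b' < 2 ^ g'" using xs(1) by (auto simp: cluster_list_def xs_eq)
  have "g \<noteq> 0" using b(1,2) by (intro notI) simp
  have less: "b + 2 ^ g * b' < 2 ^ (g + p)" if "b' < 2 ^ p" for p
  proof -
    have "b + 2 ^ g * b' < 2 ^ g * (b' + 1)" using b(2) by (simp add: algebra_simps)
    also have "\<dots> \<le> 2 ^ g * 2 ^ p" using that by (intro mult_left_mono) auto
    finally show ?thesis by (simp add: power_add)
  qed
  have "(2::nat) ^ (g + m) \<le> 2 ^ (m + min_gap m)" using i bg by (intro power_increasing) auto
  then have "b + 2 ^ g * b' < 2 ^ (m + min_gap m)" using less [OF b(4)] by linarith
  moreover have "(2::nat) ^ m \<le> 2 ^ (m + min_gap m)" by (intro power_increasing) auto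
  then have "t < 2 ^ (m + min_gap m)" if "t < 2 ^ m" for t :: nat using that by linarith
  ultimately have "cluster_list (m + min_gap m) ys"
    using xs(1) b less [OF b(5)] \<open>g \<noteq> 0\<close> unfolding cluster_list_def xs_eq ys_def by auto
  then show ?thesis using cluster_value_merge unfolding xs_eq by (intro exI [of _ ys]) (simp add: ys_def)
qed

text \<open>Merging stops at a separated list or, after at most \<open>l\<close> steps, at a single
  cluster, which is bounded by the scale reached.\<close>

lemma separate_clusters:
  assumes "cluster_list m xs" "length xs = Suc l"
  shows "(\<exists>m' ys. cluster_list m' ys \<and> separated_list m' ys \<and> 2 \<le> length ys \<and> length ys \<le> length xs
      \<and> cluster_value ys = cluster_value xs)
    \<or> cluster_value xs < 2 ^ ((\<lambda>m. m + min_gap m) ^^ l) m"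
  using assms
proof (induction l arbitrary: m xs)
  case 0
  then obtain b g where "xs = [(b, g)]" by (cases xs) auto
  then show ?case using 0 by (simp add: cluster_list_def)
next
  case (Suc l)
  show ?case
  proof (cases "separated_list m xs")
    case True
    then show ?thesis using Suc.prems by (intro disjI1 exI [of _ m] exI [of _ xs]) simp
  next
    case False
    obtain ys where ys: "cluster_list (m + min_gap m) ys" "length xs = Suc (length ys)"
      "cluster_value ys = cluster_value xs"
      using merge_clusters [OF Suc.prems(1) False] by blast
    have "length ys = Suc l" "length ys \<le> length xs" using ys Suc.prems by simp_all
    then show ?thesis using Suc.IH [OF ys(1)] unfolding ys(3) funpow_Suc_right comp_def
      by (meson order_trans)
  qed
qed

lemma bit_clusters:
  assumes "odd n"
  shows "\<exists>xs. cluster_list 1 xs \<and> length xs = s n \<and> cluster_value xs = n"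
  using assms
proof (induction n rule: less_induct)
  case (less n)
  show ?case
  proof (cases "n = 1")
    case True
    then show ?thesis by (intro exI [of _ "[(1, 1)]"]) (simp add: cluster_list_def)
  next
    case False
    then have "n - 1 > 0" using odd_pos [OF less.prems] by linarith
    then obtain p m where pm: "n - 1 = 2 ^ p * m" "odd m" "s m = s (n - 1)" by (rule s_shift_odd)
    have n: "n = 1 + 2 ^ p * m" using pm(1) odd_pos [OF less.prems] by linarith
    have p: "p \<noteq> 0" using n less.prems pm(2) by (intro notI) simp
    then have one: "1 < (2::nat) ^ p" by (intro one_less_power) auto
    have "1 * m \<le> 2 ^ p * m" using one by (intro mult_right_mono) auto
    then have "m < n" using n by linarith
    then obtain xs where xs: "cluster_list 1 xs" "length xs = s m" "cluster_value xs = m"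
      using less.IH pm(2) by blast
    have "s n = 1 + s m" unfolding n using s_split [OF one, of m] by simp
    then show ?thesis using xs one n
      by (intro exI [of _ "(1, p) # xs"]) (simp add: cluster_list_def)
  qed
qed

lemma separated_more_ones:
  assumes xs: "cluster_list m xs" "separated_list m xs" "2 \<le> length xs"
    and k: "length xs \<le> 11" "s (cluster_value xs) \<le> 11"
  shows "s (cluster_value xs) < s ((cluster_value xs)\<^sup>2)"
proof -
  interpret separated_clusters "length xs" m "\<lambda>i. fst (xs ! i)" "\<lambda>i. \<Sum>j<i. snd (xs ! j)"
    "cluster_value xs" "67 * (2 * m + 8)" "s ((cluster_value xs)\<^sup>2)" "s (cluster_value xs)"
  proof
    show "odd (fst (xs ! i))" "fst (xs ! i) < 2 ^ m" if "i < length xs" for i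
      using xs(1) nth_mem [OF that] by (cases "xs ! i"; fastforce simp: cluster_list_def)+
    show "(\<Sum>j<i. snd (xs ! j)) + 100 * (67 * (2 * m + 8)) \<le> (\<Sum>j<Suc i. snd (xs ! j))"
      if "Suc i < length xs" for i
      using xs(2) that by (simp add: separated_list_def min_gap_def)
    show "s (cluster_value xs) = (\<Sum>i<length xs. s (fst (xs ! i)))" by (rule s_cluster_value [OF xs(1)])
    show "cluster_value xs = (\<Sum>i<length xs. fst (xs ! i) * 2 ^ (\<Sum>j<i. snd (xs ! j)))"
      by (rule cluster_value_sum)
  qed (use xs k in simp_all)
  show ?thesis by (rule more_ones)
qed

theorem theorem1:
  fixes k :: nat
  assumes "k \<in> {9, 10, 11}"
  shows "finite {n :: nat. 0 < n \<and> odd n \<and> binary_digit_sum n = k \<and> binary_digit_sum (n\<^sup>2) = k}"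
proof (rule finite_subset)
  \<comment> \<open>The list starts with one cluster per digit at scale 1, so \<open>k - 1\<close>
    mergers are the most that can happen, and the bound does not depend on \<open>n\<close>.\<close>
  define N where "N = (2::nat) ^ ((\<lambda>m. m + min_gap m) ^^ (k - 1)) 1"
  show "{n :: nat. 0 < n \<and> odd n \<and> binary_digit_sum n = k \<and> binary_digit_sum (n\<^sup>2) = k} \<subseteq> {..<N}"
  proof clarify
    fix n :: nat
    assume n: "odd n" "k = binary_digit_sum n" "binary_digit_sum (n\<^sup>2) = binary_digit_sum n"
    have k: "s n \<le> 11" "s n = Suc (k - 1)" using assms n(2) by auto
    obtain xs where xs: "cluster_list 1 xs" "length xs = s n" "cluster_value xs = n"
      using bit_clusters [OF n(1)] by blast
    have False if "cluster_list m ys" "separated_list m ys" "2 \<le> length ys" "length ys \<le> length xs"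
      "cluster_value ys = n" for m ys
      using separated_more_ones [OF that(1-3)] that(4,5) k xs(2) n(3) by simp
    then show "n < N"
      using separate_clusters [OF xs(1), of "k - 1"] xs k unfolding N_def by auto
  qed
qed simp

end
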